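(* Let $\mathscr G$ be an ample groupoid and $\mathcal O$ a $\mathscr G$-sheaf of rings. Suppose that there is an invariant subset $X\subseteq\mathscr G^{(0)}$ such that each orbit contained in $X$ contains some $x$ with $B_x$ semiprimitive, and such that, for $f\in\Gamma_c(\mathscr G,\mathcal O)$, $f|_{\mathscr G|_X}=0$ implies $f=0$. Then $\Gamma_c(\mathscr G,\mathcal O)$ is semiprimitive.
   Context: "Compact" includes Hausdorff. A groupoid $\mathscr G$ (identified with its set of arrows) has unit space $\mathscr G^{(0)}$, $\boldsymbol d(\gamma)=\gamma^{-1}\gamma$, $\boldsymbol r(\gamma)=\gamma\gamma^{-1}$. It is ample if it is a topological groupoid such that $\mathscr G^{(0)}$ is locally compact Hausdorff with a basis of compact open sets and $\boldsymbol r$ is a local homeomorphism. A bisection is a subset on which $\boldsymbol d$ and $\boldsymbol r$ are injective. For $x\in\mathscr G^{(0)}$, the orbit of $x$ is $\mathrm{Orb}(x)=\boldsymbol r(\boldsymbol d^{-1}(x))$ and $\mathscr G_x^x=\{g:\boldsymbol d(g)=\boldsymbol r(g)=x\}$. A subset $X\subseteq\mathscr G^{(0)}$ is invariant if for all $\gamma\in\mathscr G$, $\boldsymbol d(\gamma)\in X$ iff $\boldsymbol r(\gamma)\in X$; then $\mathscr G|_X=\{\gamma\in\mathscr G:\boldsymbol d(\gamma)\in X\}$ is the restriction of $\mathscr G$ to $X$. A $\mathscr G$-sheaf $(E,p,\alpha)$ is a space $E$, a local homeomorphism $p:E\to\mathscr G^{(0)}$ and a continuous map $\alpha:\mathscr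 G\times_{\boldsymbol d,p}E\to E$, $(\gamma,e)\mapsto\alpha_\gamma(e)$, with $\alpha_{p(e)}(e)=e$, $p(\alpha_\gamma(e))=\boldsymbol r(\gamma)$, and $\alpha_\beta(\alpha_\gamma(e))=\alpha_{\beta\gamma}(e)$ whenever defined. The stalk at $x$ is $p^{-1}(x)$. A $\mathscr G$-sheaf of rings $\mathcal O=(E,p,\alpha)$ is a $\mathscr G$-sheaf with a unital ring structure on each stalk $\mathcal O_x$ such that fiberwise addition and multiplication $E\times_{p,p}E\to E$ and the unit section $x\mapsto 1_x$ are continuous, and each $\alpha_\gamma:\mathcal O_{\boldsymbol d(\gamma)}\to\mathcal O_{\boldsymbol r(\gamma)}$ is a (unital) ring homomorphism. $\Gamma_c(\mathscr G,\mathcal O)$ is the additive group generated by all maps $f:\mathscr G\to E$ with $p\circ f=\boldsymbol r$ for which there is a compact open bisection $U$ with $f|_U$ continuous and $f=0$ off $U$. It is a ring under pointwise addition and convolution $(f*g)(\gamma)=\sum_{\beta\rho=\gamma}f(\beta)\alpha_\beta(g(\rho))$. $B_x=\mathcal O_x\rtimes\mathscr G_x^x$ is the skew group ring, with product $(b\delta)(c\eta)=b\alpha_\delta(c)\,\delta\eta$ for $b,c\in\mathcal O_x$, $\delta,\eta\in\mathscr G_x^x$. A ring is semiprimitive if its Jacobson radical is zero; equivalently, if it has a faithful semisimple module. *)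

theory Defs
  imports "HOL-Analysis.Analysis" "HOL-Algebra.Generated_Groups" "HOL-Algebra.Ideal"
begin

definition local_homeomorphism :: "'a topology \<Rightarrow> 'b topology \<Rightarrow> ('a \<Rightarrow> 'b) \<Rightarrow> bool" where
  "local_homeomorphism X Y f \<longleftrightarrow>
     (\<forall>x \<in> topspace X. \<exists>U. openin X U \<and> x \<in> U \<and> openin Y (f ` U) \<and>
        homeomorphic_map (subtopology X U) (subtopology Y (f ` U)) f)"

text \<open>
  A groupoid is identified with its set of arrows, which is the underlying set of \<open>gtop\<close>.
  The total function \<open>gmult\<close> is only meaningful on composable pairs, i.e.\ pairs
  \<open>(\<beta>, \<gamma>)\<close> with \<open>gdom G \<beta> = gran G \<gamma>\<close>.
\<close>

record 'g groupoid =
  gtop :: "'g topology"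
  gmult :: "'g \<Rightarrow> 'g \<Rightarrow> 'g"
  ginv :: "'g \<Rightarrow> 'g"

definition arrows :: "'g groupoid \<Rightarrow> 'g set" where
  "arrows G = topspace (gtop G)"

definition gdom :: "'g groupoid \<Rightarrow> 'g \<Rightarrow> 'g" where
  "gdom G \<gamma> = gmult G (ginv G \<gamma>) \<gamma>"

definition gran :: "'g groupoid \<Rightarrow> 'g \<Rightarrow> 'g" where
  "gran G \<gamma> = gmult G \<gamma> (ginv G \<gamma>)"

definition units :: "'g groupoid \<Rightarrow> 'g set" where
  "units G = gdom G ` arrows G"

definition unit_space :: "'g groupoid \<Rightarrow> 'g topology" where
  "unit_space G = subtopology (gtop G) (units G)"

locale groupoid =
  fixes G :: "'g groupoid"
  assumes inv_closed: "\<gamma> \<in> arrows G \<Longrightarrow> ginv G \<gamma> \<in> arrows G"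
    and inv_inv: "\<gamma> \<in> arrows G \<Longrightarrow> ginv G (ginv G \<gamma>) = \<gamma>"
    and mult_closed: "\<lbrakk>\<beta> \<in> arrows G; \<gamma> \<in> arrows G; gdom G \<beta> = gran G \<gamma>\<rbrakk> \<Longrightarrow> gmult G \<beta> \<gamma> \<in> arrows G"
    and dom_mult: "\<lbrakk>\<beta> \<in> arrows G; \<gamma> \<in> arrows G; gdom G \<beta> = gran G \<gamma>\<rbrakk> \<Longrightarrow> gdom G (gmult G \<beta> \<gamma>) = gdom G \<gamma>"
    and ran_mult: "\<lbrakk>\<beta> \<in> arrows G; \<gamma> \<in> arrows G; gdom G \<beta> = gran G \<gamma>\<rbrakk> \<Longrightarrow> gran G (gmult G \<beta> \<gamma>) = gran G \<beta>"
    and mult_assoc: "\<lbrakk>\<beta> \<in> arrows G; \<gamma> \<in> arrows G; \<delta> \<in> arrows G; gdom G \<beta> = gran G \<gamma>; gdom G \<gamma> = gran G \<delta>\<rbrakk>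
      \<Longrightarrow> gmult G (gmult G \<beta> \<gamma>) \<delta> = gmult G \<beta> (gmult G \<gamma> \<delta>)"
    and mult_dom: "\<gamma> \<in> arrows G \<Longrightarrow> gmult G \<gamma> (gdom G \<gamma>) = \<gamma>"
    and ran_mult_self: "\<gamma> \<in> arrows G \<Longrightarrow> gmult G (gran G \<gamma>) \<gamma> = \<gamma>"

locale topological_groupoid = groupoid +
  assumes continuous_mult:
      "continuous_map
         (subtopology (prod_topology (gtop G) (gtop G)) {(\<beta>, \<gamma>). gdom G \<beta> = gran G \<gamma>})
         (gtop G) (\<lambda>(\<beta>, \<gamma>). gmult G \<beta> \<gamma>)"
    and continuous_inv: "continuous_map (gtop G) (gtop G) (ginv G)"

locale ample_groupoid = topological_groupoid +
  assumes unit_space_locally_compact: "locally_compact_space (unit_space G)"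
    and unit_space_Hausdorff: "Hausdorff_space (unit_space G)"
    and unit_space_compact_open_basis:
      "neighbourhood_base_of (\<lambda>K. compactin (unit_space G) K \<and> openin (unit_space G) K) (unit_space G)"
    and ran_local_homeomorphism: "local_homeomorphism (gtop G) (unit_space G) (gran G)"

definition bisection :: "'g groupoid \<Rightarrow> 'g set \<Rightarrow> bool" where
  "bisection G U \<longleftrightarrow> U \<subseteq> arrows G \<and> inj_on (gdom G) U \<and> inj_on (gran G) U"

text \<open>
  The space of arrows need not be Hausdorff, whereas a compact set is Hausdorff by convention.
\<close>

definition compact_open_bisection :: "'g groupoid \<Rightarrow> 'g set \<Rightarrow> bool" where
  "compact_open_bisection G U \<longleftrightarrow>
     bisection G U \<and> openin (gtop G) U \<and>
     compactin (gtop G) U \<and> Hausdorff_space (subtopology (gtop G) U)"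

definition orbit :: "'g groupoid \<Rightarrow> 'g \<Rightarrow> 'g set" where
  "orbit G x = gran G ` {\<gamma> \<in> arrows G. gdom G \<gamma> = x}"

definition isotropy :: "'g groupoid \<Rightarrow> 'g \<Rightarrow> 'g monoid" where
  "isotropy G x =
     \<lparr>carrier = {\<gamma> \<in> arrows G. gdom G \<gamma> = x \<and> gran G \<gamma> = x}, mult = gmult G, one = x\<rparr>"

definition invariant_set :: "'g groupoid \<Rightarrow> 'g set \<Rightarrow> bool" where
  "invariant_set G X \<longleftrightarrow> X \<subseteq> units G \<and> (\<forall>\<gamma> \<in> arrows G. gdom G \<gamma> \<in> X \<longleftrightarrow> gran G \<gamma> \<in> X)"

definition restriction :: "'g groupoid \<Rightarrow> 'g set \<Rightarrow> 'g set" where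
  "restriction G X = {\<gamma> \<in> arrows G. gdom G \<gamma> \<in> X}"

record ('g, 'e) gsheaf =
  etop :: "'e topology"
  proj :: "'e \<Rightarrow> 'g"
  act :: "'g \<Rightarrow> 'e \<Rightarrow> 'e"

text \<open>
  The stalkwise ring operations are glued to global (total) functions, which are only meaningful
  for two elements of the same stalk.
\<close>

record ('g, 'e) gsheaf_rings = "('g, 'e) gsheaf" +
  eadd :: "'e \<Rightarrow> 'e \<Rightarrow> 'e"
  emult :: "'e \<Rightarrow> 'e \<Rightarrow> 'e"
  ezero :: "'g \<Rightarrow> 'e"
  eone :: "'g \<Rightarrow> 'e"

definition stalk :: "('g, 'e) gsheaf_rings \<Rightarrow> 'g \<Rightarrow> 'e ring" where
  "stalk S x =
     \<lparr>carrier = {e \<in> topspace (etop S). proj S e = x}, mult = emult S, one = eone S x,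
      zero = ezero S x, add = eadd S\<rparr>"

locale gsheaf =
  fixes G :: "'g groupoid" and S :: "('g, 'e, 'm) gsheaf_scheme"
  assumes proj_local_homeomorphism: "local_homeomorphism (etop S) (unit_space G) (proj S)"
    and continuous_act:
      "continuous_map
         (subtopology (prod_topology (gtop G) (etop S)) {(\<gamma>, e). gdom G \<gamma> = proj S e})
         (etop S) (\<lambda>(\<gamma>, e). act S \<gamma> e)"
    and act_unit: "e \<in> topspace (etop S) \<Longrightarrow> act S (proj S e) e = e"
    and proj_act: "\<lbrakk>\<gamma> \<in> arrows G; e \<in> topspace (etop S); gdom G \<gamma> = proj S e\<rbrakk>
      \<Longrightarrow> proj S (act S \<gamma> e) = gran G \<gamma>"
    and act_act: "\<lbrakk>\<beta> \<in> arrows G; \<gamma> \<in> arrows G; e \<in> topspace (etop S);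
        gdom G \<beta> = gran G \<gamma>; gdom G \<gamma> = proj S e\<rbrakk>
      \<Longrightarrow> act S \<beta> (act S \<gamma> e) = act S (gmult G \<beta> \<gamma>) e"

locale gsheaf_of_rings = gsheaf G S
  for G :: "'g groupoid" and S :: "('g, 'e) gsheaf_rings" +
  assumes ring_stalk: "x \<in> units G \<Longrightarrow> ring (stalk S x)"
    and continuous_add:
      "continuous_map
         (subtopology (prod_topology (etop S) (etop S)) {(a, b). proj S a = proj S b})
         (etop S) (\<lambda>(a, b). eadd S a b)"
    and continuous_emult:
      "continuous_map
         (subtopology (prod_topology (etop S) (etop S)) {(a, b). proj S a = proj S b})
         (etop S) (\<lambda>(a, b). emult S a b)"
    and continuous_one: "continuous_map (unit_space G) (etop S) (eone S)"
    and act_ring_hom: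
      "\<gamma> \<in> arrows G \<Longrightarrow> act S \<gamma> \<in> ring_hom (stalk S (gdom G \<gamma>)) (stalk S (gran G \<gamma>))"

text \<open>
  All maps \<open>f\<close> from arrows to the sheaf space with \<open>proj \<circ> f = gran\<close>, with the pointwise
  addition and convolution.  The sum defining \<open>(f * g) \<gamma>\<close> is taken over those \<open>(\<beta>, \<rho>)\<close> with
  \<open>\<beta>\<rho> = \<gamma>\<close> for which \<open>f \<beta>\<close> and \<open>g \<rho>\<close> are nonzero; for \<open>f\<close> and \<open>g\<close> in \<open>gamma_c\<close> there are
  finitely many of these.  The convolution identity in the field \<open>one\<close> need not belong to
  \<open>gamma_c\<close>, which is in general a ring without unit.
\<close>

definition all_sections :: "'g groupoid \<Rightarrow> ('g, 'e) gsheaf_rings \<Rightarrow> ('g \<Rightarrow> 'e) ring" where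
  "all_sections G S =
     \<lparr>carrier = (\<Pi>\<^sub>E \<gamma> \<in> arrows G. carrier (stalk S (gran G \<gamma>))),
      mult = (\<lambda>f g. \<lambda>\<gamma> \<in> arrows G.
        finsum (stalk S (gran G \<gamma>))
          (\<lambda>(\<beta>, \<rho>). emult S (f \<beta>) (act S \<beta> (g \<rho>)))
          {(\<beta>, \<rho>). \<beta> \<in> arrows G \<and> \<rho> \<in> arrows G \<and> gdom G \<beta> = gran G \<rho> \<and> gmult G \<beta> \<rho> = \<gamma> \<and>
             f \<beta> \<noteq> ezero S (gran G \<beta>) \<and> g \<rho> \<noteq> ezero S (gran G \<rho>)}),
      one = (\<lambda>\<gamma> \<in> arrows G. if \<gamma> \<in> units G then eone S \<gamma> else ezero S (gran G \<gamma>)),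
      zero = (\<lambda>\<gamma> \<in> arrows G. ezero S (gran G \<gamma>)),
      add = (\<lambda>f g. \<lambda>\<gamma> \<in> arrows G. eadd S (f \<gamma>) (g \<gamma>))\<rparr>"

definition elementary_sections :: "'g groupoid \<Rightarrow> ('g, 'e) gsheaf_rings \<Rightarrow> ('g \<Rightarrow> 'e) set" where
  "elementary_sections G S =
     {f \<in> carrier (all_sections G S). \<exists>U. compact_open_bisection G U \<and>
        continuous_map (subtopology (gtop G) U) (etop S) f \<and>
        (\<forall>\<gamma> \<in> arrows G - U. f \<gamma> = ezero S (gran G \<gamma>))}"

definition gamma_c :: "'g groupoid \<Rightarrow> ('g, 'e) gsheaf_rings \<Rightarrow> ('g \<Rightarrow> 'e) ring" where
  "gamma_c G S =
     (all_sections G S)\<lparr>carrier := generate (add_monoid (all_sections G S)) (elementary_sections G S)\<rparr>"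

text \<open>
  The element \<open>\<Sum>\<delta>. a \<delta> \<delta>\<close> of the skew group ring of \<open>H\<close> over \<open>R\<close> is encoded as the finitely
  supported coefficient function \<open>a\<close>; \<open>\<alpha>\<close> is the action of \<open>H\<close> on \<open>R\<close>.  The product is the
  biadditive extension of \<open>(b \<delta>) (c \<eta>) = b \<alpha>\<^sub>\<delta>(c) \<delta>\<eta>\<close>.
\<close>

definition skew_group_ring ::
    "('b, 'm) ring_scheme \<Rightarrow> ('h, 'n) monoid_scheme \<Rightarrow> ('h \<Rightarrow> 'b \<Rightarrow> 'b) \<Rightarrow> ('h \<Rightarrow> 'b) ring" where
  "skew_group_ring R H \<alpha> =
     \<lparr>carrier = {a \<in> carrier H \<rightarrow>\<^sub>E carrier R. finite {\<delta> \<in> carrier H. a \<delta> \<noteq> \<zero>\<^bsub>R\<^esub>}},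
      mult = (\<lambda>a b. \<lambda>\<gamma> \<in> carrier H.
        finsum R (\<lambda>(\<delta>, \<eta>). a \<delta> \<otimes>\<^bsub>R\<^esub> \<alpha> \<delta> (b \<eta>))
          {(\<delta>, \<eta>). \<delta> \<in> carrier H \<and> \<eta> \<in> carrier H \<and> \<delta> \<otimes>\<^bsub>H\<^esub> \<eta> = \<gamma> \<and>
             a \<delta> \<noteq> \<zero>\<^bsub>R\<^esub> \<and> b \<eta> \<noteq> \<zero>\<^bsub>R\<^esub>}),
      one = (\<lambda>\<gamma> \<in> carrier H. if \<gamma> = \<one>\<^bsub>H\<^esub> then \<one>\<^bsub>R\<^esub> else \<zero>\<^bsub>R\<^esub>),
      zero = (\<lambda>\<gamma> \<in> carrier H. \<zero>\<^bsub>R\<^esub>),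
      add = (\<lambda>a b. \<lambda>\<gamma> \<in> carrier H. a \<gamma> \<oplus>\<^bsub>R\<^esub> b \<gamma>)\<rparr>"

definition isotropy_skew_ring :: "'g groupoid \<Rightarrow> ('g, 'e) gsheaf_rings \<Rightarrow> 'g \<Rightarrow> ('g \<Rightarrow> 'e) ring" where
  "isotropy_skew_ring G S x = skew_group_ring (stalk S x) (isotropy G x) (act S)"

text \<open>
  The Jacobson radical of a ring that need not have a unit is the intersection of its modular
  (or regular) maximal left ideals, i.e.\ the intersection of the annihilators of its simple left
  modules; it is the whole ring if there are none.  None of the definitions below refers to the field \<open>one\<close>.
\<close>

definition left_ideal :: "'a set \<Rightarrow> ('a, 'm) ring_scheme \<Rightarrow> bool" where
  "left_ideal I R \<longleftrightarrow>
     additive_subgroup I R \<and> (\<forall>r \<in> carrier R. \<forall>a \<in> I. r \<otimes>\<^bsub>R\<^esub> a \<in> I)"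

definition maximal_left_ideal :: "'a set \<Rightarrow> ('a, 'm) ring_scheme \<Rightarrow> bool" where
  "maximal_left_ideal M R \<longleftrightarrow>
     left_ideal M R \<and> M \<noteq> carrier R \<and>
     (\<forall>J. left_ideal J R \<and> M \<subseteq> J \<longrightarrow> J = M \<or> J = carrier R)"

definition modular_left_ideal :: "'a set \<Rightarrow> ('a, 'm) ring_scheme \<Rightarrow> bool" where
  "modular_left_ideal I R \<longleftrightarrow>
     left_ideal I R \<and> (\<exists>e \<in> carrier R. \<forall>r \<in> carrier R. r \<ominus>\<^bsub>R\<^esub> r \<otimes>\<^bsub>R\<^esub> e \<in> I)"

definition jacobson_radical :: "('a, 'm) ring_scheme \<Rightarrow> 'a set" where
  "jacobson_radical R =
     {a \<in> carrier R. \<forall>M. maximal_left_ideal M R \<and> modular_left_ideal M R \<longrightarrow> a \<in> M}"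

definition semiprimitive :: "('a, 'm) ring_scheme \<Rightarrow> bool" where
  "semiprimitive R \<longleftrightarrow> jacobson_radical R = {\<zero>\<^bsub>R\<^esub>}"

lemma (in ring) jacobson_radical_unital:
  "jacobson_radical R = {a \<in> carrier R. \<forall>M. maximal_left_ideal M R \<longrightarrow> a \<in> M}"
proof -
  have "modular_left_ideal M R" if "maximal_left_ideal M R" for M
  proof -
    have M: "left_ideal M R"
      using that by (simp add: maximal_left_ideal_def)
    then have "\<zero> \<in> M"
      by (simp add: left_ideal_def additive_subgroup.zero_closed)
    then have "\<forall>r \<in> carrier R. r \<ominus> r \<otimes> \<one> \<in> M"
      by (simp add: a_minus_def r_neg)
    with M show ?thesis
      unfolding modular_left_ideal_def by blast
  qed
  then show ?thesis
    by (auto simp: jacobson_radical_def)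
qed

end

theory Submission
  imports Defs "HOL-Algebra.QuotRing" "HOL-Algebra.UnivPoly"
begin

text \<open>
  Let \<open>C\<close> be the ring of all sections with finite support on every fibre of \<open>gdom\<close>.  It is unital,
  contains \<open>gamma_c\<close> as a subring, and for a unit \<open>x\<close> with indicator section \<open>e\<close> the corner \<open>e C e\<close>
  is \<open>B\<^sub>x\<close>.  Suppose \<open>f\<close> lies in the Jacobson radical of \<open>gamma_c\<close> and \<open>f \<gamma> \<noteq> 0\<close>, where
  \<open>x\<close> is in the orbit of \<open>gdom \<gamma>\<close>.  Multiplying by unit sections \<open>k\<close> and \<open>t\<close>, each supported at
  a single arrow, moves \<open>f \<gamma>\<close> to \<open>x\<close>: the element \<open>F = k f t\<close> of \<open>e C e\<close> has \<open>F x \<noteq> 0\<close>.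
  Elements of \<open>C\<close> agree with elements of \<open>gamma_c\<close> on any finite set of fibres, so for \<open>b\<close> in
  \<open>e C e\<close> there are \<open>h\<close> and \<open>s\<close> in \<open>gamma_c\<close> with \<open>h f s e = b F\<close>.  Since \<open>h f s\<close> is left
  quasi-regular in \<open>gamma_c\<close>, say \<open>a = h f s + a h f s\<close>, multiplying by \<open>e\<close> on both sides shows
  that \<open>b F\<close> is left quasi-regular with quasi-inverse \<open>e a e\<close>.  Hence \<open>F\<close> lies in the Jacobson
  radical of \<open>B\<^sub>x\<close>.
\<close>

section \<open>Groupoids\<close>

text \<open>The obstacle is that \<open>gamma_c G S\<close> need not have a unit and need not
  contain \<open>e\<close>, since a single unit is open only when it is isolated in the unit space.
  Hence the detour through sections without continuity. Finiteness is imposed along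
  \<open>gdom\<close> because of the shape of the convolution: writing
  \<open>\<beta> = \<gamma> \<rho>^-1\<close>, the value at \<open>\<gamma>\<close> is a sum over
  those \<open>\<rho>\<close> that share the source of \<open>\<gamma>\<close>. So a column of a
  product depends on the same column of the right factor and on finitely many columns of the left
  factor. This asymmetry fixes the order of the approximations: the right factor is replaced first,
  on the one column over \<open>x\<close>, and only then the left factor, on the columns that the
  result meets. Modules are avoided. Left quasi-regularity is an equation between elements, so it
  can be compressed by \<open>e\<close>. That radical elements are left quasi-regular is needed for
  the ring without unit; the converse, for all left multiples, is needed only for the unital
  \<open>B_x\<close>. The right factor \<open>s\<close> is absorbed without showing that the radical
  is a right ideal: quasi-regularity passes from \<open>yz\<close> to \<open>zy\<close>.\<close>

context groupoid
begin

declare inv_closed [simp] inv_inv [simp]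

lemma gdom_ginv [simp]: "\<gamma> \<in> arrows G \<Longrightarrow> gdom G (ginv G \<gamma>) = gran G \<gamma>"
  by (simp add: gdom_def gran_def inv_inv)

lemma gran_ginv [simp]: "\<gamma> \<in> arrows G \<Longrightarrow> gran G (ginv G \<gamma>) = gdom G \<gamma>"
  by (simp add: gdom_def gran_def inv_inv)

lemma gdom_closed [simp]: "\<gamma> \<in> arrows G \<Longrightarrow> gdom G \<gamma> \<in> arrows G"
  using mult_closed[of "ginv G \<gamma>" \<gamma>] by (simp add: gdom_def[of G \<gamma>])

lemma gran_closed [simp]: "\<gamma> \<in> arrows G \<Longrightarrow> gran G \<gamma> \<in> arrows G"
  using gdom_closed[of "ginv G \<gamma>"] by simp

lemma gdom_gdom [simp]: "\<gamma> \<in> arrows G \<Longrightarrow> gdom G (gdom G \<gamma>) = gdom G \<gamma>"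
  using dom_mult[of "ginv G \<gamma>" \<gamma>] by (simp add: gdom_def[of G \<gamma>])

lemma gran_gdom [simp]: "\<gamma> \<in> arrows G \<Longrightarrow> gran G (gdom G \<gamma>) = gdom G \<gamma>"
  using ran_mult[of "ginv G \<gamma>" \<gamma>] by (simp add: gdom_def[of G \<gamma>])

lemma gran_gran [simp]: "\<gamma> \<in> arrows G \<Longrightarrow> gran G (gran G \<gamma>) = gran G \<gamma>"
  using gran_gdom[of "ginv G \<gamma>"] by simp

lemma gdom_units [simp]: "\<gamma> \<in> arrows G \<Longrightarrow> gdom G \<gamma> \<in> units G"
  by (simp add: units_def)

lemma gran_units [simp]: "\<gamma> \<in> arrows G \<Longrightarrow> gran G \<gamma> \<in> units G"
  using gdom_units[of "ginv G \<gamma>"] by simp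

lemma units_arrows: "x \<in> units G \<Longrightarrow> x \<in> arrows G"
  by (auto simp: units_def)

lemma gdom_unit [simp]: "x \<in> units G \<Longrightarrow> gdom G x = x"
  by (auto simp: units_def)

lemma gran_unit [simp]: "x \<in> units G \<Longrightarrow> gran G x = x"
  by (metis gdom_unit gran_gdom units_arrows)

lemma mult_ginv_cancel:
  assumes "\<beta> \<in> arrows G" "\<rho> \<in> arrows G" "gdom G \<beta> = gran G \<rho>"
  shows "gmult G (gmult G \<beta> \<rho>) (ginv G \<rho>) = \<beta>"
proof -
  have "gmult G (gmult G \<beta> \<rho>) (ginv G \<rho>) = gmult G \<beta> (gmult G \<rho> (ginv G \<rho>))"
    by (rule mult_assoc) (use assms in simp_all)
  then show ?thesis
    using assms mult_dom[of \<beta>] by (simp add: gran_def)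
qed

lemma ginv_mult_cancel:
  assumes "\<beta> \<in> arrows G" "\<rho> \<in> arrows G" "gdom G \<beta> = gran G \<rho>"
  shows "gmult G (ginv G \<beta>) (gmult G \<beta> \<rho>) = \<rho>"
proof -
  have "gmult G (gmult G (ginv G \<beta>) \<beta>) \<rho> = gmult G (ginv G \<beta>) (gmult G \<beta> \<rho>)"
    by (rule mult_assoc) (use assms in simp_all)
  then show ?thesis
    using assms ran_mult_self[of \<rho>] by (simp add: gdom_def)
qed

text \<open>For fixed \<open>\<gamma>\<close>, the factorisations
  \<open>\<beta> \<rho> = \<gamma>\<close> correspond to the arrows \<open>\<rho>\<close> with the
  same source as \<open>\<gamma>\<close>, with \<open>gdiv \<gamma> \<rho>\<close> as the forced
  left factor. This turns the convolution sum over pairs into a sum over one fibre of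
  \<open>gdom\<close>.\<close>

definition gdiv :: "'g \<Rightarrow> 'g \<Rightarrow> 'g" where
  "gdiv \<gamma> \<rho> = gmult G \<gamma> (ginv G \<rho>)"

context
  fixes \<gamma> \<rho>
  assumes gr: "\<gamma> \<in> arrows G" "\<rho> \<in> arrows G" "gdom G \<gamma> = gdom G \<rho>"
begin

lemma gdiv_closed [simp]: "gdiv \<gamma> \<rho> \<in> arrows G"
  and gdom_gdiv [simp]: "gdom G (gdiv \<gamma> \<rho>) = gran G \<rho>"
  and gran_gdiv [simp]: "gran G (gdiv \<gamma> \<rho>) = gran G \<gamma>"
  using gr mult_closed dom_mult ran_mult by (simp_all add: gdiv_def)

lemma gdiv_mult [simp]: "gmult G (gdiv \<gamma> \<rho>) \<rho> = \<gamma>"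
  using mult_ginv_cancel[of \<gamma> "ginv G \<rho>"] gr by (simp add: gdiv_def inv_inv)

end

lemma mult_gdiv [simp]:
  assumes "\<beta> \<in> arrows G" "\<rho> \<in> arrows G" "gdom G \<beta> = gran G \<rho>"
  shows "gdiv (gmult G \<beta> \<rho>) \<rho> = \<beta>"
  using mult_ginv_cancel[OF assms] by (simp add: gdiv_def)

text \<open>Cancel on the right in
  \<open>\<gamma> \<rho>^-1 = (\<gamma> \<tau>^-1)(\<tau> \<rho>^-1)\<close>. This is the change of
  variables that matches the two bracketings of a triple convolution.\<close>

lemma gdiv_gdiv:
  assumes "\<gamma> \<in> arrows G" "\<tau> \<in> arrows G" "\<rho> \<in> arrows G" "gdom G \<gamma> = gdom G \<rho>" "gdom G \<tau> = gdom G \<rho>"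
  shows "gdiv (gdiv \<gamma> \<rho>) (gdiv \<tau> \<rho>) = gdiv \<gamma> \<tau>"
proof -
  have "gmult G (gmult G (gdiv \<gamma> \<tau>) (gdiv \<tau> \<rho>)) \<rho> = gmult G (gdiv \<gamma> \<tau>) (gmult G (gdiv \<tau> \<rho>) \<rho>)"
    by (rule mult_assoc) (use assms in simp_all)
  then have "gmult G (gmult G (gdiv \<gamma> \<tau>) (gdiv \<tau> \<rho>)) \<rho> = \<gamma>"
    using assms by simp
  then have "gdiv \<gamma> \<rho> = gmult G (gdiv \<gamma> \<tau>) (gdiv \<tau> \<rho>)"
    using assms mult_gdiv[of "gmult G (gdiv \<gamma> \<tau>) (gdiv \<tau> \<rho>)" \<rho>]
    by (simp add: mult_closed dom_mult)
  then show ?thesis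
    using assms by simp
qed

end

section \<open>Quasi-regularity and the Jacobson radical\<close>

text \<open>For an idempotent \<open>e\<close> the fixed points of multiplication by
  \<open>e\<close> on both sides form the corner \<open>e R e\<close>. In this form the closure
  properties are distributivity and associativity, and no element has to be decomposed as a
  product.\<close>

lemma (in ring) corner_ring:
  assumes e: "e \<in> carrier R" "e \<otimes> e = e"
  shows "ring (R\<lparr>carrier := {u \<in> carrier R. e \<otimes> u = u \<and> u \<otimes> e = u}, one := e\<rparr>)" (is "ring ?D")
proof (rule ringI)
  let ?D' = "{u \<in> carrier R. e \<otimes> u = u \<and> u \<otimes> e = u}"
  have "subgroup ?D' (add_monoid R)"
  proof (rule group.subgroupI[OF a_group])
    show "?D' \<noteq> {}"
      using e by blast
    show "inv\<^bsub>add_monoid R\<^esub> u \<in> ?D'" if "u \<in> ?D'" for u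
      using that e by (simp add: a_inv_def[symmetric] r_minus l_minus)
  qed (use e in \<open>auto simp: l_distr r_distr\<close>)
  then have "group ((add_monoid R)\<lparr>carrier := ?D'\<rparr>)"
    using subgroup.subgroup_is_group a_group by blast
  then show "abelian_group ?D"
    by (intro comm_group_abelian_groupI group.group_comm_groupI) (auto simp: a_comm)
  show "monoid ?D"
    by (rule monoidI) (use e in \<open>auto simp: m_assoc[symmetric]\<close>, auto simp: m_assoc)
qed (auto simp: l_distr r_distr)

text \<open>A subring without unit is no instance of the locale \<open>ring\<close>. Left ideals of
  it are therefore described inside the ambient unital ring, where all computations take
  place.\<close>

lemma (in ring) left_ideal_subring_iff:
  assumes A: "subgroup A (add_monoid R)"
  shows "left_ideal I (R\<lparr>carrier := A\<rparr>) \<longleftrightarrow>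
    subgroup I (add_monoid R) \<and> I \<subseteq> A \<and> (\<forall>r \<in> A. \<forall>a \<in> I. r \<otimes> a \<in> I)"
proof -
  have "subgroup I ((add_monoid R)\<lparr>carrier := A\<rparr>) \<longleftrightarrow> subgroup I (add_monoid R) \<and> I \<subseteq> A"
    using group.incl_subgroup[OF a_group A] group.subgroup_incl[OF a_group _ A]
      subgroup.subset[of I "(add_monoid R)\<lparr>carrier := A\<rparr>"] by auto
  then show ?thesis
    by (auto simp: left_ideal_def additive_subgroup_def)
qed

text \<open>Negation is determined by searching the carrier for an inverse, so shrinking the carrier
  could change it; for an element of a subgroup it does not.\<close>

lemma (in ring) a_minus_subring:
  assumes A: "subgroup A (add_monoid R)" and "y \<in> A"
  shows "x \<ominus>\<^bsub>R\<lparr>carrier := A\<rparr>\<^esub> y = x \<ominus> y"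
  using group.m_inv_consistent[OF a_group A assms(2)] by (simp add: a_minus_def a_inv_def)

text \<open>
  The elements \<open>a - af\<close> form a modular left ideal, and a left ideal containing it is maximal
  as soon as it is maximal among those avoiding \<open>f\<close>.
\<close>

lemma (in ring) jacobson_radical_left_quasi_regular:
  assumes A: "subgroup A (add_monoid R)" and mult: "\<And>a b. a \<in> A \<Longrightarrow> b \<in> A \<Longrightarrow> a \<otimes> b \<in> A"
    and f: "f \<in> jacobson_radical (R\<lparr>carrier := A\<rparr>)"
  shows "\<exists>a \<in> A. a = f \<oplus> a \<otimes> f"
proof (rule ccontr)
  assume contr: "\<not> (\<exists>a \<in> A. a = f \<oplus> a \<otimes> f)"
  let ?A = "R\<lparr>carrier := A\<rparr>"
  note li = left_ideal_subring_iff[OF A]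
  have AR: "a \<in> carrier R" if "a \<in> A" for a
    using that subgroup.subset[OF A] by auto
  have add: "a \<oplus> b \<in> I" if "subgroup I (add_monoid R)" "a \<in> I" "b \<in> I" for a b I
    using subgroup.m_closed[OF that(1)] that by simp
  have neg: "\<ominus> a \<in> I" if "subgroup I (add_monoid R)" "a \<in> I" for a I
    using subgroup.m_inv_closed[OF that(1)] that by (simp add: a_inv_def)
  have fA: "f \<in> A"
    using f by (simp add: jacobson_radical_def)
  define I0 where "I0 = (\<lambda>a. a \<ominus> a \<otimes> f) ` A"
  have I0: "left_ideal I0 ?A"
    unfolding li
  proof (intro conjI ballI group.subgroupI[OF a_group])
    show "I0 \<subseteq> A"
      using A by (auto simp: I0_def a_minus_def intro!: add neg mult fA)
    then show "I0 \<subseteq> carrier (add_monoid R)"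
      using AR by auto
    show "I0 \<noteq> {}"
      using fA by (auto simp: I0_def)
  next
    fix a assume "a \<in> I0"
    then obtain b where b: "b \<in> A" "a = b \<ominus> b \<otimes> f"
      by (auto simp: I0_def)
    have "inv\<^bsub>add_monoid R\<^esub> a = (\<ominus> b) \<ominus> (\<ominus> b) \<otimes> f"
      using b AR fA by (simp add: a_inv_def[symmetric] a_minus_def minus_add l_minus)
    then show "inv\<^bsub>add_monoid R\<^esub> a \<in> I0"
      using neg[OF A b(1)] by (auto simp: I0_def)
    fix a' assume "a' \<in> I0"
    then obtain b' where b': "b' \<in> A" "a' = b' \<ominus> b' \<otimes> f"
      by (auto simp: I0_def)
    have "a \<oplus> a' = (b \<oplus> b') \<ominus> (b \<oplus> b') \<otimes> f"
      using b b' AR fA by (simp add: a_minus_def l_distr minus_add a_ac)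
    then show "a \<otimes>\<^bsub>add_monoid R\<^esub> a' \<in> I0"
      using add[OF A b(1) b'(1)] by (auto simp: I0_def)
  next
    fix r a assume r: "r \<in> A" and "a \<in> I0"
    then obtain b where b: "b \<in> A" "a = b \<ominus> b \<otimes> f"
      by (auto simp: I0_def)
    have "r \<otimes> a = (r \<otimes> b) \<ominus> (r \<otimes> b) \<otimes> f"
      using b r AR fA by (simp add: a_minus_def r_distr m_assoc r_minus)
    then show "r \<otimes> a \<in> I0"
      using mult[OF r b(1)] by (auto simp: I0_def)
  qed
  \<comment> \<open>The equation \<open>f = a - af\<close> says precisely that
    \<open>a = f + af\<close>, which \<open>contr\<close> rules out.\<close>
  have "f \<notin> I0"
  proof
    assume "f \<in> I0"
    then obtain a where a: "a \<in> A" "f = a \<ominus> a \<otimes> f"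
      by (auto simp: I0_def)
    then have "f \<oplus> a \<otimes> f = a"
      using AR fA by (metis a_minus_def a_assoc a_inv_closed l_neg m_closed r_zero)
    with contr a show False
      by metis
  qed
  define \<S> where "\<S> = {I. left_ideal I ?A \<and> I0 \<subseteq> I \<and> f \<notin> I}"
  have "\<exists>M \<in> \<S>. \<forall>X \<in> \<S>. M \<subseteq> X \<longrightarrow> X = M"
  proof (rule subset_Zorn_nonempty)
    show "\<S> \<noteq> {}"
      using I0 \<open>f \<notin> I0\<close> by (auto simp: \<S>_def)
    fix \<C> assume ne: "\<C> \<noteq> {}" and ch: "subset.chain \<S> \<C>"
    have in_S: "I \<in> \<S>" if "I \<in> \<C>" for I
      using ch that by (auto simp: subset.chain_def)
    then have sg: "subgroup I (add_monoid R)" "I \<subseteq> A" if "I \<in> \<C>" for I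
      using that by (auto simp: \<S>_def li)
    have "left_ideal (\<Union>\<C>) ?A"
      unfolding li
    proof (intro conjI ballI group.subgroupI[OF a_group])
      show "\<Union>\<C> \<subseteq> A" using sg by auto
      then show "\<Union>\<C> \<subseteq> carrier (add_monoid R)" using AR by auto
      show "\<Union>\<C> \<noteq> {}"
        using ne sg subgroup.one_closed by fastforce
      show "inv\<^bsub>add_monoid R\<^esub> a \<in> \<Union>\<C>" if "a \<in> \<Union>\<C>" for a
        using that sg(1) subgroup.m_inv_closed by fastforce
      show "a \<otimes>\<^bsub>add_monoid R\<^esub> b \<in> \<Union>\<C>" if ab: "a \<in> \<Union>\<C>" "b \<in> \<Union>\<C>" for a b
      proof -
        obtain I J where IJ: "a \<in> I" "b \<in> J" "I \<in> \<C>" "J \<in> \<C>"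
          using ab by auto
        then have "I \<subseteq> J \<or> J \<subseteq> I"
          using ch by (auto simp: subset.chain_def)
        then have "a \<oplus> b \<in> I \<or> a \<oplus> b \<in> J"
          using IJ sg(1) add by blast
        then show ?thesis
          using IJ by auto
      qed
      show "r \<otimes> a \<in> \<Union>\<C>" if "r \<in> A" "a \<in> \<Union>\<C>" for r a
        using that in_S unfolding \<S>_def li by blast
    qed
    then show "\<Union>\<C> \<in> \<S>"
      using ne in_S by (auto simp: \<S>_def)
  qed
  then obtain M where M: "left_ideal M ?A" "I0 \<subseteq> M" "f \<notin> M"
    and max: "\<And>X. X \<in> \<S> \<Longrightarrow> M \<subseteq> X \<Longrightarrow> X = M"
    by (auto simp: \<S>_def)
  have "maximal_left_ideal M ?A"
    unfolding maximal_left_ideal_def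
  proof (intro conjI allI impI)
    show "M \<noteq> carrier ?A"
      using M fA by auto
    fix J assume J: "left_ideal J ?A \<and> M \<subseteq> J"
    show "J = M \<or> J = carrier ?A"
    proof (cases "f \<in> J")
      case False
      then show ?thesis
        using J M max[of J] by (auto simp: \<S>_def)
    next
      case True
      \<comment> \<open>Write \<open>r = (r - rf) + rf\<close>: the first summand lies in
        \<open>I0\<close>, the second in \<open>J\<close> because \<open>f\<close> does. So avoiding
        \<open>f\<close> is the same as being proper for left ideals above
        \<open>I0\<close>.\<close>
      have "r \<in> J" if "r \<in> A" for r
      proof -
        have "r \<ominus> r \<otimes> f \<in> J"
          using that M J by (auto simp: I0_def)
        moreover have "r \<otimes> f \<in> J"
          using that True J by (auto simp: li)
        ultimately have "(r \<ominus> r \<otimes> f) \<oplus> r \<otimes> f \<in> J"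
          using J by (intro add) (auto simp: li)
        then show ?thesis
          using AR that fA by (simp add: a_minus_def a_assoc l_neg)
      qed
      then show ?thesis
        using J by (auto simp: li)
    qed
  qed (use M in auto)
  moreover have "modular_left_ideal M ?A"
    \<comment> \<open>The element \<open>f\<close> itself acts as a right unit modulo
      \<open>M\<close>, since \<open>I0\<close> consists of the elements
      \<open>r - rf\<close>.\<close>
    unfolding modular_left_ideal_def
    using M fA mult by (auto simp: a_minus_subring[OF A] I0_def intro!: bexI[of _ f])
  ultimately show False
    using f M by (auto simp: jacobson_radical_def)
qed

text \<open>The radical is an intersection of left ideals, so it contains \<open>tcf\<close>. If
  \<open>u\<close> is a left quasi-inverse of \<open>tcf\<close>, then \<open>cft + cfut\<close> is
  one of \<open>cft\<close>: this is the usual passage from \<open>yz\<close> to \<open>zy\<close>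
  with \<open>y = t\<close> and \<open>z = cf\<close>. It deals with the right factor
  \<open>t\<close> without any right ideal property of the radical.\<close>

lemma (in ring) jacobson_radical_left_quasi_regular_mult:
  assumes A: "subgroup A (add_monoid R)" and mult: "\<And>a b. a \<in> A \<Longrightarrow> b \<in> A \<Longrightarrow> a \<otimes> b \<in> A"
    and f: "f \<in> jacobson_radical (R\<lparr>carrier := A\<rparr>)" and ct: "c \<in> A" "t \<in> A"
  shows "\<exists>a \<in> A. a = c \<otimes> f \<otimes> t \<oplus> a \<otimes> (c \<otimes> f \<otimes> t)"
proof -
  have fA: "f \<in> A"
    using f by (simp add: jacobson_radical_def)
  have "(t \<otimes> c) \<otimes> f \<in> jacobson_radical (R\<lparr>carrier := A\<rparr>)"
    using f ct fA mult by (auto simp: jacobson_radical_def maximal_left_ideal_def left_ideal_def)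
  then obtain u where u: "u \<in> A" and eq: "u = (t \<otimes> c) \<otimes> f \<oplus> u \<otimes> ((t \<otimes> c) \<otimes> f)"
    using jacobson_radical_left_quasi_regular[OF A mult] by blast
  have R: "u \<in> carrier R" "f \<in> carrier R" "c \<in> carrier R" "t \<in> carrier R"
    using subgroup.subset[OF A] u fA ct by auto
  define a where "a = c \<otimes> f \<otimes> t \<oplus> c \<otimes> f \<otimes> u \<otimes> t"
  have "a \<in> A"
    unfolding a_def using subgroup.m_closed[OF A] mult u fA ct by simp
  moreover have "a \<otimes> (c \<otimes> f \<otimes> t) = c \<otimes> f \<otimes> ((t \<otimes> c) \<otimes> f \<oplus> u \<otimes> ((t \<otimes> c) \<otimes> f)) \<otimes> t"
    using R by (simp add: a_def m_assoc l_distr r_distr)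
  then have "a = c \<otimes> f \<otimes> t \<oplus> a \<otimes> (c \<otimes> f \<otimes> t)"
    unfolding eq[symmetric] by (simp add: a_def)
  ultimately show ?thesis by blast
qed

text \<open>If a maximal left ideal \<open>M\<close> misses \<open>f\<close>, then
  \<open>M + Rf\<close> is everything and \<open>1 = m + bf\<close>. A left quasi-inverse
  \<open>a\<close> of \<open>bf\<close> makes \<open>1 + a\<close> a left inverse of
  \<open>m = 1 - bf\<close>, which forces \<open>1\<close> into \<open>M\<close>.\<close>

lemma (in ring) left_quasi_regular_jacobson_radical:
  assumes f: "f \<in> carrier R"
    and qr: "\<And>b. b \<in> carrier R \<Longrightarrow> \<exists>a \<in> carrier R. a = b \<otimes> f \<oplus> a \<otimes> (b \<otimes> f)"
  shows "f \<in> jacobson_radical R"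
  unfolding jacobson_radical_unital
proof (intro CollectI conjI allI impI f)
  fix M assume max: "maximal_left_ideal M R"
  show "f \<in> M"
  proof (rule ccontr)
    assume "f \<notin> M"
    have M: "subgroup M (add_monoid R)" "\<And>r a. r \<in> carrier R \<Longrightarrow> a \<in> M \<Longrightarrow> r \<otimes> a \<in> M"
      using max by (auto simp: maximal_left_ideal_def left_ideal_def additive_subgroup_def)
    have MR: "m \<in> carrier R" if "m \<in> M" for m
      using that subgroup.subset[OF M(1)] by auto
    have add: "a \<oplus> b \<in> M" if "a \<in> M" "b \<in> M" for a b
      using subgroup.m_closed[OF M(1)] that by simp
    have neg: "\<ominus> a \<in> M" if "a \<in> M" for a
      using subgroup.m_inv_closed[OF M(1)] that by (simp add: a_inv_def)
    have zero: "\<zero> \<in> M"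
      using subgroup.one_closed[OF M(1)] by simp
    define J where "J = (\<lambda>(m, b). m \<oplus> b \<otimes> f) ` (M \<times> carrier R)"
    have JI: "m \<oplus> b \<otimes> f \<in> J" if "m \<in> M" "b \<in> carrier R" for m b
      using that by (auto simp: J_def)
    have "left_ideal J R"
      unfolding left_ideal_def additive_subgroup_def
    proof (intro conjI ballI group.subgroupI[OF a_group])
      show "J \<subseteq> carrier (add_monoid R)"
        using MR f by (auto simp: J_def)
      show "J \<noteq> {}"
        using JI[OF zero zero_closed] by auto
    next
      fix a assume "a \<in> J"
      then obtain m b where mb: "m \<in> M" "b \<in> carrier R" "a = m \<oplus> b \<otimes> f"
        by (auto simp: J_def)
      have "inv\<^bsub>add_monoid R\<^esub> a = \<ominus> m \<oplus> (\<ominus> b) \<otimes> f"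
        using mb MR f by (simp add: a_inv_def[symmetric] minus_add l_minus)
      then show "inv\<^bsub>add_monoid R\<^esub> a \<in> J"
        using JI neg mb by simp
      fix a' assume "a' \<in> J"
      then obtain m' b' where mb': "m' \<in> M" "b' \<in> carrier R" "a' = m' \<oplus> b' \<otimes> f"
        by (auto simp: J_def)
      have "a \<oplus> a' = (m \<oplus> m') \<oplus> (b \<oplus> b') \<otimes> f"
        using mb mb' MR f by (simp add: l_distr a_ac)
      then show "a \<otimes>\<^bsub>add_monoid R\<^esub> a' \<in> J"
        using JI add mb mb' by simp
    next
      fix r a assume r: "r \<in> carrier R" and "a \<in> J"
      then obtain m b where mb: "m \<in> M" "b \<in> carrier R" "a = m \<oplus> b \<otimes> f"
        by (auto simp: J_def)
      have "r \<otimes> a = r \<otimes> m \<oplus> (r \<otimes> b) \<otimes> f"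
        using r mb MR f by (simp add: r_distr m_assoc)
      then show "r \<otimes> a \<in> J"
        using JI M(2) mb r by simp
    qed
    moreover have "M \<subseteq> J"
      using JI[OF _ zero_closed] MR f by fastforce
    moreover have "f \<in> J"
      using JI[OF zero one_closed] f by simp
    ultimately have "\<one> \<in> J"
      using max \<open>f \<notin> M\<close> by (auto simp: maximal_left_ideal_def)
    then obtain m b where mb: "m \<in> M" "b \<in> carrier R" "\<one> = m \<oplus> b \<otimes> f"
      by (auto simp: J_def)
    then have m: "m = \<one> \<ominus> b \<otimes> f"
      using MR f by (simp add: a_minus_def a_assoc r_neg)
    obtain a where a: "a \<in> carrier R" "a = b \<otimes> f \<oplus> a \<otimes> (b \<otimes> f)"
      using qr mb by blast
    have bf: "b \<otimes> f \<in> carrier R"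
      using mb(2) f by simp
    then have "(\<one> \<oplus> a) \<otimes> m = (\<one> \<oplus> a) \<ominus> (b \<otimes> f \<oplus> a \<otimes> (b \<otimes> f))"
      using a(1) by (simp add: m a_minus_def l_distr r_distr r_minus)
    also have "\<dots> = (\<one> \<oplus> a) \<ominus> a"
      using a(2) by simp
    also have "\<dots> = \<one>"
      using a(1) by (simp add: a_minus_def a_assoc r_neg)
    finally have "\<one> \<in> M"
      using M(2)[of "\<one> \<oplus> a" m] a(1) mb(1) by simp
    then have "M = carrier R"
      using M MR by (metis r_one subsetI subset_antisym)
    with max show False
      by (simp add: maximal_left_ideal_def)
  qed
qed

lemma zero_in_jacobson_radical:
  assumes "\<zero>\<^bsub>R\<^esub> \<in> carrier R"
  shows "\<zero>\<^bsub>R\<^esub> \<in> jacobson_radical R"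
  using assms additive_subgroup.zero_closed
  by (auto simp: jacobson_radical_def maximal_left_ideal_def left_ideal_def)

section \<open>Local homeomorphisms\<close>

lemma local_homeomorphism_continuous:
  assumes "local_homeomorphism X Y f"
  shows "continuous_map X Y f"
proof -
  have nb: "\<exists>U. openin X U \<and> x \<in> U \<and> openin Y (f ` U) \<and>
      homeomorphic_map (subtopology X U) (subtopology Y (f ` U)) f" if "x \<in> topspace X" for x
    using assms that by (auto simp: local_homeomorphism_def)
  show ?thesis
    unfolding continuous_map
  proof (intro conjI allI impI)
    show "f ` topspace X \<subseteq> topspace Y"
      using nb openin_subset by fastforce
    fix V assume V: "openin Y V"
    show "openin X {x \<in> topspace X. f x \<in> V}"
    proof (subst openin_subopen, clarify)
      fix x assume "x \<in> topspace X" "f x \<in> V"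
      then obtain U where U: "openin X U" "x \<in> U" "homeomorphic_map (subtopology X U) (subtopology Y (f ` U)) f"
        using nb by blast
      then have "continuous_map (subtopology X U) Y f"
        by (meson homeomorphic_imp_continuous_map continuous_map_into_fulltopology)
      then have "openin (subtopology X U) {z \<in> topspace (subtopology X U). f z \<in> V}"
        using V by (rule openin_continuous_map_preimage)
      then have "openin X {z \<in> topspace (subtopology X U). f z \<in> V}"
        using U(1) openin_trans_full by blast
      then show "\<exists>T. openin X T \<and> x \<in> T \<and> T \<subseteq> {x \<in> topspace X. f x \<in> V}"
        using U openin_subset \<open>f x \<in> V\<close> by (intro exI[of _ "{z \<in> topspace (subtopology X U). f z \<in> V}"]) auto
    qed
  qed
qed

lemma local_homeomorphism_open_map:
  assumes "local_homeomorphism X Y f"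
  shows "open_map X Y f"
  unfolding open_map_def
proof (intro allI impI)
  fix V assume V: "openin X V"
  show "openin Y (f ` V)"
  proof (subst openin_subopen, clarify)
    fix x assume x: "x \<in> V"
    then have "x \<in> topspace X"
      using V openin_subset by blast
    then obtain U where U: "openin X U" "x \<in> U" "openin Y (f ` U)"
      "homeomorphic_map (subtopology X U) (subtopology Y (f ` U)) f"
      using assms by (auto simp: local_homeomorphism_def)
    have "openin (subtopology X U) (U \<inter> V)"
      using V by (auto simp: openin_subtopology_Int2)
    then have "openin (subtopology Y (f ` U)) (f ` (U \<inter> V))"
      using homeomorphic_imp_open_map[OF U(4)] by (auto simp: open_map_def)
    then have "openin Y (f ` (U \<inter> V))"
      using U(3) openin_trans_full by blast
    then show "\<exists>T. openin Y T \<and> f x \<in> T \<and> T \<subseteq> f ` V"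
      using x U by (intro exI[of _ "f ` (U \<inter> V)"]) auto
  qed
qed

lemma local_homeomorphism_inj:
  assumes "local_homeomorphism X Y f" "x \<in> topspace X"
  obtains U where "openin X U" "x \<in> U" "inj_on f U"
proof -
  obtain U where U: "openin X U" "x \<in> U" "homeomorphic_map (subtopology X U) (subtopology Y (f ` U)) f"
    using assms by (auto simp: local_homeomorphism_def)
  have "inj_on f U"
    using homeomorphic_imp_injective_map[OF U(3)] openin_subset[OF U(1)]
    by (simp add: inf.absorb2)
  with U that show ?thesis by blast
qed

lemma open_map_continuous_inv_into:
  assumes f: "open_map X Y f" and U: "openin X U" and inj: "inj_on f U"
  shows "continuous_map (subtopology Y (f ` U)) X (inv_into U f)"
  unfolding continuous_map
proof (intro conjI allI impI)
  have UX: "U \<subseteq> topspace X"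
    using U by (rule openin_subset)
  then show "inv_into U f ` topspace (subtopology Y (f ` U)) \<subseteq> topspace X"
    by (auto simp: inv_into_into)
  fix V assume V: "openin X V"
  have "f ` (U \<inter> V) \<subseteq> topspace Y"
    using f U V openin_subset by (fastforce simp: open_map_def)
  then have "{y \<in> topspace (subtopology Y (f ` U)). inv_into U f y \<in> V} = f ` (U \<inter> V)"
    using inj by (auto simp: image_iff)
  moreover have "openin Y (f ` (U \<inter> V))"
    using f U V by (simp add: open_map_def openin_Int)
  ultimately show "openin (subtopology Y (f ` U)) {y \<in> topspace (subtopology Y (f ` U)). inv_into U f y \<in> V}"
    unfolding openin_subtopology by (intro exI[of _ "f ` (U \<inter> V)"]) auto
qed

section \<open>Column-finite sections\<close>

lemma finsum_commute:
  assumes "abelian_monoid R" "finite I" "finite J"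
    and "\<And>i j. i \<in> I \<Longrightarrow> j \<in> J \<Longrightarrow> h i j \<in> carrier R"
  shows "finsum R (\<lambda>i. finsum R (h i) J) I = finsum R (\<lambda>j. finsum R (\<lambda>i. h i j) I) J"
proof -
  interpret R: abelian_monoid R by fact
  show ?thesis
    using assms(2,4)
  proof (induction I)
    case (insert i I)
    have "finsum R (\<lambda>j. finsum R (\<lambda>i. h i j) (insert i I)) J = finsum R (\<lambda>j. h i j \<oplus>\<^bsub>R\<^esub> finsum R (\<lambda>i. h i j) I) J"
      by (rule R.finsum_cong') (use insert in \<open>auto intro!: R.finsum_closed R.add.m_closed\<close>)
    also have "\<dots> = finsum R (h i) J \<oplus>\<^bsub>R\<^esub> finsum R (\<lambda>j. finsum R (\<lambda>i. h i j) I) J"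
      by (rule R.finsum_addf) (use insert in \<open>auto intro!: R.finsum_closed\<close>)
    finally show ?case
      using insert by (simp add: Pi_def)
  qed simp
qed

lemma stalk_sel [simp]:
  "add (stalk S x) = eadd S" "mult (stalk S x) = emult S"
  "zero (stalk S x) = ezero S x" "one (stalk S x) = eone S x"
  by (simp_all add: stalk_def)

text \<open>With rows indexed by ranges and columns by sources this is the analogue of column-finite
  matrices. Continuity is dropped so that sections supported at a single arrow belong to it, and the
  convolution identity inherited from \<open>all_sections\<close> becomes a genuine element.\<close>

definition column_finite_sections :: "'g groupoid \<Rightarrow> ('g, 'e) gsheaf_rings \<Rightarrow> ('g \<Rightarrow> 'e) ring" where
  "column_finite_sections G S =
     (all_sections G S)\<lparr>carrier :=
       {f \<in> carrier (all_sections G S).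
          \<forall>y. finite {\<gamma> \<in> arrows G. gdom G \<gamma> = y \<and> f \<gamma> \<noteq> ezero S (gran G \<gamma>)}}\<rparr>"

locale ample_sheaf = ample_groupoid G + gsheaf_of_rings G S
  for G :: "'g groupoid" and S :: "('g, 'e) gsheaf_rings"
begin

section \<open>The additive group of column-finite sections\<close>

abbreviation "AS \<equiv> all_sections G S"
abbreviation "CS \<equiv> column_finite_sections G S"

lemma CS_sel [simp]:
  "add CS = add AS" "mult CS = mult AS" "zero CS = zero AS" "one CS = one AS"
  by (simp_all add: column_finite_sections_def)

lemma CS_AS: "f \<in> carrier CS \<Longrightarrow> f \<in> carrier AS"
  by (simp add: column_finite_sections_def)

lemma CS_finite:
  "f \<in> carrier CS \<Longrightarrow> finite {\<gamma> \<in> arrows G. gdom G \<gamma> = y \<and> f \<gamma> \<noteq> ezero S (gran G \<gamma>)}"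
  by (simp add: column_finite_sections_def)

lemma CS_I:
  "f \<in> carrier AS \<Longrightarrow>
   (\<And>y. y \<in> units G \<Longrightarrow> finite {\<gamma> \<in> arrows G. gdom G \<gamma> = y \<and> f \<gamma> \<noteq> ezero S (gran G \<gamma>)}) \<Longrightarrow> f \<in> carrier CS"
proof -
  assume f: "f \<in> carrier AS"
    and fin: "\<And>y. y \<in> units G \<Longrightarrow> finite {\<gamma> \<in> arrows G. gdom G \<gamma> = y \<and> f \<gamma> \<noteq> ezero S (gran G \<gamma>)}"
  have "finite {\<gamma> \<in> arrows G. gdom G \<gamma> = y \<and> f \<gamma> \<noteq> ezero S (gran G \<gamma>)}" for y
  proof (cases "y \<in> units G")
    case False
    then have "{\<gamma> \<in> arrows G. gdom G \<gamma> = y \<and> f \<gamma> \<noteq> ezero S (gran G \<gamma>)} = {}"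
      by auto
    then show ?thesis
      by (simp only: finite.emptyI)
  qed (use fin in auto)
  with f show ?thesis
    by (simp add: column_finite_sections_def)
qed

lemma section_value: "f \<in> carrier AS \<Longrightarrow> \<gamma> \<in> arrows G \<Longrightarrow> f \<gamma> \<in> carrier (stalk S (gran G \<gamma>))"
  by (auto simp: all_sections_def)

lemma ring_stalk_gran: "\<gamma> \<in> arrows G \<Longrightarrow> ring (stalk S (gran G \<gamma>))"
  by (rule ring_stalk) simp

lemma section_eqI:
  assumes "f \<in> carrier AS" "g \<in> carrier AS" "\<And>\<gamma>. \<gamma> \<in> arrows G \<Longrightarrow> f \<gamma> = g \<gamma>"
  shows "f = g"
  by (rule PiE_ext) (use assms in \<open>auto simp: all_sections_def\<close>)

lemma restrict_section:
  "(\<And>\<gamma>. \<gamma> \<in> arrows G \<Longrightarrow> h \<gamma> \<in> carrier (stalk S (gran G \<gamma>))) \<Longrightarrow> (\<lambda>\<gamma> \<in> arrows G. h \<gamma>) \<in> carrier AS"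
  by (auto simp: all_sections_def)

lemma add_apply [simp]: "\<gamma> \<in> arrows G \<Longrightarrow> (f \<oplus>\<^bsub>AS\<^esub> g) \<gamma> = eadd S (f \<gamma>) (g \<gamma>)"
  by (simp add: all_sections_def)

lemma zero_apply [simp]: "\<gamma> \<in> arrows G \<Longrightarrow> \<zero>\<^bsub>AS\<^esub> \<gamma> = ezero S (gran G \<gamma>)"
  by (simp add: all_sections_def)

lemma abelian_group_AS: "abelian_group AS"
proof (rule abelian_groupI)
  show closed: "f \<oplus>\<^bsub>AS\<^esub> g \<in> carrier AS" if "f \<in> carrier AS" "g \<in> carrier AS" for f g
    using that ring.ring_simprules(1)[OF ring_stalk_gran]
    by (fastforce simp: all_sections_def dest: PiE_mem)
  show zero: "\<zero>\<^bsub>AS\<^esub> \<in> carrier AS"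
    using ring.ring_simprules(2)[OF ring_stalk_gran] by (auto simp: all_sections_def)
  show "f \<oplus>\<^bsub>AS\<^esub> g \<oplus>\<^bsub>AS\<^esub> h = f \<oplus>\<^bsub>AS\<^esub> (g \<oplus>\<^bsub>AS\<^esub> h)"
    if "f \<in> carrier AS" "g \<in> carrier AS" "h \<in> carrier AS" for f g h
    by (rule section_eqI) (use that closed zero section_value ring.ring_simprules(7)[OF ring_stalk_gran] in simp_all)
  show "f \<oplus>\<^bsub>AS\<^esub> g = g \<oplus>\<^bsub>AS\<^esub> f" if "f \<in> carrier AS" "g \<in> carrier AS" for f g
    by (rule section_eqI) (use that closed zero section_value ring.ring_simprules(10)[OF ring_stalk_gran] in simp_all)
  show "\<zero>\<^bsub>AS\<^esub> \<oplus>\<^bsub>AS\<^esub> f = f" if "f \<in> carrier AS" for f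
    by (rule section_eqI) (use that closed zero section_value ring.ring_simprules(8)[OF ring_stalk_gran] in simp_all)
  show "\<exists>g\<in>carrier AS. g \<oplus>\<^bsub>AS\<^esub> f = \<zero>\<^bsub>AS\<^esub>" if f: "f \<in> carrier AS" for f
  proof
    let ?g = "\<lambda>\<gamma> \<in> arrows G. \<ominus>\<^bsub>stalk S (gran G \<gamma>)\<^esub> f \<gamma>"
    show g: "?g \<in> carrier AS"
      using f section_value ring.ring_simprules(3)[OF ring_stalk] by (intro restrict_section) auto
    show "?g \<oplus>\<^bsub>AS\<^esub> f = \<zero>\<^bsub>AS\<^esub>"
      by (rule section_eqI)
        (use f g closed zero section_value ring.ring_simprules(9)[OF ring_stalk_gran] in simp_all)
  qed
qed

lemma minus_apply:
  assumes "f \<in> carrier AS" "\<gamma> \<in> arrows G"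
  shows "(\<ominus>\<^bsub>AS\<^esub> f) \<gamma> = \<ominus>\<^bsub>stalk S (gran G \<gamma>)\<^esub> f \<gamma>"
proof -
  interpret AS: abelian_group AS by (rule abelian_group_AS)
  interpret R: ring "stalk S (gran G \<gamma>)" by (rule ring_stalk) (use assms in simp)
  have "\<ominus>\<^bsub>AS\<^esub> f \<oplus>\<^bsub>AS\<^esub> f = \<zero>\<^bsub>AS\<^esub>"
    using assms by (simp add: AS.l_neg)
  then have "eadd S ((\<ominus>\<^bsub>AS\<^esub> f) \<gamma>) (f \<gamma>) = ezero S (gran G \<gamma>)"
    using assms by (metis add_apply zero_apply)
  then show ?thesis
    using assms R.minus_equality[of "(\<ominus>\<^bsub>AS\<^esub> f) \<gamma>" "f \<gamma>"] by (simp add: section_value)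
qed

lemma subgroup_CS: "subgroup (carrier CS) (add_monoid AS)"
proof -
  interpret AS: abelian_group AS by (rule abelian_group_AS)
  show ?thesis
  proof (rule group.subgroupI[OF AS.a_group])
    show "carrier CS \<subseteq> carrier (add_monoid AS)"
      using CS_AS by auto
    have "\<zero>\<^bsub>AS\<^esub> \<in> carrier CS"
    proof (rule CS_I)
      fix y
      have "{\<gamma> \<in> arrows G. gdom G \<gamma> = y \<and> \<zero>\<^bsub>AS\<^esub> \<gamma> \<noteq> ezero S (gran G \<gamma>)} = {}"
        by auto
      then show "finite {\<gamma> \<in> arrows G. gdom G \<gamma> = y \<and> \<zero>\<^bsub>AS\<^esub> \<gamma> \<noteq> ezero S (gran G \<gamma>)}"
        by (simp only: finite.emptyI)
    qed simp
    then show "carrier CS \<noteq> {}" by auto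
  next
    fix f assume f: "f \<in> carrier CS"
    have "(\<ominus>\<^bsub>AS\<^esub> f) \<in> carrier CS"
    proof (rule CS_I)
      fix y
      show "finite {\<gamma> \<in> arrows G. gdom G \<gamma> = y \<and> (\<ominus>\<^bsub>AS\<^esub> f) \<gamma> \<noteq> ezero S (gran G \<gamma>)}"
        by (rule finite_subset[OF _ CS_finite[OF f, of y]])
          (use f ring.minus_zero[OF ring_stalk_gran] in \<open>auto simp: minus_apply CS_AS\<close>)
    qed (use f CS_AS in simp)
    then show "inv\<^bsub>add_monoid AS\<^esub> f \<in> carrier CS"
      by (simp add: a_inv_def)
  next
    fix f g assume fg: "f \<in> carrier CS" "g \<in> carrier CS"
    have "f \<oplus>\<^bsub>AS\<^esub> g \<in> carrier CS"
    proof (rule CS_I)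
      fix y
      show "finite {\<gamma> \<in> arrows G. gdom G \<gamma> = y \<and> (f \<oplus>\<^bsub>AS\<^esub> g) \<gamma> \<noteq> ezero S (gran G \<gamma>)}"
        by (rule finite_subset[OF _ finite_UnI[OF CS_finite[OF fg(1), of y] CS_finite[OF fg(2), of y]]])
          (use ring.ring_simprules(8,2)[OF ring_stalk_gran] in auto)
    qed (use fg CS_AS in simp)
    then show "f \<otimes>\<^bsub>add_monoid AS\<^esub> g \<in> carrier CS"
      by simp
  qed
qed

lemma abelian_group_CS: "abelian_group CS"
proof -
  interpret AS: abelian_group AS by (rule abelian_group_AS)
  have "add_monoid CS = (add_monoid AS)\<lparr>carrier := carrier CS\<rparr>"
    by (simp add: column_finite_sections_def)
  moreover have "comm_group ((add_monoid AS)\<lparr>carrier := carrier CS\<rparr>)"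
    by (rule group.group_comm_groupI[OF subgroup.subgroup_is_group[OF subgroup_CS AS.a_group]])
      (simp add: AS.a_comm CS_AS)
  ultimately show ?thesis
    by (intro comm_group_abelian_groupI) simp
qed

lemma act_closed:
  "\<beta> \<in> arrows G \<Longrightarrow> a \<in> carrier (stalk S (gdom G \<beta>)) \<Longrightarrow> act S \<beta> a \<in> carrier (stalk S (gran G \<beta>))"
  using act_ring_hom ring_hom_closed by metis

lemma act_ezero: "\<beta> \<in> arrows G \<Longrightarrow> act S \<beta> (ezero S (gdom G \<beta>)) = ezero S (gran G \<beta>)"
  using ring_hom_zero[OF act_ring_hom ring_stalk ring_stalk, of \<beta>] by simp

lemma act_emult: "\<beta> \<in> arrows G \<Longrightarrow> a \<in> carrier (stalk S (gdom G \<beta>)) \<Longrightarrow> b \<in> carrier (stalk S (gdom G \<beta>)) \<Longrightarrow>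
  act S \<beta> (emult S a b) = emult S (act S \<beta> a) (act S \<beta> b)"
  using ring_hom_mult[OF act_ring_hom, of \<beta> a b] by simp

lemma act_eadd: "\<beta> \<in> arrows G \<Longrightarrow> a \<in> carrier (stalk S (gdom G \<beta>)) \<Longrightarrow> b \<in> carrier (stalk S (gdom G \<beta>)) \<Longrightarrow>
  act S \<beta> (eadd S a b) = eadd S (act S \<beta> a) (act S \<beta> b)"
  using ring_hom_add[OF act_ring_hom, of \<beta> a b] by simp

lemma act_eone: "\<beta> \<in> arrows G \<Longrightarrow> act S \<beta> (eone S (gdom G \<beta>)) = eone S (gran G \<beta>)"
  using ring_hom_one[OF act_ring_hom, of \<beta>] by simp

lemma act_finsum:
  assumes "\<beta> \<in> arrows G" "finite K" "h \<in> K \<rightarrow> carrier (stalk S (gdom G \<beta>))"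
  shows "act S \<beta> (finsum (stalk S (gdom G \<beta>)) h K) = finsum (stalk S (gran G \<beta>)) (\<lambda>k. act S \<beta> (h k)) K"
proof -
  interpret ring_hom_ring "stalk S (gdom G \<beta>)" "stalk S (gran G \<beta>)" "act S \<beta>"
    using assms by (intro ring_hom_ringI2 ring_stalk act_ring_hom) auto
  show ?thesis
    using hom_finsum[of h K] assms by (simp add: comp_def)
qed

section \<open>Convolution as a finite sum along a fibre of the source map\<close>

definition column_support :: "('g \<Rightarrow> 'e) \<Rightarrow> 'g \<Rightarrow> 'g set" where
  "column_support g y = {\<rho> \<in> arrows G. gdom G \<rho> = y \<and> g \<rho> \<noteq> ezero S (gran G \<rho>)}"

lemma conv_term_closed:
  assumes "f \<in> carrier AS" "g \<in> carrier AS" "\<gamma> \<in> arrows G" "\<rho> \<in> arrows G" "gdom G \<rho> = gdom G \<gamma>"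
  shows "emult S (f (gdiv \<gamma> \<rho>)) (act S (gdiv \<gamma> \<rho>) (g \<rho>)) \<in> carrier (stalk S (gran G \<gamma>))"
proof -
  interpret R: ring "stalk S (gran G \<gamma>)" by (rule ring_stalk) (use assms in simp)
  show ?thesis
    using assms R.m_closed section_value[of f "gdiv \<gamma> \<rho>"] section_value[of g \<rho>]
      act_closed[of "gdiv \<gamma> \<rho>" "g \<rho>"] by simp
qed

text \<open>The sum in the definition runs over pairs of nonzero factors, hence over an index set
  that varies with both \<open>f\<close> and \<open>g\<close>. Reindexing by the right factor and
  adding vanishing terms replaces it by any finite \<open>K\<close> between the support of
  \<open>g\<close> and the whole fibre, so that different products can be compared over a common
  index set.\<close>

lemma conv_apply:
  assumes f: "f \<in> carrier AS" and g: "g \<in> carrier AS" and \<gamma>: "\<gamma> \<in> arrows G"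
    and K: "finite K" "column_support g (gdom G \<gamma>) \<subseteq> K" "K \<subseteq> {\<rho> \<in> arrows G. gdom G \<rho> = gdom G \<gamma>}"
  shows "(f \<otimes>\<^bsub>AS\<^esub> g) \<gamma> =
    finsum (stalk S (gran G \<gamma>)) (\<lambda>\<rho>. emult S (f (gdiv \<gamma> \<rho>)) (act S (gdiv \<gamma> \<rho>) (g \<rho>))) K"
proof -
  interpret R: ring "stalk S (gran G \<gamma>)" by (rule ring_stalk) (use \<gamma> in simp)
  let ?P = "{(\<beta>, \<rho>). \<beta> \<in> arrows G \<and> \<rho> \<in> arrows G \<and> gdom G \<beta> = gran G \<rho> \<and> gmult G \<beta> \<rho> = \<gamma> \<and>
             f \<beta> \<noteq> ezero S (gran G \<beta>) \<and> g \<rho> \<noteq> ezero S (gran G \<rho>)}"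
  let ?K = "{\<rho> \<in> K. f (gdiv \<gamma> \<rho>) \<noteq> ezero S (gran G \<gamma>) \<and> g \<rho> \<noteq> ezero S (gran G \<rho>)}"
  let ?t = "\<lambda>\<rho>. emult S (f (gdiv \<gamma> \<rho>)) (act S (gdiv \<gamma> \<rho>) (g \<rho>))"
  have t: "?t \<rho> \<in> carrier (stalk S (gran G \<gamma>))" if "\<rho> \<in> K" for \<rho>
    using conv_term_closed[OF f g \<gamma>, of \<rho>] K that by auto
  have P: "?P = (\<lambda>\<rho>. (gdiv \<gamma> \<rho>, \<rho>)) ` ?K"
  proof (intro equalityI subsetI)
    fix p assume "p \<in> ?P"
    then obtain \<beta> \<rho> where p: "p = (\<beta>, \<rho>)" and *: "\<beta> \<in> arrows G" "\<rho> \<in> arrows G" "gdom G \<beta> = gran G \<rho>"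
      "f \<beta> \<noteq> ezero S (gran G \<beta>)" "g \<rho> \<noteq> ezero S (gran G \<rho>)" "gmult G \<beta> \<rho> = \<gamma>"
      by auto
    then have "\<rho> \<in> ?K"
      using K by (auto simp: column_support_def dom_mult ran_mult)
    moreover have "gdiv \<gamma> \<rho> = \<beta>"
      using mult_gdiv[of \<beta> \<rho>] * by simp
    ultimately show "p \<in> (\<lambda>\<rho>. (gdiv \<gamma> \<rho>, \<rho>)) ` ?K"
      using p by (intro image_eqI[of _ _ \<rho>]) auto
  qed (use K \<gamma> in auto)
  have "(f \<otimes>\<^bsub>AS\<^esub> g) \<gamma> = finsum (stalk S (gran G \<gamma>)) (\<lambda>(\<beta>, \<rho>). emult S (f \<beta>) (act S \<beta> (g \<rho>))) ?P"
    using \<gamma> by (simp add: all_sections_def)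
  also have "\<dots> = finsum (stalk S (gran G \<gamma>)) ?t ?K"
    unfolding P using t by (subst R.finsum_reindex) (auto simp: inj_on_def)
  also have "\<dots> = finsum (stalk S (gran G \<gamma>)) ?t K"
  proof (rule R.add.finprod_mono_neutral_cong_left)
    fix \<rho> assume \<rho>: "\<rho> \<in> K - ?K"
    then have r: "\<rho> \<in> arrows G" "gdom G \<rho> = gdom G \<gamma>"
      using K by auto
    have fr: "f (gdiv \<gamma> \<rho>) \<in> carrier (stalk S (gran G \<gamma>))"
      using section_value[of f "gdiv \<gamma> \<rho>"] f \<gamma> r by simp
    have gr: "act S (gdiv \<gamma> \<rho>) (g \<rho>) \<in> carrier (stalk S (gran G \<gamma>))"
      using section_value[of g \<rho>] act_closed[of "gdiv \<gamma> \<rho>" "g \<rho>"] g \<gamma> r by simp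
    consider "f (gdiv \<gamma> \<rho>) = ezero S (gran G \<gamma>)" | "g \<rho> = ezero S (gran G \<rho>)"
      using \<rho> by blast
    then show "?t \<rho> = \<zero>\<^bsub>stalk S (gran G \<gamma>)\<^esub>"
    proof cases
      case 1
      then show ?thesis using R.l_null[OF gr] by simp
    next
      case 2
      then show ?thesis using R.r_null[OF fr] act_ezero[of "gdiv \<gamma> \<rho>"] \<gamma> r by simp
    qed
  qed (use K t in auto)
  finally show ?thesis .
qed

lemma CS_column_support: "f \<in> carrier CS \<Longrightarrow> finite (column_support f y)"
  unfolding column_support_def by (rule CS_finite)

lemma column_support_subset: "column_support f y \<subseteq> {\<rho> \<in> arrows G. gdom G \<rho> = y}"
  by (auto simp: column_support_def)

lemmas CS_conv_apply = conv_apply[OF CS_AS CS_AS]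

lemma conv_in_AS:
  assumes "f \<in> carrier CS" "g \<in> carrier CS"
  shows "f \<otimes>\<^bsub>AS\<^esub> g \<in> carrier AS"
proof -
  have "(f \<otimes>\<^bsub>AS\<^esub> g) \<gamma> \<in> carrier (stalk S (gran G \<gamma>))" if \<gamma>: "\<gamma> \<in> arrows G" for \<gamma>
  proof -
    interpret R: ring "stalk S (gran G \<gamma>)" by (rule ring_stalk_gran[OF \<gamma>])
    show ?thesis
      unfolding CS_conv_apply[OF assms \<gamma> CS_column_support[OF assms(2)] subset_refl column_support_subset]
      by (rule R.finsum_closed) (use assms \<gamma> column_support_subset in \<open>auto intro!: conv_term_closed CS_AS\<close>)
  qed
  moreover have "f \<otimes>\<^bsub>AS\<^esub> g = (\<lambda>\<gamma> \<in> arrows G. (f \<otimes>\<^bsub>AS\<^esub> g) \<gamma>)"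
    unfolding all_sections_def by (simp cong: restrict_cong)
  ultimately show ?thesis
    by (metis restrict_section)
qed

lemma conv_term_zero:
  assumes f: "f \<in> carrier AS" and g: "g \<in> carrier AS"
    and \<gamma>: "\<gamma> \<in> arrows G" and \<rho>: "\<rho> \<in> arrows G" "gdom G \<rho> = gdom G \<gamma>"
    and z: "f (gdiv \<gamma> \<rho>) = ezero S (gran G \<gamma>) \<or> g \<rho> = ezero S (gran G \<rho>)"
  shows "emult S (f (gdiv \<gamma> \<rho>)) (act S (gdiv \<gamma> \<rho>) (g \<rho>)) = ezero S (gran G \<gamma>)"
proof -
  interpret R: ring "stalk S (gran G \<gamma>)" by (rule ring_stalk_gran[OF \<gamma>])
  have fr: "f (gdiv \<gamma> \<rho>) \<in> carrier (stalk S (gran G \<gamma>))"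
    using section_value[of f "gdiv \<gamma> \<rho>"] f \<gamma> \<rho> by simp
  have gr: "act S (gdiv \<gamma> \<rho>) (g \<rho>) \<in> carrier (stalk S (gran G \<gamma>))"
    using section_value[of g \<rho>] act_closed[of "gdiv \<gamma> \<rho>" "g \<rho>"] g \<gamma> \<rho> by simp
  show ?thesis
    using z R.l_null[OF gr] R.r_null[OF fr] act_ezero[of "gdiv \<gamma> \<rho>"] \<gamma> \<rho> by auto
qed

lemma conv_zero:
  assumes f: "f \<in> carrier CS" and g: "g \<in> carrier CS" and \<gamma>: "\<gamma> \<in> arrows G"
    and z: "\<And>\<rho>. \<rho> \<in> arrows G \<Longrightarrow> gdom G \<rho> = gdom G \<gamma> \<Longrightarrow> g \<rho> \<noteq> ezero S (gran G \<rho>) \<Longrightarrow>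
      f (gdiv \<gamma> \<rho>) = ezero S (gran G \<gamma>)"
  shows "(f \<otimes>\<^bsub>AS\<^esub> g) \<gamma> = ezero S (gran G \<gamma>)"
proof -
  interpret R: ring "stalk S (gran G \<gamma>)" by (rule ring_stalk_gran[OF \<gamma>])
  have "emult S (f (gdiv \<gamma> \<rho>)) (act S (gdiv \<gamma> \<rho>) (g \<rho>)) = \<zero>\<^bsub>stalk S (gran G \<gamma>)\<^esub>"
    if "\<rho> \<in> column_support g (gdom G \<gamma>)" for \<rho>
    using that conv_term_zero[OF CS_AS[OF f] CS_AS[OF g] \<gamma>, of \<rho>] z[of \<rho>] by (simp add: column_support_def)
  from R.add.finprod_one_eqI[OF this] show ?thesis
    unfolding CS_conv_apply[OF f g \<gamma> CS_column_support[OF g] subset_refl column_support_subset] by simp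
qed

text \<open>This evaluates products in which at most one factorisation can contribute, as happens
  when a factor lives on a bisection, on units or on one arrow. The arrow \<open>\<rho>0\<close> is
  inserted into the index set because it may lie outside the support of \<open>g\<close>, in which
  case both sides vanish.\<close>

lemma conv_single:
  assumes f: "f \<in> carrier CS" and g: "g \<in> carrier CS" and \<gamma>: "\<gamma> \<in> arrows G"
    and \<rho>0: "\<rho>0 \<in> arrows G" "gdom G \<rho>0 = gdom G \<gamma>"
    and z: "\<And>\<rho>. \<rho> \<in> arrows G \<Longrightarrow> gdom G \<rho> = gdom G \<gamma> \<Longrightarrow> \<rho> \<noteq> \<rho>0 \<Longrightarrow> g \<rho> \<noteq> ezero S (gran G \<rho>) \<Longrightarrow>
      f (gdiv \<gamma> \<rho>) = ezero S (gran G \<gamma>)"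
  shows "(f \<otimes>\<^bsub>AS\<^esub> g) \<gamma> = emult S (f (gdiv \<gamma> \<rho>0)) (act S (gdiv \<gamma> \<rho>0) (g \<rho>0))"
proof -
  interpret R: ring "stalk S (gran G \<gamma>)" by (rule ring_stalk_gran[OF \<gamma>])
  let ?t = "\<lambda>\<rho>. emult S (f (gdiv \<gamma> \<rho>)) (act S (gdiv \<gamma> \<rho>) (g \<rho>))"
  let ?K = "insert \<rho>0 (column_support g (gdom G \<gamma>))"
  have t: "?t \<rho>0 \<in> carrier (stalk S (gran G \<gamma>))"
    using conv_term_closed[OF CS_AS[OF f] CS_AS[OF g] \<gamma> \<rho>0] .
  have "(f \<otimes>\<^bsub>AS\<^esub> g) \<gamma> = finsum (stalk S (gran G \<gamma>)) ?t ?K"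
    by (rule CS_conv_apply[OF f g \<gamma>]) (use CS_column_support[OF g] \<rho>0 in \<open>auto simp: column_support_def\<close>)
  also have "\<dots> = finsum (stalk S (gran G \<gamma>)) ?t {\<rho>0}"
  proof (rule R.add.finprod_mono_neutral_cong_right)
    show "?t \<rho> = \<zero>\<^bsub>stalk S (gran G \<gamma>)\<^esub>" if "\<rho> \<in> ?K - {\<rho>0}" for \<rho>
      using that conv_term_zero[OF CS_AS[OF f] CS_AS[OF g] \<gamma>, of \<rho>] z[of \<rho>] by (auto simp: column_support_def)
    show "?t \<in> ?K \<rightarrow> carrier (stalk S (gran G \<gamma>))"
      using conv_term_closed[OF CS_AS[OF f] CS_AS[OF g] \<gamma>] \<rho>0 by (auto simp: column_support_def)
  qed (use CS_column_support[OF g] in auto)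
  also have "\<dots> = ?t \<rho>0"
    using t R.r_zero[OF t] by simp
  finally show ?thesis .
qed

text \<open>In column \<open>y\<close> the support of the product lies in the set of products
  \<open>\<beta> \<rho>\<close> with \<open>\<rho>\<close> in column \<open>y\<close> of
  \<open>g\<close> and \<open>\<beta>\<close> in the column of \<open>f\<close> over the range of
  \<open>\<rho>\<close>: a finite union of finite sets.\<close>

lemma conv_CS:
  assumes f: "f \<in> carrier CS" and g: "g \<in> carrier CS"
  shows "f \<otimes>\<^bsub>AS\<^esub> g \<in> carrier CS"
proof (rule CS_I)
  show "f \<otimes>\<^bsub>AS\<^esub> g \<in> carrier AS"
    using assms by (rule conv_in_AS)
  fix y
  let ?U = "\<Union>\<rho> \<in> column_support g y. (\<lambda>\<beta>. gmult G \<beta> \<rho>) ` column_support f (gran G \<rho>)"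
  have "{\<gamma> \<in> arrows G. gdom G \<gamma> = y \<and> (f \<otimes>\<^bsub>AS\<^esub> g) \<gamma> \<noteq> ezero S (gran G \<gamma>)} \<subseteq> ?U"
  proof clarify
    fix \<gamma> assume \<gamma>: "\<gamma> \<in> arrows G" and "(f \<otimes>\<^bsub>AS\<^esub> g) \<gamma> \<noteq> ezero S (gran G \<gamma>)"
    then obtain \<rho> where \<rho>: "\<rho> \<in> arrows G" "gdom G \<rho> = gdom G \<gamma>" "g \<rho> \<noteq> ezero S (gran G \<rho>)"
      "f (gdiv \<gamma> \<rho>) \<noteq> ezero S (gran G \<gamma>)"
      using conv_zero[OF f g \<gamma>] by blast
    then have "\<rho> \<in> column_support g (gdom G \<gamma>)" "gdiv \<gamma> \<rho> \<in> column_support f (gran G \<rho>)" "\<gamma> = gmult G (gdiv \<gamma> \<rho>) \<rho>"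
      using \<gamma> by (auto simp: column_support_def)
    then show "\<gamma> \<in> (\<Union>\<rho> \<in> column_support g (gdom G \<gamma>). (\<lambda>\<beta>. gmult G \<beta> \<rho>) ` column_support f (gran G \<rho>))"
      by blast
  qed
  then show "finite {\<gamma> \<in> arrows G. gdom G \<gamma> = y \<and> (f \<otimes>\<^bsub>AS\<^esub> g) \<gamma> \<noteq> ezero S (gran G \<gamma>)}"
    by (rule finite_subset) (use f g CS_column_support in auto)
qed

text \<open>
  Since \<open>conv_apply\<close> admits every finite superset of the support, both triple products become
  double sums over the same index set \<open>K \<times> L\<close>.
\<close>

lemma conv_assoc:
  assumes f: "f \<in> carrier CS" and g: "g \<in> carrier CS" and h: "h \<in> carrier CS"
  shows "(f \<otimes>\<^bsub>AS\<^esub> g) \<otimes>\<^bsub>AS\<^esub> h = f \<otimes>\<^bsub>AS\<^esub> (g \<otimes>\<^bsub>AS\<^esub> h)"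
proof (rule section_eqI)
  fix \<gamma> assume \<gamma>: "\<gamma> \<in> arrows G"
  define y where "y = gdom G \<gamma>"
  interpret R: ring "stalk S (gran G \<gamma>)" by (rule ring_stalk_gran[OF \<gamma>])
  note fA = CS_AS[OF f] and gA = CS_AS[OF g] and hA = CS_AS[OF h]
  define K where "K = column_support h y"
  \<comment> \<open>Two demands are made on \<open>L\<close>: it must contain the support of
    \<open>g * h\<close> in column \<open>y\<close> to evaluate the outer product with
    \<open>f\<close>, and all \<open>\<sigma> \<rho>\<close> with \<open>\<sigma>\<close> in the
    support of \<open>g\<close>, so that dividing \<open>L\<close> by any \<open>\<rho>\<close> in
    \<open>K\<close> covers the column of \<open>g\<close> over the range of
    \<open>\<rho>\<close>.\<close>
  define L where "L = column_support (g \<otimes>\<^bsub>AS\<^esub> h) y \<union> (\<Union>\<rho> \<in> K. (\<lambda>\<sigma>. gmult G \<sigma> \<rho>) ` column_support g (gran G \<rho>))"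
  have K: "finite K" "K \<subseteq> {\<rho> \<in> arrows G. gdom G \<rho> = y}"
    using h column_support_subset by (auto simp: K_def CS_column_support)
  have L: "finite L" "L \<subseteq> {\<rho> \<in> arrows G. gdom G \<rho> = y}"
  proof -
    show "finite L"
      using g h K conv_CS CS_column_support by (auto simp: L_def)
    show "L \<subseteq> {\<rho> \<in> arrows G. gdom G \<rho> = y}"
    proof -
      have "gmult G \<sigma> \<rho> \<in> arrows G" "gdom G (gmult G \<sigma> \<rho>) = y" if "\<rho> \<in> K" "\<sigma> \<in> column_support g (gran G \<rho>)" for \<rho> \<sigma>
        using that K by (auto simp: column_support_def mult_closed dom_mult)
      then show ?thesis
        using column_support_subset by (auto simp: L_def)
    qed
  qed
  \<comment> \<open>The term of the factorisation
    \<open>\<gamma> = (\<gamma> \<tau>^-1)(\<tau> \<rho>^-1) \<rho>\<close>, bracketed to the right.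
    Here \<open>\<tau>\<close> stands for the product of the last two factors, which makes the index
    set of the inner sum independent of \<open>\<rho>\<close>.\<close>
  define T where "T \<rho> \<tau> = emult S (f (gdiv \<gamma> \<tau>))
     (act S (gdiv \<gamma> \<tau>) (emult S (g (gdiv \<tau> \<rho>)) (act S (gdiv \<tau> \<rho>) (h \<rho>))))" for \<rho> \<tau>
  have T: "T \<rho> \<tau> \<in> carrier (stalk S (gran G \<gamma>))" if "\<rho> \<in> K" "\<tau> \<in> L" for \<rho> \<tau>
  proof -
    have *: "\<rho> \<in> arrows G" "gdom G \<rho> = y" "\<tau> \<in> arrows G" "gdom G \<tau> = y"
      using that K L by auto
    have "emult S (g (gdiv \<tau> \<rho>)) (act S (gdiv \<tau> \<rho>) (h \<rho>)) \<in> carrier (stalk S (gran G \<tau>))"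
      using * by (intro conv_term_closed gA hA) auto
    then show ?thesis
      using * \<gamma> section_value[OF fA, of "gdiv \<gamma> \<tau>"] act_closed[of "gdiv \<gamma> \<tau>"] R.m_closed
      by (simp add: T_def y_def)
  qed
  have "(f \<otimes>\<^bsub>AS\<^esub> g \<otimes>\<^bsub>AS\<^esub> h) \<gamma> = finsum (stalk S (gran G \<gamma>))
     (\<lambda>\<rho>. emult S ((f \<otimes>\<^bsub>AS\<^esub> g) (gdiv \<gamma> \<rho>)) (act S (gdiv \<gamma> \<rho>) (h \<rho>))) K"
    by (rule CS_conv_apply[OF conv_CS[OF f g] h \<gamma>]) (use K in \<open>auto simp: K_def y_def\<close>)
  also have "\<dots> = finsum (stalk S (gran G \<gamma>)) (\<lambda>\<rho>. finsum (stalk S (gran G \<gamma>)) (T \<rho>) L) K"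
  proof (rule R.finsum_cong'[OF refl])
    fix \<rho> assume "\<rho> \<in> K"
    then have \<rho>: "\<rho> \<in> arrows G" "gdom G \<rho> = gdom G \<gamma>"
      using K by (auto simp: y_def)
    let ?\<delta> = "gdiv \<gamma> \<rho>" and ?q = "\<lambda>\<tau>. gdiv \<tau> \<rho>"
    let ?t = "\<lambda>\<sigma>. emult S (f (gdiv ?\<delta> \<sigma>)) (act S (gdiv ?\<delta> \<sigma>) (g \<sigma>))"
    have \<delta>: "?\<delta> \<in> arrows G" "gran G ?\<delta> = gran G \<gamma>" "gdom G ?\<delta> = gran G \<rho>"
      using \<rho> \<gamma> by auto
    have La: "\<tau> \<in> arrows G \<and> gdom G \<tau> = gdom G \<rho>" if "\<tau> \<in> L" for \<tau>
      using L \<rho> that by (auto simp: y_def)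
    have inj: "inj_on ?q L"
      by (rule inj_onI) (metis La \<rho>(1) gdiv_mult)
    have tc: "?t (?q \<tau>) \<in> carrier (stalk S (gran G \<gamma>))" if "\<tau> \<in> L" for \<tau>
      using conv_term_closed[OF fA gA \<delta>(1), of "?q \<tau>"] La[OF that] \<rho> \<delta> by simp
    have hc: "act S ?\<delta> (h \<rho>) \<in> carrier (stalk S (gran G \<gamma>))"
      using act_closed[OF \<delta>(1)] section_value[OF hA \<rho>(1)] \<delta> by simp
    have col: "column_support g (gdom G ?\<delta>) \<subseteq> ?q ` L"
    proof
      fix \<sigma> assume \<sigma>: "\<sigma> \<in> column_support g (gdom G ?\<delta>)"
      then have "gmult G \<sigma> \<rho> \<in> L"
        using \<open>\<rho> \<in> K\<close> \<delta> by (auto simp: L_def)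
      moreover have "\<sigma> = ?q (gmult G \<sigma> \<rho>)"
        using \<sigma> \<rho> \<delta> by (simp add: column_support_def)
      ultimately show "\<sigma> \<in> ?q ` L" by blast
    qed
    have "(f \<otimes>\<^bsub>AS\<^esub> g) ?\<delta> = finsum (stalk S (gran G ?\<delta>)) ?t (?q ` L)"
      by (rule CS_conv_apply[OF f g \<delta>(1)]) (use col L La \<rho> \<delta> in auto)
    also have "\<dots> = finsum (stalk S (gran G \<gamma>)) (\<lambda>\<tau>. ?t (?q \<tau>)) L"
      unfolding \<delta> by (rule R.finsum_reindex) (use inj tc in auto)
    finally have "emult S ((f \<otimes>\<^bsub>AS\<^esub> g) ?\<delta>) (act S ?\<delta> (h \<rho>)) =
        finsum (stalk S (gran G \<gamma>)) (\<lambda>\<tau>. emult S (?t (?q \<tau>)) (act S ?\<delta> (h \<rho>))) L"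
      using R.finsum_ldistr[OF L(1) hc, of "\<lambda>\<tau>. ?t (?q \<tau>)"] tc by auto
    also have "\<dots> = finsum (stalk S (gran G \<gamma>)) (T \<rho>) L"
    proof (rule R.finsum_cong'[OF refl])
      fix \<tau> assume "\<tau> \<in> L"
      then have \<tau>: "\<tau> \<in> arrows G" "gdom G \<tau> = gdom G \<rho>"
        using La by auto
      let ?\<epsilon> = "gdiv \<gamma> \<tau>"
      have \<epsilon>: "?\<epsilon> \<in> arrows G" "gran G ?\<epsilon> = gran G \<gamma>" "gdom G ?\<epsilon> = gran G \<tau>"
        using \<tau> \<gamma> \<rho> by auto
      have q: "?q \<tau> \<in> arrows G" "gran G (?q \<tau>) = gran G \<tau>" "gdom G (?q \<tau>) = gran G \<rho>"
        using \<tau> \<rho> by auto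
      have dd: "gdiv ?\<delta> (?q \<tau>) = ?\<epsilon>"
        using \<gamma> \<tau> \<rho> by (simp add: gdiv_gdiv)
      have mm: "gmult G ?\<epsilon> (?q \<tau>) = ?\<delta>"
        using gdiv_mult[of ?\<delta> "?q \<tau>"] dd \<delta> q by simp
      have hv: "h \<rho> \<in> carrier (stalk S (gran G \<rho>))"
        using section_value[OF hA \<rho>(1)] .
      have gv: "g (?q \<tau>) \<in> carrier (stalk S (gran G \<tau>))"
        using section_value[OF gA q(1)] q by simp
      have fv: "f ?\<epsilon> \<in> carrier (stalk S (gran G \<gamma>))"
        using section_value[OF fA \<epsilon>(1)] \<epsilon> by simp
      have av: "act S (?q \<tau>) (h \<rho>) \<in> carrier (stalk S (gran G \<tau>))"
        using act_closed[OF q(1)] hv q by simp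
      have ag: "act S ?\<epsilon> (g (?q \<tau>)) \<in> carrier (stalk S (gran G \<gamma>))"
        using act_closed[OF \<epsilon>(1)] gv \<epsilon> by simp
      have aa: "act S ?\<epsilon> (act S (?q \<tau>) (h \<rho>)) = act S ?\<delta> (h \<rho>)"
        using act_act[OF \<epsilon>(1) q(1), of "h \<rho>"] hv \<epsilon> q mm by (simp add: stalk_def)
      show "emult S (?t (?q \<tau>)) (act S ?\<delta> (h \<rho>)) = T \<rho> \<tau>"
        using R.m_assoc[OF fv ag hc] act_emult[OF \<epsilon>(1), of "g (?q \<tau>)" "act S (?q \<tau>) (h \<rho>)"] \<epsilon> gv av aa
        by (simp add: T_def dd)
    qed (use T \<open>\<rho> \<in> K\<close> in auto)
    finally show "emult S ((f \<otimes>\<^bsub>AS\<^esub> g) ?\<delta>) (act S ?\<delta> (h \<rho>)) = finsum (stalk S (gran G \<gamma>)) (T \<rho>) L" .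
  qed (use T in \<open>auto intro!: R.finsum_closed\<close>)
  also have "\<dots> = finsum (stalk S (gran G \<gamma>)) (\<lambda>\<tau>. finsum (stalk S (gran G \<gamma>)) (\<lambda>\<rho>. T \<rho> \<tau>) K) L"
    by (rule finsum_commute) (use K L T R.abelian_monoid_axioms in auto)
  also have "\<dots> = finsum (stalk S (gran G \<gamma>))
      (\<lambda>\<tau>. emult S (f (gdiv \<gamma> \<tau>)) (act S (gdiv \<gamma> \<tau>) ((g \<otimes>\<^bsub>AS\<^esub> h) \<tau>))) L"
  proof (rule R.finsum_cong'[OF refl])
    fix \<tau> assume "\<tau> \<in> L"
    then have \<tau>: "\<tau> \<in> arrows G" "gdom G \<tau> = gdom G \<gamma>"
      using L by (auto simp: y_def)
    let ?\<epsilon> = "gdiv \<gamma> \<tau>" and ?s = "\<lambda>\<rho>. emult S (g (gdiv \<tau> \<rho>)) (act S (gdiv \<tau> \<rho>) (h \<rho>))"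
    have \<epsilon>: "?\<epsilon> \<in> arrows G" "gran G ?\<epsilon> = gran G \<gamma>" "gdom G ?\<epsilon> = gran G \<tau>"
      using \<tau> \<gamma> by auto
    have s: "?s \<in> K \<rightarrow> carrier (stalk S (gran G \<tau>))"
      using K \<tau> by (auto intro!: conv_term_closed gA hA simp: y_def)
    have fv: "f ?\<epsilon> \<in> carrier (stalk S (gran G \<gamma>))"
      using section_value[OF fA \<epsilon>(1)] \<epsilon> by simp
    have as: "(\<lambda>\<rho>. act S ?\<epsilon> (?s \<rho>)) \<in> K \<rightarrow> carrier (stalk S (gran G \<gamma>))"
      using s act_closed[OF \<epsilon>(1)] \<epsilon> by (auto simp: Pi_def)
    have "(g \<otimes>\<^bsub>AS\<^esub> h) \<tau> = finsum (stalk S (gran G \<tau>)) ?s K"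
      by (rule CS_conv_apply[OF g h \<tau>(1)]) (use K \<tau> in \<open>auto simp: K_def y_def\<close>)
    then have "act S ?\<epsilon> ((g \<otimes>\<^bsub>AS\<^esub> h) \<tau>) = finsum (stalk S (gran G \<gamma>)) (\<lambda>\<rho>. act S ?\<epsilon> (?s \<rho>)) K"
      using act_finsum[OF \<epsilon>(1) K(1), of ?s] s \<epsilon> by simp
    then show "finsum (stalk S (gran G \<gamma>)) (\<lambda>\<rho>. T \<rho> \<tau>) K = emult S (f ?\<epsilon>) (act S ?\<epsilon> ((g \<otimes>\<^bsub>AS\<^esub> h) \<tau>))"
      using R.finsum_rdistr[OF K(1) fv as] by (simp add: T_def)
  next
    show "(\<lambda>\<tau>. emult S (f (gdiv \<gamma> \<tau>)) (act S (gdiv \<gamma> \<tau>) ((g \<otimes>\<^bsub>AS\<^esub> h) \<tau>))) \<in> L \<rightarrow> carrier (stalk S (gran G \<gamma>))"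
      using L \<gamma> by (auto intro!: conv_term_closed fA conv_in_AS g h simp: y_def)
  qed
  also have "\<dots> = (f \<otimes>\<^bsub>AS\<^esub> (g \<otimes>\<^bsub>AS\<^esub> h)) \<gamma>"
    by (rule CS_conv_apply[OF f conv_CS[OF g h] \<gamma>, symmetric]) (use L in \<open>auto simp: L_def y_def\<close>)
  finally show "(f \<otimes>\<^bsub>AS\<^esub> g \<otimes>\<^bsub>AS\<^esub> h) \<gamma> = (f \<otimes>\<^bsub>AS\<^esub> (g \<otimes>\<^bsub>AS\<^esub> h)) \<gamma>" .
qed (use f g h conv_CS conv_in_AS in auto)

lemma CS_add: "f \<in> carrier CS \<Longrightarrow> g \<in> carrier CS \<Longrightarrow> f \<oplus>\<^bsub>AS\<^esub> g \<in> carrier CS"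
  using subgroup.m_closed[OF subgroup_CS] by simp

lemma conv_l_distr:
  assumes f: "f \<in> carrier CS" and g: "g \<in> carrier CS" and h: "h \<in> carrier CS"
  shows "(f \<oplus>\<^bsub>AS\<^esub> g) \<otimes>\<^bsub>AS\<^esub> h = f \<otimes>\<^bsub>AS\<^esub> h \<oplus>\<^bsub>AS\<^esub> g \<otimes>\<^bsub>AS\<^esub> h"
proof (rule section_eqI)
  fix \<gamma> assume \<gamma>: "\<gamma> \<in> arrows G"
  interpret R: ring "stalk S (gran G \<gamma>)" by (rule ring_stalk_gran[OF \<gamma>])
  let ?K = "column_support h (gdom G \<gamma>)"
  let ?t = "\<lambda>f \<rho>. emult S (f (gdiv \<gamma> \<rho>)) (act S (gdiv \<gamma> \<rho>) (h \<rho>))"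
  have t: "?t f \<in> ?K \<rightarrow> carrier (stalk S (gran G \<gamma>))" if "f \<in> carrier CS" for f
    using that h \<gamma> by (auto intro!: conv_term_closed CS_AS simp: column_support_def)
  have conv: "(f \<otimes>\<^bsub>AS\<^esub> h) \<gamma> = finsum (stalk S (gran G \<gamma>)) (?t f) ?K" if "f \<in> carrier CS" for f
    by (rule CS_conv_apply[OF that h \<gamma> CS_column_support[OF h] subset_refl column_support_subset])
  have "finsum (stalk S (gran G \<gamma>)) (?t (f \<oplus>\<^bsub>AS\<^esub> g)) ?K =
      finsum (stalk S (gran G \<gamma>)) (\<lambda>\<rho>. ?t f \<rho> \<oplus>\<^bsub>stalk S (gran G \<gamma>)\<^esub> ?t g \<rho>) ?K"
  proof (rule R.finsum_cong'[OF refl])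
    fix \<rho> assume "\<rho> \<in> ?K"
    then have \<rho>: "\<rho> \<in> arrows G" "gdom G \<rho> = gdom G \<gamma>"
      by (auto simp: column_support_def)
    have "f (gdiv \<gamma> \<rho>) \<in> carrier (stalk S (gran G \<gamma>))" "g (gdiv \<gamma> \<rho>) \<in> carrier (stalk S (gran G \<gamma>))"
      using section_value[OF CS_AS[OF f], of "gdiv \<gamma> \<rho>"] section_value[OF CS_AS[OF g], of "gdiv \<gamma> \<rho>"] \<gamma> \<rho>
      by auto
    moreover have "act S (gdiv \<gamma> \<rho>) (h \<rho>) \<in> carrier (stalk S (gran G \<gamma>))"
      using section_value[OF CS_AS[OF h], of \<rho>] act_closed[of "gdiv \<gamma> \<rho>"] \<gamma> \<rho> by simp
    ultimately show "?t (f \<oplus>\<^bsub>AS\<^esub> g) \<rho> = ?t f \<rho> \<oplus>\<^bsub>stalk S (gran G \<gamma>)\<^esub> ?t g \<rho>"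
      using R.l_distr \<gamma> \<rho> by simp
  qed (use t[OF f] t[OF g] R.add.m_closed in \<open>auto simp: Pi_def\<close>)
  then show "((f \<oplus>\<^bsub>AS\<^esub> g) \<otimes>\<^bsub>AS\<^esub> h) \<gamma> = (f \<otimes>\<^bsub>AS\<^esub> h \<oplus>\<^bsub>AS\<^esub> g \<otimes>\<^bsub>AS\<^esub> h) \<gamma>"
    using conv[OF CS_add[OF f g]] conv[OF f] conv[OF g] R.finsum_addf[OF t[OF f] t[OF g]] \<gamma> by simp
qed (use f g h CS_add conv_CS CS_AS in auto)

lemma conv_r_distr:
  assumes f: "f \<in> carrier CS" and g: "g \<in> carrier CS" and h: "h \<in> carrier CS"
  shows "h \<otimes>\<^bsub>AS\<^esub> (f \<oplus>\<^bsub>AS\<^esub> g) = h \<otimes>\<^bsub>AS\<^esub> f \<oplus>\<^bsub>AS\<^esub> h \<otimes>\<^bsub>AS\<^esub> g"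
proof (rule section_eqI)
  fix \<gamma> assume \<gamma>: "\<gamma> \<in> arrows G"
  interpret R: ring "stalk S (gran G \<gamma>)" by (rule ring_stalk_gran[OF \<gamma>])
  let ?y = "gdom G \<gamma>"
  \<comment> \<open>Adjoining the support of the sum as well lets all three products be evaluated
    over the same index set.\<close>
  let ?K = "column_support f ?y \<union> column_support g ?y \<union> column_support (f \<oplus>\<^bsub>AS\<^esub> g) ?y"
  let ?t = "\<lambda>f \<rho>. emult S (h (gdiv \<gamma> \<rho>)) (act S (gdiv \<gamma> \<rho>) (f \<rho>))"
  have t: "?t f \<in> ?K \<rightarrow> carrier (stalk S (gran G \<gamma>))" if "f \<in> carrier CS" for f
    using that h \<gamma> by (auto intro!: conv_term_closed CS_AS simp: column_support_def)
  have K: "finite ?K" "?K \<subseteq> {\<rho> \<in> arrows G. gdom G \<rho> = ?y}"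
    using f g CS_column_support CS_add column_support_subset by auto
  have conv: "(h \<otimes>\<^bsub>AS\<^esub> f') \<gamma> = finsum (stalk S (gran G \<gamma>)) (?t f') ?K"
    if "f' \<in> carrier CS" "column_support f' ?y \<subseteq> ?K" for f'
    by (rule CS_conv_apply[OF h that(1) \<gamma> K(1) that(2) K(2)])
  have "finsum (stalk S (gran G \<gamma>)) (?t (f \<oplus>\<^bsub>AS\<^esub> g)) ?K =
      finsum (stalk S (gran G \<gamma>)) (\<lambda>\<rho>. ?t f \<rho> \<oplus>\<^bsub>stalk S (gran G \<gamma>)\<^esub> ?t g \<rho>) ?K"
  proof (rule R.finsum_cong'[OF refl])
    fix \<rho> assume "\<rho> \<in> ?K"
    then have \<rho>: "\<rho> \<in> arrows G" "gdom G \<rho> = gdom G \<gamma>"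
      by (auto simp: column_support_def)
    have v: "f \<rho> \<in> carrier (stalk S (gran G \<rho>))" "g \<rho> \<in> carrier (stalk S (gran G \<rho>))"
      using section_value[OF CS_AS[OF f], of \<rho>] section_value[OF CS_AS[OF g], of \<rho>] \<rho> by auto
    then have "act S (gdiv \<gamma> \<rho>) (f \<rho>) \<in> carrier (stalk S (gran G \<gamma>))"
       "act S (gdiv \<gamma> \<rho>) (g \<rho>) \<in> carrier (stalk S (gran G \<gamma>))"
      using act_closed[of "gdiv \<gamma> \<rho>"] \<gamma> \<rho> by auto
    moreover have "h (gdiv \<gamma> \<rho>) \<in> carrier (stalk S (gran G \<gamma>))"
      using section_value[OF CS_AS[OF h], of "gdiv \<gamma> \<rho>"] \<gamma> \<rho> by auto
    ultimately show "?t (f \<oplus>\<^bsub>AS\<^esub> g) \<rho> = ?t f \<rho> \<oplus>\<^bsub>stalk S (gran G \<gamma>)\<^esub> ?t g \<rho>"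
      using R.r_distr act_eadd[of "gdiv \<gamma> \<rho>" "f \<rho>" "g \<rho>"] v \<gamma> \<rho> by simp
  qed (use t[OF f] t[OF g] R.add.m_closed in \<open>auto simp: Pi_def\<close>)
  then show "(h \<otimes>\<^bsub>AS\<^esub> (f \<oplus>\<^bsub>AS\<^esub> g)) \<gamma> = (h \<otimes>\<^bsub>AS\<^esub> f \<oplus>\<^bsub>AS\<^esub> h \<otimes>\<^bsub>AS\<^esub> g) \<gamma>"
    unfolding add_apply[OF \<gamma>]
    using conv[OF CS_add[OF f g] Un_upper2] conv[OF f le_supI1[OF Un_upper1]] conv[OF g le_supI1[OF Un_upper2]]
      R.finsum_addf[OF t[OF f] t[OF g]]
    by simp
qed (use f g h CS_add conv_CS CS_AS in auto)

section \<open>Indicator sections on units and the identity of the column-finite ring\<close>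

definition unit_section :: "'g set \<Rightarrow> 'g \<Rightarrow> 'e" where
  "unit_section Y = (\<lambda>\<gamma> \<in> arrows G. if \<gamma> \<in> Y then eone S \<gamma> else ezero S (gran G \<gamma>))"

lemma unit_section_apply:
  "\<gamma> \<in> arrows G \<Longrightarrow> unit_section Y \<gamma> = (if \<gamma> \<in> Y then eone S \<gamma> else ezero S (gran G \<gamma>))"
  by (simp add: unit_section_def)

lemma one_unit_section: "\<one>\<^bsub>AS\<^esub> = unit_section (units G)"
  by (simp add: all_sections_def unit_section_def)

lemma ezero_closed: "\<gamma> \<in> arrows G \<Longrightarrow> ezero S (gran G \<gamma>) \<in> carrier (stalk S (gran G \<gamma>))"
  using ring.ring_simprules(2)[OF ring_stalk_gran] by simp

lemma eone_closed: "\<gamma> \<in> arrows G \<Longrightarrow> eone S (gran G \<gamma>) \<in> carrier (stalk S (gran G \<gamma>))"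
  using ring.ring_simprules(6)[OF ring_stalk_gran] by simp

lemma gdiv_self: "\<gamma> \<in> arrows G \<Longrightarrow> gdiv \<gamma> \<gamma> = gran G \<gamma>"
  by (simp add: gdiv_def gran_def)

lemma gdiv_gdom: "\<gamma> \<in> arrows G \<Longrightarrow> gdiv \<gamma> (gdom G \<gamma>) = \<gamma>"
  using mult_gdiv[of \<gamma> "gdom G \<gamma>"] by (simp add: mult_dom)

lemma unit_section_CS:
  assumes "Y \<subseteq> units G"
  shows "unit_section Y \<in> carrier CS"
proof (rule CS_I)
  show "unit_section Y \<in> carrier AS"
    unfolding unit_section_def
    using assms ezero_closed eone_closed by (intro restrict_section) force
  show "finite {\<gamma> \<in> arrows G. gdom G \<gamma> = y \<and> unit_section Y \<gamma> \<noteq> ezero S (gran G \<gamma>)}" for y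
    by (rule finite_subset[of _ "{y}"]) (use assms in \<open>auto simp: unit_section_apply split: if_splits\<close>)
qed

text \<open>A left factor \<open>\<gamma> \<rho>^-1\<close> in \<open>Y\<close> is a unit, which
  forces \<open>\<rho> = \<gamma>\<close>; so the sum has the single term at
  \<open>\<rho> = \<gamma>\<close>, whose left factor is the range of \<open>\<gamma>\<close>.
  Indicators on the left thus select rows.\<close>

lemma unit_section_conv:
  assumes Y: "Y \<subseteq> units G" and g: "g \<in> carrier CS" and \<gamma>: "\<gamma> \<in> arrows G"
  shows "(unit_section Y \<otimes>\<^bsub>AS\<^esub> g) \<gamma> = (if gran G \<gamma> \<in> Y then g \<gamma> else ezero S (gran G \<gamma>))"
proof -
  interpret R: ring "stalk S (gran G \<gamma>)" by (rule ring_stalk_gran[OF \<gamma>])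
  have gv: "g \<gamma> \<in> carrier (stalk S (gran G \<gamma>))"
    using section_value[OF CS_AS[OF g] \<gamma>] .
  have "(unit_section Y \<otimes>\<^bsub>AS\<^esub> g) \<gamma> = emult S (unit_section Y (gdiv \<gamma> \<gamma>)) (act S (gdiv \<gamma> \<gamma>) (g \<gamma>))"
  proof (rule conv_single[OF unit_section_CS[OF Y] g \<gamma> \<gamma> refl])
    fix \<rho> assume \<rho>: "\<rho> \<in> arrows G" "gdom G \<rho> = gdom G \<gamma>" "\<rho> \<noteq> \<gamma>"
    have "gdiv \<gamma> \<rho> \<notin> Y"
    proof
      assume "gdiv \<gamma> \<rho> \<in> Y"
      then have "gdiv \<gamma> \<rho> \<in> units G"
        using Y by auto
      then have "gdiv \<gamma> \<rho> = gran G \<rho>"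
        using \<rho> \<gamma> by (metis gdom_unit gdom_gdiv)
      then have "\<gamma> = \<rho>"
        using gdiv_mult[of \<gamma> \<rho>] \<rho> \<gamma> by (simp add: ran_mult_self)
      with \<rho> show False by simp
    qed
    then show "unit_section Y (gdiv \<gamma> \<rho>) = ezero S (gran G \<gamma>)"
      using \<rho> \<gamma> by (simp add: unit_section_apply)
  qed
  also have "act S (gdiv \<gamma> \<gamma>) (g \<gamma>) = g \<gamma>"
    using gv act_unit[of "g \<gamma>"] \<gamma> by (simp add: gdiv_self stalk_def)
  finally show ?thesis
    using R.l_one[OF gv] R.l_null[OF gv] \<gamma> by (simp add: gdiv_self unit_section_apply)
qed

text \<open>The only unit in the fibre of \<open>\<gamma>\<close> is its source, so the sum has a
  single term there. Indicators on the right thus select columns.\<close>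

lemma conv_unit_section:
  assumes Y: "Y \<subseteq> units G" and g: "g \<in> carrier CS" and \<gamma>: "\<gamma> \<in> arrows G"
  shows "(g \<otimes>\<^bsub>AS\<^esub> unit_section Y) \<gamma> = (if gdom G \<gamma> \<in> Y then g \<gamma> else ezero S (gran G \<gamma>))"
proof -
  interpret R: ring "stalk S (gran G \<gamma>)" by (rule ring_stalk_gran[OF \<gamma>])
  let ?y = "gdom G \<gamma>"
  have gv: "g \<gamma> \<in> carrier (stalk S (gran G \<gamma>))"
    using section_value[OF CS_AS[OF g] \<gamma>] .
  have "(g \<otimes>\<^bsub>AS\<^esub> unit_section Y) \<gamma> = emult S (g (gdiv \<gamma> ?y)) (act S (gdiv \<gamma> ?y) (unit_section Y ?y))"
  proof (rule conv_single[OF g unit_section_CS[OF Y] \<gamma>])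
    fix \<rho> assume \<rho>: "\<rho> \<in> arrows G" "gdom G \<rho> = gdom G \<gamma>" "\<rho> \<noteq> ?y"
      "unit_section Y \<rho> \<noteq> ezero S (gran G \<rho>)"
    then have "\<rho> \<in> units G"
      using Y by (auto simp: unit_section_apply split: if_splits)
    with \<rho> show "g (gdiv \<gamma> \<rho>) = ezero S (gran G \<gamma>)"
      by simp
  qed (use \<gamma> in auto)
  moreover have "act S \<gamma> (unit_section Y ?y) = (if ?y \<in> Y then eone S (gran G \<gamma>) else ezero S (gran G \<gamma>))"
    using act_eone[OF \<gamma>] act_ezero[OF \<gamma>] \<gamma> by (simp add: unit_section_apply)
  ultimately show ?thesis
    using R.r_one[OF gv] R.r_null[OF gv] \<gamma> by (simp add: gdiv_gdom)
qed

lemma ring_CS: "ring CS"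
proof (rule ringI)
  show "abelian_group CS" by (rule abelian_group_CS)
  show "monoid CS"
  proof (rule monoidI)
    fix f assume f: "f \<in> carrier CS"
    show "\<one>\<^bsub>CS\<^esub> \<otimes>\<^bsub>CS\<^esub> f = f" "f \<otimes>\<^bsub>CS\<^esub> \<one>\<^bsub>CS\<^esub> = f"
      by (rule section_eqI; use f unit_section_CS conv_CS CS_AS in
        \<open>force simp: one_unit_section unit_section_conv conv_unit_section\<close>)+
  qed (use conv_CS unit_section_CS conv_assoc in \<open>auto simp: one_unit_section\<close>)
qed (use conv_l_distr conv_r_distr in auto)

section \<open>Isotropy rings as corners\<close>

definition corner :: "'g \<Rightarrow> ('g \<Rightarrow> 'e) ring" where
  "corner x = CS\<lparr>carrier := {u \<in> carrier CS. unit_section {x} \<otimes>\<^bsub>CS\<^esub> u = u \<and> u \<otimes>\<^bsub>CS\<^esub> unit_section {x} = u},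
     one := unit_section {x}\<rparr>"

lemma corner_sel [simp]:
  "add (corner x) = add AS" "mult (corner x) = mult AS" "zero (corner x) = zero AS" "one (corner x) = unit_section {x}"
  by (simp_all add: corner_def)

text \<open>Being fixed by the indicator of \<open>x\<close> on the left means vanishing off the
  arrows with range \<open>x\<close>, and on the right off those with source \<open>x\<close>. So
  the corner consists of sections supported on the isotropy group.\<close>

lemma carrier_corner:
  assumes x: "x \<in> units G"
  shows "u \<in> carrier (corner x) \<longleftrightarrow> u \<in> carrier CS \<and>
    (\<forall>\<gamma> \<in> arrows G. (gdom G \<gamma> \<noteq> x \<or> gran G \<gamma> \<noteq> x) \<longrightarrow> u \<gamma> = ezero S (gran G \<gamma>))"
proof -
  have Y: "{x} \<subseteq> units G" using x by simp
  have eq: "w = u \<longleftrightarrow> (\<forall>\<gamma> \<in> arrows G. w \<gamma> = u \<gamma>)" if "w \<in> carrier AS" "u \<in> carrier AS" for w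
    using section_eqI that by metis
  show ?thesis
  proof (cases "u \<in> carrier CS")
    case True
    then show ?thesis
      using conv_CS[OF unit_section_CS[OF Y] True] conv_CS[OF True unit_section_CS[OF Y]]
      by (auto simp: corner_def eq CS_AS unit_section_conv[OF Y] conv_unit_section[OF Y])
  qed (simp add: corner_def)
qed

lemma ring_corner:
  assumes x: "x \<in> units G"
  shows "ring (corner x)"
proof -
  interpret ring CS by (rule ring_CS)
  have Y: "{x} \<subseteq> units G" using x by simp
  have "unit_section {x} \<otimes>\<^bsub>AS\<^esub> unit_section {x} = unit_section {x}"
    by (rule section_eqI)
      (use x conv_CS[OF unit_section_CS[OF Y] unit_section_CS[OF Y]] in
        \<open>auto simp: CS_AS unit_section_CS[OF Y] unit_section_conv[OF Y], auto simp: unit_section_def\<close>)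
  then show ?thesis
    unfolding corner_def using corner_ring[of "unit_section {x}"] unit_section_CS[OF Y] by simp
qed

lemma carrier_isotropy: "\<delta> \<in> carrier (isotropy G x) \<longleftrightarrow> \<delta> \<in> arrows G \<and> gdom G \<delta> = x \<and> gran G \<delta> = x"
  by (simp add: isotropy_def)

text \<open>The isotropy group lies in one fibre of \<open>gdom\<close>, so column-finiteness
  becomes the finite support required in the skew group ring. Both products sum over the
  factorisations of \<open>\<gamma>\<close> with nonzero factors, and for corner elements such
  factors already lie in the isotropy group.\<close>

lemma restrict_corner_iso:
  assumes x: "x \<in> units G"
  shows "(\<lambda>u. restrict u (carrier (isotropy G x))) \<in> ring_iso (corner x) (isotropy_skew_ring G S x)"
    (is "?res \<in> _")
proof (rule ring_iso_memI)
  let ?B = "isotropy_skew_ring G S x" and ?H = "carrier (isotropy G x)"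
  have val: "u \<delta> \<in> carrier (stalk S x)" if "u \<in> carrier (corner x)" "\<delta> \<in> ?H" for u \<delta>
    using that section_value[of u \<delta>] by (auto simp: carrier_corner[OF x] carrier_isotropy dest: CS_AS)
  have off: "\<gamma> \<in> ?H" if "u \<in> carrier (corner x)" "\<gamma> \<in> arrows G" "u \<gamma> \<noteq> ezero S (gran G \<gamma>)" for u \<gamma>
    using that by (auto simp: carrier_corner[OF x] carrier_isotropy)
  show closed: "?res u \<in> carrier ?B" if u: "u \<in> carrier (corner x)" for u
  proof -
    have "{\<delta> \<in> ?H. ?res u \<delta> \<noteq> \<zero>\<^bsub>stalk S x\<^esub>} \<subseteq> column_support u x"
      by (auto simp: column_support_def carrier_isotropy)
    then have "finite {\<delta> \<in> ?H. ?res u \<delta> \<noteq> \<zero>\<^bsub>stalk S x\<^esub>}"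
      by (rule finite_subset) (use u carrier_corner[OF x] CS_column_support in auto)
    then show ?thesis
      using val[OF u] by (auto simp: isotropy_skew_ring_def skew_group_ring_def)
  qed
  show "?res (u \<oplus>\<^bsub>corner x\<^esub> v) = ?res u \<oplus>\<^bsub>?B\<^esub> ?res v"
    if "u \<in> carrier (corner x)" "v \<in> carrier (corner x)" for u v
    by (rule ext) (auto simp: isotropy_skew_ring_def skew_group_ring_def carrier_isotropy)
  show "?res \<one>\<^bsub>corner x\<^esub> = \<one>\<^bsub>?B\<^esub>"
    by (rule ext)
      (auto simp: isotropy_skew_ring_def skew_group_ring_def carrier_isotropy unit_section_apply isotropy_def)
  show "?res (u \<otimes>\<^bsub>corner x\<^esub> v) = ?res u \<otimes>\<^bsub>?B\<^esub> ?res v"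
    if u: "u \<in> carrier (corner x)" and v: "v \<in> carrier (corner x)" for u v
  proof (rule ext)
    fix \<gamma>
    let ?P = "{(\<beta>, \<rho>). \<beta> \<in> arrows G \<and> \<rho> \<in> arrows G \<and> gdom G \<beta> = gran G \<rho> \<and> gmult G \<beta> \<rho> = \<gamma> \<and>
             u \<beta> \<noteq> ezero S (gran G \<beta>) \<and> v \<rho> \<noteq> ezero S (gran G \<rho>)}"
    let ?Q = "{(\<delta>, \<eta>). \<delta> \<in> ?H \<and> \<eta> \<in> ?H \<and> gmult G \<delta> \<eta> = \<gamma> \<and>
             ?res u \<delta> \<noteq> ezero S x \<and> ?res v \<eta> \<noteq> ezero S x}"
    interpret R: ring "stalk S x" by (rule ring_stalk[OF x])
    show "?res (u \<otimes>\<^bsub>corner x\<^esub> v) \<gamma> = (?res u \<otimes>\<^bsub>?B\<^esub> ?res v) \<gamma>"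
    proof (cases "\<gamma> \<in> ?H")
      case True
      then have \<gamma>: "\<gamma> \<in> arrows G" "gran G \<gamma> = x"
        by (auto simp: carrier_isotropy)
      \<comment> \<open>Equality of the two index sets: nonzero values of \<open>u\<close> and
        \<open>v\<close> occur only at isotropy arrows, where restriction changes nothing.\<close>
      have PQ: "?P = ?Q"
      proof -
        have "\<beta> \<in> ?H \<and> \<rho> \<in> ?H \<and> gmult G \<beta> \<rho> = \<gamma> \<and> ?res u \<beta> \<noteq> ezero S x \<and> ?res v \<rho> \<noteq> ezero S x"
          if "(\<beta>, \<rho>) \<in> ?P" for \<beta> \<rho>
          using that off[OF u, of \<beta>] off[OF v, of \<rho>] by (auto simp: carrier_isotropy)
        moreover have "(\<beta>, \<rho>) \<in> ?P" if "(\<beta>, \<rho>) \<in> ?Q" for \<beta> \<rho>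
          using that by (auto simp: carrier_isotropy)
        ultimately show ?thesis by blast
      qed
      have "(u \<otimes>\<^bsub>AS\<^esub> v) \<gamma> = finsum (stalk S x) (\<lambda>(\<beta>, \<rho>). emult S (u \<beta>) (act S \<beta> (v \<rho>))) ?P"
        using \<gamma> by (simp add: all_sections_def)
      also have "\<dots> = finsum (stalk S x) (\<lambda>(\<beta>, \<rho>). emult S (?res u \<beta>) (act S \<beta> (?res v \<rho>))) ?Q"
      proof (rule R.finsum_cong'[OF PQ])
        have "emult S (?res u \<beta>) (act S \<beta> (?res v \<rho>)) \<in> carrier (stalk S x)" if "\<beta> \<in> ?H" "\<rho> \<in> ?H" for \<beta> \<rho>
          using that val[OF u] val[OF v] act_closed[of \<beta> "v \<rho>"] R.m_closed by (simp add: carrier_isotropy)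
        then show "(\<lambda>(\<beta>, \<rho>). emult S (?res u \<beta>) (act S \<beta> (?res v \<rho>))) \<in> ?Q \<rightarrow> carrier (stalk S x)"
          by auto
      qed auto
      also have "\<dots> = (?res u \<otimes>\<^bsub>?B\<^esub> ?res v) \<gamma>"
        using True by (simp add: isotropy_skew_ring_def skew_group_ring_def isotropy_def)
      finally show ?thesis
        using True by simp
    qed (simp add: isotropy_skew_ring_def skew_group_ring_def)
  qed
  show "bij_betw ?res (carrier (corner x)) (carrier ?B)"
  proof (rule bij_betw_byWitness)
    \<comment> \<open>The inverse is extension by zero. The outer restriction makes the result
      undefined off the arrows, as membership in \<open>all_sections\<close> demands.\<close>
    let ?ext = "\<lambda>b. \<lambda>\<gamma> \<in> arrows G. if \<gamma> \<in> ?H then b \<gamma> else ezero S (gran G \<gamma>)"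
    show "\<forall>u \<in> carrier (corner x). ?ext (?res u) = u"
    proof
      fix u assume u: "u \<in> carrier (corner x)"
      have uA: "u \<in> carrier AS"
        using u carrier_corner[OF x] CS_AS by blast
      then have "u \<in> extensional (arrows G)"
        by (simp add: all_sections_def PiE_def)
      then show "?ext (?res u) = u"
        using off[OF u] by (intro ext) (force simp: extensional_def)
    qed
    have arr: "\<delta> \<in> arrows G" "gran G \<delta> = x" "gdom G \<delta> = x" if "\<delta> \<in> ?H" for \<delta>
      using that by (auto simp: carrier_isotropy)
    have B: "carrier ?B = {a \<in> ?H \<rightarrow>\<^sub>E carrier (stalk S x). finite {\<delta> \<in> ?H. a \<delta> \<noteq> ezero S x}}"
      by (simp add: isotropy_skew_ring_def skew_group_ring_def)
    show "\<forall>b \<in> carrier ?B. ?res (?ext b) = b"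
    proof
      fix b assume "b \<in> carrier ?B"
      then have "b \<gamma> = undefined" if "\<gamma> \<notin> ?H" for \<gamma>
        using that PiE_arb unfolding B by blast
      then show "?res (?ext b) = b"
        using arr(1) by (intro ext) (simp add: restrict_def)
    qed
    show "?res ` carrier (corner x) \<subseteq> carrier ?B"
      using closed by auto
    show "?ext ` carrier ?B \<subseteq> carrier (corner x)"
    proof
      fix u assume "u \<in> ?ext ` carrier ?B"
      then obtain b where b: "b \<in> carrier ?B" and u: "u = ?ext b"
        by auto
      have uA: "u \<in> carrier AS"
        unfolding u
      proof (rule restrict_section)
        fix \<gamma> assume "\<gamma> \<in> arrows G"
        then show "(if \<gamma> \<in> ?H then b \<gamma> else ezero S (gran G \<gamma>)) \<in> carrier (stalk S (gran G \<gamma>))"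
          using b arr ezero_closed by (auto simp: B)
      qed
      have fin: "finite {\<delta> \<in> ?H. b \<delta> \<noteq> ezero S x}"
        using b by (simp add: B)
      have "u \<in> carrier CS"
      proof (rule CS_I[OF uA])
        show "finite {\<gamma> \<in> arrows G. gdom G \<gamma> = y \<and> u \<gamma> \<noteq> ezero S (gran G \<gamma>)}" for y
          by (rule finite_subset[OF _ fin]) (use arr in \<open>auto simp: u\<close>)
      qed
      then show "u \<in> carrier (corner x)"
        unfolding carrier_corner[OF x] by (auto simp: u carrier_isotropy)
    qed
  qed
qed

text \<open>Transport along the isomorphism replaces a direct check of the ring axioms for the skew
  product. The transported structure has the image of zero as its zero, so that image is identified
  first.\<close>

lemma ring_isotropy_skew_ring:
  assumes x: "x \<in> units G"
  shows "ring (isotropy_skew_ring G S x)"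
proof -
  interpret ring "corner x" by (rule ring_corner[OF x])
  let ?B = "isotropy_skew_ring G S x"
  have "restrict \<zero>\<^bsub>AS\<^esub> (carrier (isotropy G x)) = \<zero>\<^bsub>?B\<^esub>"
    by (rule ext) (auto simp: isotropy_skew_ring_def skew_group_ring_def carrier_isotropy)
  then show ?thesis
    using ring_iso_imp_img_ring[OF restrict_corner_iso[OF x]] by simp
qed

section \<open>Compact open bisections and density\<close>

lemma topspace_gtop [simp]: "topspace (gtop G) = arrows G"
  by (simp add: arrows_def)

lemma topspace_unit_space [simp]: "topspace (unit_space G) = units G"
  using units_arrows by (auto simp: unit_space_def)

lemma continuous_gran: "continuous_map (gtop G) (unit_space G) (gran G)"
  using ran_local_homeomorphism by (rule local_homeomorphism_continuous)

lemma open_gran: "open_map (gtop G) (unit_space G) (gran G)"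
  using ran_local_homeomorphism by (rule local_homeomorphism_open_map)

lemma continuous_gdom: "continuous_map (gtop G) (unit_space G) (gdom G)"
proof -
  have "continuous_map (gtop G) (unit_space G) (gran G \<circ> ginv G)"
    using continuous_inv continuous_gran by (rule continuous_map_compose)
  then show ?thesis
    by (rule continuous_map_eq) simp
qed

text \<open>The arrow space itself may fail to be Hausdorff, so separation is pulled back from the
  unit space along the continuous map \<open>gran G\<close>, which is injective on a
  bisection.\<close>

lemma bisection_Hausdorff:
  assumes "bisection G U"
  shows "Hausdorff_space (subtopology (gtop G) U)"
proof (rule Hausdorff_space_injective_preimage[OF unit_space_Hausdorff])
  show "continuous_map (subtopology (gtop G) U) (unit_space G) (gran G)"
    using continuous_gran by (rule continuous_map_from_subtopology)
  show "inj_on (gran G) (topspace (subtopology (gtop G) U))"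
    using assms by (auto simp: bisection_def inj_on_def)
qed

lemma compact_open_bisection_basis:
  assumes W: "openin (gtop G) W" and \<gamma>: "\<gamma> \<in> W"
  obtains V where "compact_open_bisection G V" "\<gamma> \<in> V" "V \<subseteq> W"
proof -
  have \<gamma>G: "\<gamma> \<in> arrows G"
    using openin_subset[OF W] \<gamma> by auto
  obtain U1 where U1: "openin (gtop G) U1" "\<gamma> \<in> U1" "inj_on (gran G) U1"
    using local_homeomorphism_inj[OF ran_local_homeomorphism, of \<gamma>] \<gamma>G by auto
  obtain U2 where U2: "openin (gtop G) U2" "ginv G \<gamma> \<in> U2" "inj_on (gran G) U2"
    using local_homeomorphism_inj[OF ran_local_homeomorphism, of "ginv G \<gamma>"] \<gamma>G by auto
  \<comment> \<open>Inversion exchanges range and source, so injectivity of \<open>gran\<close> near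
    the inverse of \<open>\<gamma>\<close> becomes injectivity of \<open>gdom\<close> near
    \<open>\<gamma>\<close>.\<close>
  define U3 where "U3 = {\<beta> \<in> arrows G. ginv G \<beta> \<in> U2}"
  have U3: "openin (gtop G) U3" "\<gamma> \<in> U3"
    using openin_continuous_map_preimage[OF continuous_inv U2(1)] U2(2) \<gamma>G by (auto simp: U3_def)
  have inj3: "inj_on (gdom G) U3"
  proof (rule inj_onI)
    fix \<beta> \<rho> assume *: "\<beta> \<in> U3" "\<rho> \<in> U3" "gdom G \<beta> = gdom G \<rho>"
    then have "ginv G \<beta> = ginv G \<rho>"
      using inj_onD[OF U2(3), of "ginv G \<beta>" "ginv G \<rho>"] by (auto simp: U3_def)
    then show "\<beta> = \<rho>"
      using * by (metis (mono_tags, lifting) U3_def inv_inv mem_Collect_eq)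
  qed
  define U where "U = U1 \<inter> U3 \<inter> W"
  have U: "openin (gtop G) U" "\<gamma> \<in> U" "inj_on (gran G) U" "inj_on (gdom G) U"
    using U1 U3 W \<gamma> inj3 by (auto simp: U_def inj_on_def)
  have "openin (unit_space G) (gran G ` U)"
    using open_gran U(1) by (auto simp: open_map_def)
  then obtain K where K: "compactin (unit_space G) K" "openin (unit_space G) K" "gran G \<gamma> \<in> K" "K \<subseteq> gran G ` U"
    using unit_space_compact_open_basis U(2) unfolding neighbourhood_base_of
    by (metis (no_types, lifting) image_eqI in_mono)
  define V where "V = {\<beta> \<in> U. gran G \<beta> \<in> K}"
  have VU: "V \<subseteq> U" by (auto simp: V_def)
  have UG: "U \<subseteq> arrows G"
    using openin_subset[OF U(1)] by simp
  have "V = inv_into U (gran G) ` K"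
  proof (intro equalityI subsetI)
    show "\<beta> \<in> inv_into U (gran G) ` K" if "\<beta> \<in> V" for \<beta>
      using that U(3) by (intro image_eqI[of _ _ "gran G \<beta>"]) (auto simp: V_def)
    show "\<beta> \<in> V" if "\<beta> \<in> inv_into U (gran G) ` K" for \<beta>
      using that K(4) by (auto simp: V_def inv_into_into f_inv_into_f subset_iff)
  qed
  moreover have "compactin (subtopology (unit_space G) (gran G ` U)) K"
    using K by (simp add: compactin_subtopology)
  ultimately have "compactin (gtop G) V"
    using image_compactin open_map_continuous_inv_into[OF open_gran U(1,3)] by metis
  moreover have "openin (gtop G) V"
    unfolding V_def using continuous_gran U(1) K(2) by (rule openin_continuous_map_preimage_gen)
  moreover have "bisection G V"
    using U VU UG inj_on_subset unfolding bisection_def by blast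
  ultimately have "compact_open_bisection G V"
    by (simp add: compact_open_bisection_def bisection_Hausdorff)
  moreover have "\<gamma> \<in> V" "V \<subseteq> W"
    using U(2) K(3) by (auto simp: V_def U_def)
  ultimately show ?thesis
    using that by blast
qed

lemma carrier_stalk: "c \<in> carrier (stalk S x) \<longleftrightarrow> c \<in> topspace (etop S) \<and> proj S c = x"
  by (simp add: stalk_def)

text \<open>Any value at any arrow is attained. Since \<open>proj\<close> is a local homeomorphism,
  a continuous local section of it passes through \<open>c\<close>; it is pulled back along
  \<open>gran\<close> to a compact open bisection in \<open>W\<close> and extended by zero.\<close>

lemma elementary_section_through:
  assumes W: "openin (gtop G) W" and \<beta>: "\<beta> \<in> W" and c: "c \<in> carrier (stalk S (gran G \<beta>))"
  obtains f V where "f \<in> elementary_sections G S" "f \<beta> = c" "bisection G V" "\<beta> \<in> V" "V \<subseteq> W"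
    "\<And>\<gamma>. \<gamma> \<in> arrows G \<Longrightarrow> \<gamma> \<notin> V \<Longrightarrow> f \<gamma> = ezero S (gran G \<gamma>)"
proof -
  note p = proj_local_homeomorphism
  have op: "open_map (etop S) (unit_space G) (proj S)"
    using p by (rule local_homeomorphism_open_map)
  have c': "c \<in> topspace (etop S)" "proj S c = gran G \<beta>"
    using c by (auto simp: carrier_stalk)
  obtain Q where Q: "openin (etop S) Q" "c \<in> Q" "inj_on (proj S) Q"
    using local_homeomorphism_inj[OF p c'(1)] .
  let ?s = "inv_into Q (proj S)"
  have s: "continuous_map (subtopology (unit_space G) (proj S ` Q)) (etop S) ?s"
    by (rule open_map_continuous_inv_into[OF op Q(1,3)])
  have "openin (unit_space G) (proj S ` Q)"
    using op Q(1) by (auto simp: open_map_def)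
  then have "openin (gtop G) {\<gamma> \<in> W. gran G \<gamma> \<in> proj S ` Q}"
    by (rule openin_continuous_map_preimage_gen[OF continuous_gran W])
  moreover have "\<beta> \<in> {\<gamma> \<in> W. gran G \<gamma> \<in> proj S ` Q}"
    using \<beta> Q(2) c'(2) by force
  ultimately obtain V where V: "compact_open_bisection G V" "\<beta> \<in> V" "V \<subseteq> {\<gamma> \<in> W. gran G \<gamma> \<in> proj S ` Q}"
    by (rule compact_open_bisection_basis)
  have VG: "V \<subseteq> arrows G" "bisection G V"
    using V(1) by (auto simp: compact_open_bisection_def bisection_def)
  define f where "f = (\<lambda>\<gamma> \<in> arrows G. if \<gamma> \<in> V then ?s (gran G \<gamma>) else ezero S (gran G \<gamma>))"
  have sQ: "?s (gran G \<gamma>) \<in> carrier (stalk S (gran G \<gamma>))" if "\<gamma> \<in> V" for \<gamma>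
    using that V(3) openin_subset[OF Q(1)] by (auto simp: carrier_stalk f_inv_into_f subset_iff inv_into_into)
  have fA: "f \<in> carrier AS"
    unfolding f_def using sQ ezero_closed by (intro restrict_section) auto
  have "continuous_map (subtopology (gtop G) V) (etop S) (?s \<circ> gran G)"
  proof (rule continuous_map_compose[OF _ s])
    show "continuous_map (subtopology (gtop G) V) (subtopology (unit_space G) (proj S ` Q)) (gran G)"
      using V(3) by (intro continuous_map_into_subtopology continuous_map_from_subtopology continuous_gran) auto
  qed
  then have "continuous_map (subtopology (gtop G) V) (etop S) f"
    by (rule continuous_map_eq) (auto simp: f_def)
  moreover have off: "f \<gamma> = ezero S (gran G \<gamma>)" if "\<gamma> \<in> arrows G" "\<gamma> \<notin> V" for \<gamma>
    using that by (simp add: f_def)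
  ultimately have "f \<in> elementary_sections G S"
    unfolding elementary_sections_def using fA V(1) by blast
  moreover have "?s (gran G \<beta>) = c"
    using Q(2,3) c'(2) by (metis inv_into_f_f)
  then have "f \<beta> = c"
    using V(2) VG by (auto simp: f_def)
  ultimately show ?thesis
    using that[of f V] V(2,3) VG off by blast
qed

section \<open>The additive group of \<open>gamma_c\<close>, its density and its closure under
  convolution\<close>

abbreviation "A \<equiv> carrier (gamma_c G S)"

text \<open>A bisection meets each fibre of \<open>gdom\<close> in at most one arrow.\<close>

lemma elementary_sections_CS:
  assumes "f \<in> elementary_sections G S"
  shows "f \<in> carrier CS"
proof (rule CS_I)
  show "f \<in> carrier AS"
    using assms by (simp add: elementary_sections_def)
  obtain U where U: "compact_open_bisection G U" "\<forall>\<gamma> \<in> arrows G - U. f \<gamma> = ezero S (gran G \<gamma>)"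
    using assms by (auto simp: elementary_sections_def)
  have inj: "inj_on (gdom G) U"
    using U(1) by (auto simp: compact_open_bisection_def bisection_def)
  show "finite {\<gamma> \<in> arrows G. gdom G \<gamma> = y \<and> f \<gamma> \<noteq> ezero S (gran G \<gamma>)}" for y
  proof (rule finite_subset)
    show "{\<gamma> \<in> arrows G. gdom G \<gamma> = y \<and> f \<gamma> \<noteq> ezero S (gran G \<gamma>)} \<subseteq> gdom G -` {y} \<inter> U"
      using U(2) by auto
    show "finite (gdom G -` {y} \<inter> U)"
      by (rule finite_vimage_IntI) (use inj in auto)
  qed
qed

lemma subgroup_gamma_c: "subgroup A (add_monoid AS)"
proof -
  interpret AS: abelian_group AS by (rule abelian_group_AS)
  show ?thesis
    using AS.add.generate_is_subgroup[of "elementary_sections G S"] elementary_sections_CS CS_AS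
    by (auto simp: gamma_c_def)
qed

lemma gamma_c_CS: "f \<in> A \<Longrightarrow> f \<in> carrier CS"
proof -
  interpret AS: abelian_group AS by (rule abelian_group_AS)
  show "f \<in> A \<Longrightarrow> f \<in> carrier CS"
    using AS.add.generate_subgroup_incl[OF _ subgroup_CS, of "elementary_sections G S"] elementary_sections_CS
    by (auto simp: gamma_c_def)
qed

lemma elementary_sections_gamma_c: "f \<in> elementary_sections G S \<Longrightarrow> f \<in> A"
  by (auto simp: gamma_c_def intro: generate.incl)

lemma gamma_c_add: "f \<in> A \<Longrightarrow> g \<in> A \<Longrightarrow> f \<oplus>\<^bsub>AS\<^esub> g \<in> A"
  using subgroup.m_closed[OF subgroup_gamma_c] by simp

lemma gamma_c_zero: "\<zero>\<^bsub>AS\<^esub> \<in> A"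
  using subgroup.one_closed[OF subgroup_gamma_c] by simp

text \<open>Over \<open>Y\<close> only finitely many arrows carry nonzero values of
  \<open>u\<close>. They are corrected one at a time by adding elementary sections whose supports
  are so small that no other arrow over \<open>Y\<close> is disturbed.\<close>

lemma gamma_c_dense:
  assumes u: "u \<in> carrier CS" and Y: "finite Y" "Y \<subseteq> units G"
  obtains h where "h \<in> A" "\<And>\<gamma>. \<gamma> \<in> arrows G \<Longrightarrow> gdom G \<gamma> \<in> Y \<Longrightarrow> h \<gamma> = u \<gamma>"
proof -
  define K where "K = (\<Union>y \<in> Y. column_support u y)"
  have "finite K"
    using u Y by (auto simp: K_def CS_column_support)
  have "K' \<subseteq> K \<Longrightarrow> \<exists>h \<in> A. \<forall>\<gamma> \<in> arrows G. gdom G \<gamma> \<in> Y \<longrightarrow>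
      h \<gamma> = (if \<gamma> \<in> K' then u \<gamma> else ezero S (gran G \<gamma>))" if "finite K'" for K'
    using that
  proof (induction K')
    case empty
    show ?case
      by (rule bexI[OF _ gamma_c_zero]) auto
  next
    case (insert \<beta> K')
    then obtain h where h: "h \<in> A"
      "\<And>\<gamma>. \<gamma> \<in> arrows G \<Longrightarrow> gdom G \<gamma> \<in> Y \<Longrightarrow> h \<gamma> = (if \<gamma> \<in> K' then u \<gamma> else ezero S (gran G \<gamma>))"
      by auto
    have \<beta>: "\<beta> \<in> arrows G" "gdom G \<beta> \<in> Y"
      using insert.prems by (auto simp: K_def column_support_def)
    \<comment> \<open>All points of \<open>Y\<close> other than the source of \<open>\<beta>\<close>
      are removed. The removed set is finite, hence closed in the Hausdorff unit space, so
      \<open>?W\<close> is open.\<close>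
    let ?W = "{\<gamma> \<in> topspace (gtop G). gdom G \<gamma> \<in> units G - (Y - {gdom G \<beta>})}"
    have "closedin (unit_space G) (Y - {gdom G \<beta>})"
      using Y by (intro closedin_Hausdorff_finite[OF unit_space_Hausdorff]) auto
    then have "openin (unit_space G) (units G - (Y - {gdom G \<beta>}))"
      using openin_diff[OF openin_topspace] by (metis topspace_unit_space)
    then have W: "openin (gtop G) ?W"
      by (rule openin_continuous_map_preimage[OF continuous_gdom])
    have \<beta>W: "\<beta> \<in> ?W"
      using \<beta> by auto
    obtain f V where f: "f \<in> elementary_sections G S" "f \<beta> = u \<beta>" "bisection G V" "\<beta> \<in> V" "V \<subseteq> ?W"
      "\<And>\<gamma>. \<gamma> \<in> arrows G \<Longrightarrow> \<gamma> \<notin> V \<Longrightarrow> f \<gamma> = ezero S (gran G \<gamma>)"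
      using elementary_section_through[OF W \<beta>W section_value[OF CS_AS[OF u] \<beta>(1)]] by blast
    show ?case
    proof (intro bexI[OF _ gamma_c_add[OF h(1) elementary_sections_gamma_c[OF f(1)]]] ballI impI)
      fix \<gamma> assume \<gamma>: "\<gamma> \<in> arrows G" "gdom G \<gamma> \<in> Y"
      interpret R: ring "stalk S (gran G \<gamma>)" by (rule ring_stalk_gran[OF \<gamma>(1)])
      have uv: "u \<gamma> \<in> carrier (stalk S (gran G \<gamma>))"
        using section_value[OF CS_AS[OF u] \<gamma>(1)] .
      \<comment> \<open>An arrow of \<open>V\<close> over \<open>Y\<close> has the source of
        \<open>\<beta>\<close> by the choice of \<open>?W\<close>, and \<open>gdom\<close> is
        injective on \<open>V\<close>.\<close>
      have fv: "f \<gamma> = (if \<gamma> = \<beta> then u \<beta> else ezero S (gran G \<gamma>))"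
      proof (cases "\<gamma> \<in> V")
        case True
        then have "gdom G \<gamma> = gdom G \<beta>"
          using f(5) \<gamma>(2) by auto
        then have "\<gamma> = \<beta>"
          using f(3,4) True by (auto simp: bisection_def inj_on_def)
        then show ?thesis using f(2) by simp
      qed (use f(4,6) \<gamma> in auto)
      show "(h \<oplus>\<^bsub>AS\<^esub> f) \<gamma> = (if \<gamma> \<in> insert \<beta> K' then u \<gamma> else ezero S (gran G \<gamma>))"
        using insert.hyps(2) uv R.l_zero[OF uv] R.r_zero[OF uv] R.l_zero[OF R.zero_closed]
        by (auto simp: \<gamma>(1) h(2)[OF \<gamma>] fv)
    qed
  qed
  from this[OF \<open>finite K\<close>] obtain h where h: "h \<in> A"
    "\<And>\<gamma>. \<gamma> \<in> arrows G \<Longrightarrow> gdom G \<gamma> \<in> Y \<Longrightarrow> h \<gamma> = (if \<gamma> \<in> K then u \<gamma> else ezero S (gran G \<gamma>))"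
    by auto
  show ?thesis
  proof (rule that[OF h(1)])
    show "h \<gamma> = u \<gamma>" if "\<gamma> \<in> arrows G" "gdom G \<gamma> \<in> Y" for \<gamma>
      using h(2)[OF that] that by (auto simp: K_def column_support_def)
  qed
qed

text \<open>The product lives on the set \<open>UV\<close> of products of composable arrows. An
  arrow of \<open>UV\<close> factors uniquely over \<open>U\<close> and \<open>V\<close>, and both
  factors depend continuously on it: the left one is the arrow of \<open>U\<close> with the given
  range, the right one is then obtained by division. Hence each value of the convolution is a single
  term, continuous in \<open>\<gamma>\<close>.\<close>

lemma elementary_sections_conv:
  assumes "f \<in> elementary_sections G S" "g \<in> elementary_sections G S"
  shows "f \<otimes>\<^bsub>AS\<^esub> g \<in> elementary_sections G S"
proof -
  obtain U where U: "compact_open_bisection G U" "continuous_map (subtopology (gtop G) U) (etop S) f"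
    and fU: "\<And>\<gamma>. \<gamma> \<in> arrows G \<Longrightarrow> \<gamma> \<notin> U \<Longrightarrow> f \<gamma> = ezero S (gran G \<gamma>)"
    using assms(1) by (auto simp: elementary_sections_def)
  obtain V where V: "compact_open_bisection G V" "continuous_map (subtopology (gtop G) V) (etop S) g"
    and gV: "\<And>\<gamma>. \<gamma> \<in> arrows G \<Longrightarrow> \<gamma> \<notin> V \<Longrightarrow> g \<gamma> = ezero S (gran G \<gamma>)"
    using assms(2) by (auto simp: elementary_sections_def)
  note f = elementary_sections_CS[OF assms(1)] and g = elementary_sections_CS[OF assms(2)]
  have U': "U \<subseteq> arrows G" "inj_on (gdom G) U" "inj_on (gran G) U" "openin (gtop G) U" "compactin (gtop G) U"
    using U(1) by (auto simp: compact_open_bisection_def bisection_def)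
  have V': "V \<subseteq> arrows G" "inj_on (gdom G) V" "inj_on (gran G) V" "openin (gtop G) V" "compactin (gtop G) V"
    using V(1) by (auto simp: compact_open_bisection_def bisection_def)
  let ?s = "inv_into U (gran G)"
  define D where "D = {\<gamma> \<in> arrows G. gran G \<gamma> \<in> gran G ` U}"
  \<comment> \<open>The only possible right factor once the left factor is taken in
    \<open>U\<close>; it makes sense on all of \<open>D\<close>, which is what allows
    \<open>W\<close> to be written as an open preimage.\<close>
  define \<theta> where "\<theta> \<gamma> = gmult G (ginv G (?s (gran G \<gamma>))) \<gamma>" for \<gamma>
  define W where "W = {\<gamma> \<in> D. \<theta> \<gamma> \<in> V}"
  have s: "?s (gran G \<gamma>) \<in> U" "gran G (?s (gran G \<gamma>)) = gran G \<gamma>" if "\<gamma> \<in> D" for \<gamma>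
    using that by (auto simp: D_def inv_into_into f_inv_into_f)
  have D: "openin (gtop G) D"
    using openin_continuous_map_preimage[OF continuous_gran, of "gran G ` U"] open_gran U'(4)
    by (simp add: D_def open_map_def)
  have cs: "continuous_map (subtopology (gtop G) D) (gtop G) (\<lambda>\<gamma>. ?s (gran G \<gamma>))"
  proof -
    have "continuous_map (subtopology (gtop G) D) (subtopology (unit_space G) (gran G ` U)) (gran G)"
      by (intro continuous_map_into_subtopology continuous_map_from_subtopology continuous_gran) (auto simp: D_def)
    from continuous_map_compose[OF this open_map_continuous_inv_into[OF open_gran U'(4,3)]] show ?thesis
      by (simp add: comp_def)
  qed
  have \<theta>: "\<theta> \<gamma> \<in> arrows G" "gran G (\<theta> \<gamma>) = gdom G (?s (gran G \<gamma>))" "gdom G (\<theta> \<gamma>) = gdom G \<gamma>"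
    "gmult G (?s (gran G \<gamma>)) (\<theta> \<gamma>) = \<gamma>" if "\<gamma> \<in> D" for \<gamma>
  proof -
    have *: "?s (gran G \<gamma>) \<in> arrows G" "\<gamma> \<in> arrows G" "gran G (?s (gran G \<gamma>)) = gran G \<gamma>"
      using s[OF that] U' that by (auto simp: D_def)
    show "\<theta> \<gamma> \<in> arrows G" "gran G (\<theta> \<gamma>) = gdom G (?s (gran G \<gamma>))" "gdom G (\<theta> \<gamma>) = gdom G \<gamma>"
      using * mult_closed ran_mult dom_mult by (simp_all add: \<theta>_def)
    show "gmult G (?s (gran G \<gamma>)) (\<theta> \<gamma>) = \<gamma>"
      using ginv_mult_cancel[of "ginv G (?s (gran G \<gamma>))" \<gamma>] * by (simp add: \<theta>_def)
  qed
  have c\<theta>: "continuous_map (subtopology (gtop G) D) (gtop G) \<theta>"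
  proof -
    have "continuous_map (subtopology (gtop G) D) (prod_topology (gtop G) (gtop G)) (\<lambda>\<gamma>. (ginv G (?s (gran G \<gamma>)), \<gamma>))"
      using continuous_map_compose[OF cs continuous_inv]
      by (intro continuous_map_pairedI) (auto simp: comp_def continuous_map_from_subtopology)
    then have "continuous_map (subtopology (gtop G) D)
       (subtopology (prod_topology (gtop G) (gtop G)) {(\<beta>, \<gamma>). gdom G \<beta> = gran G \<gamma>}) (\<lambda>\<gamma>. (ginv G (?s (gran G \<gamma>)), \<gamma>))"
      using s U' by (intro continuous_map_into_subtopology) (auto simp: subset_iff)
    from continuous_map_compose[OF this continuous_mult] show ?thesis
      by (simp add: comp_def \<theta>_def[abs_def])
  qed
  \<comment> \<open>The two descriptions of \<open>W\<close> serve different ends: as the preimage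
    of \<open>V\<close> under \<open>\<theta>\<close> it is open, as an image under multiplication
    it is compact.\<close>
  have W_eq: "W = (\<lambda>(\<beta>, \<rho>). gmult G \<beta> \<rho>) ` {(\<beta>, \<rho>) \<in> U \<times> V. gdom G \<beta> = gran G \<rho>}"
  proof (intro equalityI subsetI)
    fix \<gamma> assume "\<gamma> \<in> W"
    then have "\<gamma> \<in> D" "\<theta> \<gamma> \<in> V"
      by (auto simp: W_def)
    then show "\<gamma> \<in> (\<lambda>(\<beta>, \<rho>). gmult G \<beta> \<rho>) ` {(\<beta>, \<rho>) \<in> U \<times> V. gdom G \<beta> = gran G \<rho>}"
      using s[of \<gamma>] \<theta>(2,4)[of \<gamma>] by (intro image_eqI[of _ _ "(?s (gran G \<gamma>), \<theta> \<gamma>)"]) simp_all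
  next
    fix \<gamma> assume "\<gamma> \<in> (\<lambda>(\<beta>, \<rho>). gmult G \<beta> \<rho>) ` {(\<beta>, \<rho>) \<in> U \<times> V. gdom G \<beta> = gran G \<rho>}"
    then obtain \<beta> \<rho> where *: "\<beta> \<in> U" "\<rho> \<in> V" "gdom G \<beta> = gran G \<rho>" "\<gamma> = gmult G \<beta> \<rho>"
      by auto
    then have a: "\<beta> \<in> arrows G" "\<rho> \<in> arrows G"
      using U' V' by auto
    then have r: "gran G \<gamma> = gran G \<beta>"
      using * ran_mult by simp
    then have "?s (gran G \<gamma>) = \<beta>"
      using *(1) U'(3) by simp
    then have "\<theta> \<gamma> = \<rho>"
      using ginv_mult_cancel[OF a *(3)] * by (simp add: \<theta>_def)
    then show "\<gamma> \<in> W"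
      using * a r mult_closed by (auto simp: W_def D_def)
  qed
  have WD: "W \<subseteq> D" "W \<subseteq> arrows G"
    by (auto simp: W_def D_def)
  have Wopen: "openin (gtop G) W"
  proof -
    have "openin (subtopology (gtop G) D) {\<gamma> \<in> topspace (subtopology (gtop G) D). \<theta> \<gamma> \<in> V}"
      using c\<theta> V'(4) by (rule openin_continuous_map_preimage)
    moreover have "{\<gamma> \<in> topspace (subtopology (gtop G) D). \<theta> \<gamma> \<in> V} = W"
      by (auto simp: W_def D_def)
    ultimately show ?thesis
      using D openin_trans_full by metis
  qed
  have Wcompact: "compactin (gtop G) W"
  proof -
    let ?P = "subtopology (prod_topology (gtop G) (gtop G)) (U \<times> V)"
    have "continuous_map ?P (unit_space G) (gdom G \<circ> fst)" "continuous_map ?P (unit_space G) (gran G \<circ> snd)"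
      by (intro continuous_map_from_subtopology continuous_map_compose[OF continuous_map_fst continuous_gdom]
          continuous_map_compose[OF continuous_map_snd continuous_gran])+
    from closedin_continuous_maps_eq[OF unit_space_Hausdorff this]
    \<comment> \<open>Composability is the equality of two continuous maps into a Hausdorff space,
      so the composable pairs form a closed subset of the compact
      \<open>U \<times> V\<close>.\<close>
    have "closedin ?P {p \<in> topspace ?P. (gdom G \<circ> fst) p = (gran G \<circ> snd) p}" .
    moreover have "compactin ?P (U \<times> V)"
      using U'(5) V'(5) by (simp add: compactin_subtopology compactin_Times)
    moreover have sub: "{p \<in> topspace ?P. (gdom G \<circ> fst) p = (gran G \<circ> snd) p} = {(\<beta>, \<rho>) \<in> U \<times> V. gdom G \<beta> = gran G \<rho>}"
      using U' V' by auto
    ultimately have "compactin ?P {(\<beta>, \<rho>) \<in> U \<times> V. gdom G \<beta> = gran G \<rho>}"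
      using closed_compactin[of ?P "U \<times> V"] by auto
    \<comment> \<open>Multiplication is continuous only on the space of composable pairs, so
      compactness is transferred to that subspace before taking the image.\<close>
    then have "compactin (subtopology (prod_topology (gtop G) (gtop G)) {(\<beta>, \<gamma>). gdom G \<beta> = gran G \<gamma>})
        {(\<beta>, \<rho>) \<in> U \<times> V. gdom G \<beta> = gran G \<rho>}"
      by (auto simp: compactin_subtopology)
    then show ?thesis
      unfolding W_eq using continuous_mult by (rule image_compactin)
  qed
  have "bisection G W"
    unfolding bisection_def
  proof (intro conjI inj_onI WD)
    fix \<gamma> \<gamma>' assume \<gamma>: "\<gamma> \<in> W" "\<gamma>' \<in> W"
    then have "\<theta> \<gamma> \<in> V" "\<theta> \<gamma>' \<in> V" "\<gamma> \<in> D" "\<gamma>' \<in> D"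
      by (auto simp: W_def)
    note * = this \<theta>[OF this(3)] \<theta>[OF this(4)] s[OF this(3)] s[OF this(4)]
    show "\<gamma> = \<gamma>'" if "gran G \<gamma> = gran G \<gamma>'"
    proof -
      have "gran G (\<theta> \<gamma>) = gran G (\<theta> \<gamma>')"
        using * that by simp
      then have "\<theta> \<gamma> = \<theta> \<gamma>'"
        using * V'(3) by (simp add: inj_on_def)
      then show ?thesis
        using *(8,12) that by metis
    qed
    show "\<gamma> = \<gamma>'" if "gdom G \<gamma> = gdom G \<gamma>'"
    proof -
      have "\<theta> \<gamma> = \<theta> \<gamma>'"
        using * V'(2) that by (simp add: inj_on_def)
      moreover from this have "?s (gran G \<gamma>) = ?s (gran G \<gamma>')"
        using * U'(2) by (metis inj_onD)
      ultimately show ?thesis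
        using *(8,12) by metis
    qed
  qed
  then have "compact_open_bisection G W"
    using Wopen Wcompact by (simp add: compact_open_bisection_def bisection_Hausdorff)
  moreover have "(f \<otimes>\<^bsub>AS\<^esub> g) \<gamma> = ezero S (gran G \<gamma>)" if \<gamma>: "\<gamma> \<in> arrows G" "\<gamma> \<notin> W" for \<gamma>
  proof (rule conv_zero[OF f g \<gamma>(1)], rule ccontr)
    fix \<rho> assume \<rho>: "\<rho> \<in> arrows G" "gdom G \<rho> = gdom G \<gamma>" "g \<rho> \<noteq> ezero S (gran G \<rho>)"
      "f (gdiv \<gamma> \<rho>) \<noteq> ezero S (gran G \<gamma>)"
    then have "\<rho> \<in> V" "gdiv \<gamma> \<rho> \<in> U"
      using gV[of \<rho>] fU[of "gdiv \<gamma> \<rho>"] \<gamma> by auto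
    then have "(gdiv \<gamma> \<rho>, \<rho>) \<in> {(\<beta>, \<rho>) \<in> U \<times> V. gdom G \<beta> = gran G \<rho>}"
      using \<rho> \<gamma> by simp
    then have "gmult G (gdiv \<gamma> \<rho>) \<rho> \<in> W"
      unfolding W_eq by (metis (no_types, lifting) image_eqI split_conv)
    then show False
      using \<rho> \<gamma> by simp
  qed
  moreover have "continuous_map (subtopology (gtop G) W) (etop S) (f \<otimes>\<^bsub>AS\<^esub> g)"
  proof -
    let ?TW = "subtopology (gtop G) W"
    have cs': "continuous_map ?TW (gtop G) (\<lambda>\<gamma>. ?s (gran G \<gamma>))" and c\<theta>': "continuous_map ?TW (gtop G) \<theta>"
      using cs c\<theta> WD(1) continuous_map_from_subtopology_mono by blast+
    have "continuous_map ?TW (subtopology (gtop G) U) (\<lambda>\<gamma>. ?s (gran G \<gamma>))"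
      using cs' s WD by (intro continuous_map_into_subtopology) auto
    from continuous_map_compose[OF this U(2)]
    have cf: "continuous_map ?TW (etop S) (\<lambda>\<gamma>. f (?s (gran G \<gamma>)))"
      by (simp add: comp_def)
    have "continuous_map ?TW (subtopology (gtop G) V) \<theta>"
      using c\<theta>' by (intro continuous_map_into_subtopology) (auto simp: W_def)
    from continuous_map_compose[OF this V(2)]
    have cg: "continuous_map ?TW (etop S) (\<lambda>\<gamma>. g (\<theta> \<gamma>))"
      by (simp add: comp_def)
    have gv: "g (\<theta> \<gamma>) \<in> carrier (stalk S (gdom G (?s (gran G \<gamma>))))" and fv: "f (?s (gran G \<gamma>)) \<in> carrier (stalk S (gran G \<gamma>))"
      if "\<gamma> \<in> W" for \<gamma>
    proof -
      have "\<gamma> \<in> D" using that WD by auto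
      then show "g (\<theta> \<gamma>) \<in> carrier (stalk S (gdom G (?s (gran G \<gamma>))))"
        using section_value[OF CS_AS[OF g], of "\<theta> \<gamma>"] \<theta> by metis
      show "f (?s (gran G \<gamma>)) \<in> carrier (stalk S (gran G \<gamma>))"
        using section_value[OF CS_AS[OF f], of "?s (gran G \<gamma>)"] s[OF \<open>\<gamma> \<in> D\<close>] U'(1) by (metis subsetD)
    qed
    have "continuous_map ?TW (subtopology (prod_topology (gtop G) (etop S)) {(\<gamma>, e). gdom G \<gamma> = proj S e})
        (\<lambda>\<gamma>. (?s (gran G \<gamma>), g (\<theta> \<gamma>)))"
      using cs' cg gv by (intro continuous_map_into_subtopology continuous_map_pairedI) (auto simp: carrier_stalk)
    from continuous_map_compose[OF this continuous_act]
    have ca: "continuous_map ?TW (etop S) (\<lambda>\<gamma>. act S (?s (gran G \<gamma>)) (g (\<theta> \<gamma>)))"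
      by (simp add: comp_def)
    have av: "act S (?s (gran G \<gamma>)) (g (\<theta> \<gamma>)) \<in> carrier (stalk S (gran G \<gamma>))" if "\<gamma> \<in> W" for \<gamma>
    proof -
      have "\<gamma> \<in> D" using that WD by auto
      then show ?thesis
        using act_closed[OF _ gv[OF that]] s[of \<gamma>] U'(1) by (metis subsetD)
    qed
    have "continuous_map ?TW (subtopology (prod_topology (etop S) (etop S)) {(a, b). proj S a = proj S b})
        (\<lambda>\<gamma>. (f (?s (gran G \<gamma>)), act S (?s (gran G \<gamma>)) (g (\<theta> \<gamma>))))"
      using cf ca fv av by (intro continuous_map_into_subtopology continuous_map_pairedI) (auto simp: carrier_stalk)
    from continuous_map_compose[OF this continuous_emult]
    have "continuous_map ?TW (etop S) (\<lambda>\<gamma>. emult S (f (?s (gran G \<gamma>))) (act S (?s (gran G \<gamma>)) (g (\<theta> \<gamma>))))"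
      by (simp add: comp_def)
    then show ?thesis
    proof (rule continuous_map_eq)
      fix \<gamma> assume "\<gamma> \<in> topspace ?TW"
      then have "\<gamma> \<in> W" "\<gamma> \<in> D" "\<gamma> \<in> arrows G" "\<theta> \<gamma> \<in> V"
        using WD by (auto simp: W_def)
      note * = this \<theta>[OF this(2)] s[OF this(2)]
      have sG: "?s (gran G \<gamma>) \<in> arrows G"
        using * U'(1) by auto
      have "gdiv \<gamma> (\<theta> \<gamma>) = ?s (gran G \<gamma>)"
        using mult_gdiv[OF sG *(5)] * by simp
      moreover have "(f \<otimes>\<^bsub>AS\<^esub> g) \<gamma> = emult S (f (gdiv \<gamma> (\<theta> \<gamma>))) (act S (gdiv \<gamma> (\<theta> \<gamma>)) (g (\<theta> \<gamma>)))"
      proof (rule conv_single[OF f g *(3) *(5) *(7)])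
        fix \<rho> assume \<rho>: "\<rho> \<in> arrows G" "gdom G \<rho> = gdom G \<gamma>" "\<rho> \<noteq> \<theta> \<gamma>" "g \<rho> \<noteq> ezero S (gran G \<rho>)"
        then have "\<rho> \<in> V"
          using gV by blast
        then have "\<rho> = \<theta> \<gamma>"
          using * \<rho> V'(2) by (simp add: inj_on_def)
        with \<rho> show "f (gdiv \<gamma> \<rho>) = ezero S (gran G \<gamma>)" by simp
      qed
      ultimately show "emult S (f (?s (gran G \<gamma>))) (act S (?s (gran G \<gamma>)) (g (\<theta> \<gamma>))) = (f \<otimes>\<^bsub>AS\<^esub> g) \<gamma>"
        by simp
    qed
  qed
  ultimately show ?thesis
    using conv_in_AS[OF f g] by (auto simp: elementary_sections_def)
qed

text \<open>Products of elementary sections are elementary; biadditivity extends closure to the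
  generated groups, first in the right factor with an elementary left factor, then in the left
  factor.\<close>

lemma gamma_c_conv:
  assumes "f \<in> A" "g \<in> A"
  shows "f \<otimes>\<^bsub>AS\<^esub> g \<in> A"
proof -
  interpret C: ring CS by (rule ring_CS)
  interpret AS: abelian_group AS by (rule abelian_group_AS)
  \<comment> \<open>The group is generated inside \<open>AS\<close>, whereas the rules for products
    of negatives belong to the ring \<open>CS\<close>. The two negations have different carriers and
    are identified by uniqueness of the inverse.\<close>
  have minus: "\<ominus>\<^bsub>CS\<^esub> h = \<ominus>\<^bsub>AS\<^esub> h" if "h \<in> carrier CS" for h
  proof -
    have "h \<oplus>\<^bsub>AS\<^esub> \<ominus>\<^bsub>CS\<^esub> h = \<zero>\<^bsub>AS\<^esub>"
      using C.r_neg[OF that] by simp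
    then show ?thesis
      using that C.a_inv_closed[OF that] by (metis AS.minus_equality AS.a_comm CS_AS)
  qed
  have neg: "\<ominus>\<^bsub>AS\<^esub> h \<in> A" if "h \<in> A" for h
    using subgroup.m_inv_closed[OF subgroup_gamma_c that] by (simp add: a_inv_def)
  have A_gen: "A = generate (add_monoid AS) (elementary_sections G S)"
    by (simp add: gamma_c_def)
  have el: "f \<otimes>\<^bsub>AS\<^esub> g \<in> A" if f: "f \<in> elementary_sections G S" and g: "g \<in> A" for f g
    using g unfolding A_gen
  proof (induction rule: generate.induct)
    case one
    then show ?case
      using C.r_null[of f] elementary_sections_CS[OF f] gamma_c_zero A_gen by simp
  next
    case (incl h)
    then show ?case
      using elementary_sections_conv[OF f] elementary_sections_gamma_c A_gen by simp
  next
    case (inv h)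
    then have "f \<otimes>\<^bsub>AS\<^esub> \<ominus>\<^bsub>AS\<^esub> h \<in> A"
      using C.r_minus[of f h] elementary_sections_CS elementary_sections_conv[OF f] f minus conv_CS
        neg[OF elementary_sections_gamma_c] by simp
    then show ?case
      by (simp only: a_inv_def A_gen)
  next
    case (eng h1 h2)
    then show ?case
      using C.r_distr[of h1 h2 f] elementary_sections_CS[OF f] gamma_c_CS gamma_c_add A_gen by simp
  qed
  show ?thesis
    using assms(1) unfolding A_gen
  proof (induction rule: generate.induct)
    case one
    then show ?case
      using C.l_null[of g] gamma_c_CS[OF assms(2)] gamma_c_zero A_gen by simp
  next
    case (incl h)
    then show ?case
      using el assms(2) A_gen by simp
  next
    case (inv h)
    then have "\<ominus>\<^bsub>AS\<^esub> h \<otimes>\<^bsub>AS\<^esub> g \<in> A"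
      using C.l_minus[of h g] elementary_sections_CS gamma_c_CS[OF assms(2)] el[OF _ assms(2)] minus conv_CS neg
      by simp
    then show ?case
      by (simp only: a_inv_def A_gen)
  next
    case (eng h1 h2)
    then show ?case
      using C.l_distr[of h1 h2 g] gamma_c_CS[OF assms(2)] gamma_c_CS gamma_c_add A_gen by simp
  qed
qed

section \<open>Semiprimitivity\<close>

lemma gamma_c_eq: "gamma_c G S = CS\<lparr>carrier := A\<rparr>"
  by (simp add: gamma_c_def column_finite_sections_def)

text \<open>The analogue of a matrix unit: multiplying by it on the right moves the column over the
  range of \<open>\<beta>\<close> to the column over its source. It is column-finite, but need not
  lie in \<open>gamma_c\<close>, since single arrows need not be open.\<close>

definition point_section :: "'g \<Rightarrow> 'g \<Rightarrow> 'e" where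
  "point_section \<beta> = (\<lambda>\<gamma> \<in> arrows G. if \<gamma> = \<beta> then eone S (gran G \<beta>) else ezero S (gran G \<gamma>))"

lemma point_section_apply:
  "\<gamma> \<in> arrows G \<Longrightarrow> point_section \<beta> \<gamma> = (if \<gamma> = \<beta> then eone S (gran G \<beta>) else ezero S (gran G \<gamma>))"
  by (simp add: point_section_def)

lemma point_section_CS: "point_section \<beta> \<in> carrier CS"
proof (rule CS_I)
  show "point_section \<beta> \<in> carrier AS"
    unfolding point_section_def
    using ezero_closed eone_closed by (intro restrict_section) auto
  show "finite {\<gamma> \<in> arrows G. gdom G \<gamma> = y \<and> point_section \<beta> \<gamma> \<noteq> ezero S (gran G \<gamma>)}" for y
    by (rule finite_subset[of _ "{\<beta>}"]) (auto simp: point_section_apply split: if_splits)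
qed

text \<open>A left factor \<open>\<gamma> \<rho>^-1\<close> has the range of \<open>\<rho>\<close>
  as its source. So the value at \<open>\<gamma>\<close> sees \<open>f\<close> only on finitely many
  columns, which is what allows density to be used for a left factor.\<close>

lemma conv_cong_left:
  assumes f: "f \<in> carrier CS" "f' \<in> carrier CS" and g: "g \<in> carrier CS" and \<gamma>: "\<gamma> \<in> arrows G"
    and eq: "\<And>\<beta>. \<beta> \<in> arrows G \<Longrightarrow> gdom G \<beta> \<in> gran G ` column_support g (gdom G \<gamma>) \<Longrightarrow> f \<beta> = f' \<beta>"
  shows "(f \<otimes>\<^bsub>AS\<^esub> g) \<gamma> = (f' \<otimes>\<^bsub>AS\<^esub> g) \<gamma>"
proof -
  interpret R: ring "stalk S (gran G \<gamma>)" by (rule ring_stalk_gran[OF \<gamma>])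
  let ?K = "column_support g (gdom G \<gamma>)"
  show ?thesis
    unfolding CS_conv_apply[OF f(1) g \<gamma> CS_column_support[OF g] subset_refl column_support_subset]
      CS_conv_apply[OF f(2) g \<gamma> CS_column_support[OF g] subset_refl column_support_subset]
  proof (rule R.finsum_cong'[OF refl])
    fix \<rho> assume \<rho>: "\<rho> \<in> ?K"
    then have "f (gdiv \<gamma> \<rho>) = f' (gdiv \<gamma> \<rho>)"
      using eq[of "gdiv \<gamma> \<rho>"] \<gamma> by (simp add: column_support_def)
    then show "emult S (f (gdiv \<gamma> \<rho>)) (act S (gdiv \<gamma> \<rho>) (g \<rho>)) = emult S (f' (gdiv \<gamma> \<rho>)) (act S (gdiv \<gamma> \<rho>) (g \<rho>))"
      by simp
  qed (use f g \<gamma> in \<open>auto intro!: conv_term_closed CS_AS simp: column_support_def\<close>)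
qed

text \<open>The action of the inverse arrow undoes that of \<open>\<beta>\<close>, so no nonzero
  value is lost when it is moved along an arrow.\<close>

lemma act_eq_ezero_iff:
  assumes \<beta>: "\<beta> \<in> arrows G" and c: "c \<in> carrier (stalk S (gdom G \<beta>))"
  shows "act S \<beta> c = ezero S (gran G \<beta>) \<longleftrightarrow> c = ezero S (gdom G \<beta>)"
proof
  assume "act S \<beta> c = ezero S (gran G \<beta>)"
  then have "act S (ginv G \<beta>) (act S \<beta> c) = ezero S (gdom G \<beta>)"
    using act_ezero[of "ginv G \<beta>"] \<beta> by simp
  moreover have "act S (ginv G \<beta>) (act S \<beta> c) = act S (gdom G \<beta>) c"
    using act_act[of "ginv G \<beta>" \<beta> c] \<beta> c by (simp add: carrier_stalk gdom_def[of G \<beta>, symmetric])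
  moreover have "act S (gdom G \<beta>) c = c"
    using act_unit[of c] c by (simp add: carrier_stalk)
  ultimately show "c = ezero S (gdom G \<beta>)" by simp
qed (use act_ezero[OF \<beta>] in simp)


lemma subgroup_gamma_c_CS: "subgroup A (add_monoid CS)"
proof -
  interpret AS: abelian_group AS by (rule abelian_group_AS)
  have "add_monoid CS = (add_monoid AS)\<lparr>carrier := carrier CS\<rparr>"
    by (simp add: column_finite_sections_def)
  then show ?thesis
    using group.subgroup_incl[OF AS.a_group subgroup_gamma_c subgroup_CS] gamma_c_CS by auto
qed

text \<open>The sections called \<open>t\<close> and \<open>s\<close> in the overview are
  \<open>point_section \<tau>\<close> and \<open>t\<close> here. The approximation \<open>t\<close>
  has to be chosen before \<open>h\<close>, because the columns on which \<open>h\<close> must agree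
  with \<open>bk\<close> are read off from the support of \<open>ft\<close> over
  \<open>x\<close>.\<close>

lemma corner_left_quasi_regular:
  assumes x: "x \<in> units G" and f: "f \<in> jacobson_radical (gamma_c G S)"
    and k: "k \<in> carrier CS" and \<tau>: "\<tau> \<in> arrows G" "gdom G \<tau> = x"
    and b: "b \<in> carrier (corner x)"
    and F: "k \<otimes>\<^bsub>AS\<^esub> f \<otimes>\<^bsub>AS\<^esub> point_section \<tau> \<in> carrier (corner x)" (is "?F \<in> _")
  shows "\<exists>a \<in> carrier (corner x). a = b \<otimes>\<^bsub>AS\<^esub> ?F \<oplus>\<^bsub>AS\<^esub> a \<otimes>\<^bsub>AS\<^esub> (b \<otimes>\<^bsub>AS\<^esub> ?F)"
proof -
  interpret C: ring CS by (rule ring_CS)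
  interpret D: ring "corner x" by (rule ring_corner[OF x])
  have Y: "{x} \<subseteq> units G" using x by simp
  define e where "e = unit_section {x}"
  define T where "T = point_section \<tau>"
  have e: "e \<in> carrier CS" and T: "T \<in> carrier CS"
    using unit_section_CS[OF Y] point_section_CS by (auto simp: e_def T_def)
  have fA: "f \<in> A"
    using f by (simp add: jacobson_radical_def)
  note fC = gamma_c_CS[OF fA]
  have corner: "u \<in> carrier CS \<and> e \<otimes>\<^bsub>AS\<^esub> u = u \<and> u \<otimes>\<^bsub>AS\<^esub> e = u" if "u \<in> carrier (corner x)" for u
    using that by (simp add: corner_def e_def)
  have eqI: "u \<otimes>\<^bsub>AS\<^esub> e = v \<otimes>\<^bsub>AS\<^esub> e"
    if "u \<in> carrier CS" "v \<in> carrier CS" "\<And>\<gamma>. \<gamma> \<in> arrows G \<Longrightarrow> gdom G \<gamma> = x \<Longrightarrow> u \<gamma> = v \<gamma>" for u v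
    by (rule section_eqI) (use that Y conv_in_AS[OF _ e] in \<open>auto simp: e_def conv_unit_section\<close>)
  obtain t where t: "t \<in> A" and tT: "\<And>\<gamma>. \<gamma> \<in> arrows G \<Longrightarrow> gdom G \<gamma> \<in> {x} \<Longrightarrow> t \<gamma> = T \<gamma>"
    \<comment> \<open>Multiplication by \<open>e\<close> on the right keeps only the column over
      \<open>x\<close>, so agreement on that one column suffices. As \<open>\<tau>\<close> starts at
      \<open>x\<close>, \<open>Te = T\<close> holds as well.\<close>
    using gamma_c_dense[OF T _ Y] by blast
  note tC = gamma_c_CS[OF t]
  have te: "t \<otimes>\<^bsub>AS\<^esub> e = T \<otimes>\<^bsub>AS\<^esub> e"
    using eqI[OF tC T] tT by simp
  have Te: "T \<otimes>\<^bsub>AS\<^esub> e = T"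
    by (rule section_eqI) (use T e Y conv_in_AS \<tau> in
        \<open>auto simp: CS_AS e_def conv_unit_section T_def point_section_apply\<close>)
  define g where "g = f \<otimes>\<^bsub>AS\<^esub> t"
  have gA: "g \<in> A"
    using gamma_c_conv[OF fA t] by (simp add: g_def)
  note gC = gamma_c_CS[OF gA]
  have ge: "g \<otimes>\<^bsub>AS\<^esub> e = f \<otimes>\<^bsub>AS\<^esub> T"
    using C.m_assoc[OF fC tC e] te Te by (simp add: g_def)
  have bC: "b \<in> carrier CS"
    using corner[OF b] by simp
  define u where "u = b \<otimes>\<^bsub>AS\<^esub> k"
  have uC: "u \<in> carrier CS"
    using conv_CS[OF bC k] by (simp add: u_def)
  \<comment> \<open>The sources of the possible left factors in column \<open>x\<close> of a product
    with \<open>g\<close>: a finite set, over which \<open>h\<close> is made equal to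
    \<open>bk\<close>.\<close>
  have "gran G ` column_support g x \<subseteq> units G"
    by (auto simp: column_support_def)
  then obtain h where h: "h \<in> A" and hu: "\<And>\<gamma>. \<gamma> \<in> arrows G \<Longrightarrow> gdom G \<gamma> \<in> gran G ` column_support g x \<Longrightarrow> h \<gamma> = u \<gamma>"
    using gamma_c_dense[OF uC finite_imageI[OF CS_column_support[OF gC]]] by blast
  note hC = gamma_c_CS[OF h]
  define p where "p = h \<otimes>\<^bsub>AS\<^esub> f \<otimes>\<^bsub>AS\<^esub> t"
  have pC: "p \<in> carrier CS"
    using conv_CS hC fC tC by (simp add: p_def)
  have "p \<otimes>\<^bsub>AS\<^esub> e = (h \<otimes>\<^bsub>AS\<^esub> g) \<otimes>\<^bsub>AS\<^esub> e"
    using C.m_assoc[OF hC fC tC] by (simp add: p_def g_def)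
  also have "\<dots> = (u \<otimes>\<^bsub>AS\<^esub> g) \<otimes>\<^bsub>AS\<^esub> e"
    by (rule eqI) (use conv_CS hC uC gC hu in \<open>auto intro!: conv_cong_left\<close>)
  also have "\<dots> = u \<otimes>\<^bsub>AS\<^esub> (f \<otimes>\<^bsub>AS\<^esub> T)"
    using C.m_assoc[OF uC gC e] ge by simp
  also have "\<dots> = b \<otimes>\<^bsub>AS\<^esub> ?F"
    using C.m_assoc[OF bC k conv_CS[OF fC T]] C.m_assoc[OF k fC T] by (simp add: u_def T_def)
  finally have pe: "p \<otimes>\<^bsub>AS\<^esub> e = b \<otimes>\<^bsub>AS\<^esub> ?F" .
  have bF: "b \<otimes>\<^bsub>AS\<^esub> ?F \<in> carrier (corner x)"
    using D.m_closed[OF b F] by simp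
  have "f \<in> jacobson_radical (CS\<lparr>carrier := A\<rparr>)"
    using f by (subst gamma_c_eq[symmetric])
  then have "\<exists>a \<in> A. a = p \<oplus>\<^bsub>AS\<^esub> a \<otimes>\<^bsub>AS\<^esub> p"
    using C.jacobson_radical_left_quasi_regular_mult[OF subgroup_gamma_c_CS _ _ h t] gamma_c_conv by (simp add: p_def)
  then obtain a where a: "a \<in> A" and ap: "a = p \<oplus>\<^bsub>AS\<^esub> a \<otimes>\<^bsub>AS\<^esub> p"
    by blast
  note aC = gamma_c_CS[OF a]
  define q where "q = b \<otimes>\<^bsub>AS\<^esub> ?F"
  have q: "q \<in> carrier CS" "e \<otimes>\<^bsub>AS\<^esub> q = q" "p \<otimes>\<^bsub>AS\<^esub> e = q"
    using corner[OF bF] pe by (auto simp: q_def)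
  \<comment> \<open>Multiply \<open>a = p + ap\<close> by \<open>e\<close> on the right and use
    \<open>pe = q\<close>.\<close>
  have ae: "a \<otimes>\<^bsub>AS\<^esub> e = q \<oplus>\<^bsub>AS\<^esub> a \<otimes>\<^bsub>AS\<^esub> q"
  proof -
    have "a \<otimes>\<^bsub>AS\<^esub> e = (p \<oplus>\<^bsub>AS\<^esub> a \<otimes>\<^bsub>AS\<^esub> p) \<otimes>\<^bsub>AS\<^esub> e"
      using ap by simp
    also have "\<dots> = p \<otimes>\<^bsub>AS\<^esub> e \<oplus>\<^bsub>AS\<^esub> a \<otimes>\<^bsub>AS\<^esub> p \<otimes>\<^bsub>AS\<^esub> e"
      using C.l_distr[OF pC conv_CS[OF aC pC] e] by simp
    also have "\<dots> = q \<oplus>\<^bsub>AS\<^esub> a \<otimes>\<^bsub>AS\<^esub> q"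
      using C.m_assoc[OF aC pC e] q by simp
    finally show ?thesis .
  qed
  \<comment> \<open>Left multiplication of the previous equation by \<open>e\<close> gives
    \<open>eae = q + eaq\<close>. Since \<open>q = eq\<close>, the last summand is
    \<open>(eae)q\<close>, so the compressed element satisfies the same kind of equation inside the
    corner.\<close>
  define a' where "a' = e \<otimes>\<^bsub>AS\<^esub> (a \<otimes>\<^bsub>AS\<^esub> e)"
  have ee: "e \<otimes>\<^bsub>AS\<^esub> e = e"
    using D.l_one[OF D.one_closed] by (simp add: e_def)
  have aeC: "a \<otimes>\<^bsub>AS\<^esub> e \<in> carrier CS" "a \<otimes>\<^bsub>AS\<^esub> q \<in> carrier CS"
    using conv_CS aC e q by auto
  have "a' \<in> carrier (corner x)"
  proof -
    have "e \<otimes>\<^bsub>AS\<^esub> a' = a'"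
      using C.m_assoc[OF e e aeC(1)] ee by (simp add: a'_def)
    moreover have "a' \<otimes>\<^bsub>AS\<^esub> e = a'"
      using C.m_assoc[OF e aeC(1) e] C.m_assoc[OF aC e e] ee by (simp add: a'_def)
    moreover have "a' \<in> carrier CS"
      using conv_CS[OF e aeC(1)] by (simp add: a'_def)
    ultimately show ?thesis
      by (simp add: corner_def e_def)
  qed
  moreover have "a' = q \<oplus>\<^bsub>AS\<^esub> a' \<otimes>\<^bsub>AS\<^esub> q"
  proof -
    have "a' = q \<oplus>\<^bsub>AS\<^esub> e \<otimes>\<^bsub>AS\<^esub> (a \<otimes>\<^bsub>AS\<^esub> q)"
      using C.r_distr[OF q(1) aeC(2) e] q by (simp add: a'_def ae)
    also have "e \<otimes>\<^bsub>AS\<^esub> (a \<otimes>\<^bsub>AS\<^esub> q) = a' \<otimes>\<^bsub>AS\<^esub> q"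
      using C.m_assoc[OF e aeC(1) q(1)] C.m_assoc[OF aC e q(1)] q by (simp add: a'_def)
    finally show ?thesis .
  qed
  ultimately show ?thesis
    unfolding q_def by blast
qed

text \<open>The entry of \<open>?F\<close> at the unit \<open>x\<close> is the image of
  \<open>f \<gamma>\<close> under an invertible action map. Since \<open>?F\<close> restricts to a
  radical element of a semiprimitive ring, this entry vanishes, and \<open>f \<gamma>\<close> with
  it.\<close>

lemma jacobson_radical_vanishes:
  assumes f: "f \<in> jacobson_radical (gamma_c G S)" and \<gamma>: "\<gamma> \<in> arrows G"
    and x: "x \<in> orbit G (gdom G \<gamma>)" and sp: "semiprimitive (isotropy_skew_ring G S x)"
  shows "f \<gamma> = ezero S (gran G \<gamma>)"
proof -
  obtain \<sigma> where \<sigma>: "\<sigma> \<in> arrows G" "gdom G \<sigma> = gdom G \<gamma>" "gran G \<sigma> = x"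
    using x by (auto simp: orbit_def)
  then have xu: "x \<in> units G"
    using gran_units by blast
  have xx: "x \<in> arrows G" "gdom G x = x" "gran G x = x"
    using xu units_arrows by auto
  define \<tau> where "\<tau> = ginv G \<sigma>"
  have \<tau>: "\<tau> \<in> arrows G" "gdom G \<tau> = x" "gran G \<tau> = gdom G \<gamma>"
    using \<sigma> by (auto simp: \<tau>_def)
  \<comment> \<open>Here \<open>\<tau>\<close> runs from \<open>x\<close> to the source of
    \<open>\<gamma>\<close> and \<open>\<kappa>\<close> from \<open>x\<close> to its range, so
    \<open>x = \<kappa>^-1 \<gamma> \<tau>\<close>. The two point sections single out exactly this
    factorisation in the triple product.\<close>
  define \<kappa> where "\<kappa> = gmult G \<gamma> \<tau>"
  have \<kappa>: "\<kappa> \<in> arrows G" "gdom G \<kappa> = x" "gran G \<kappa> = gran G \<gamma>"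
    using \<tau> \<gamma> by (auto simp: \<kappa>_def mult_closed dom_mult ran_mult)
  have f\<kappa>: "gdiv \<kappa> \<tau> = \<gamma>"
    using \<tau> \<gamma> by (simp add: \<kappa>_def)
  let ?k = "point_section (ginv G \<kappa>)" and ?T = "point_section \<tau>"
  let ?F = "?k \<otimes>\<^bsub>AS\<^esub> f \<otimes>\<^bsub>AS\<^esub> ?T"
  interpret C: ring CS by (rule ring_CS)
  interpret B: ring "isotropy_skew_ring G S x" by (rule ring_isotropy_skew_ring[OF xu])
  have fC: "f \<in> carrier CS"
    using f gamma_c_CS by (simp add: jacobson_radical_def)
  note k = point_section_CS[of "ginv G \<kappa>"] and T = point_section_CS[of \<tau>]
  note kf = conv_CS[OF k fC] and fT = conv_CS[OF fC T]
  have F_eq: "?F = ?k \<otimes>\<^bsub>AS\<^esub> (f \<otimes>\<^bsub>AS\<^esub> ?T)"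
    using conv_assoc[OF k fC T] .
  have F: "?F \<in> carrier (corner x)"
    unfolding carrier_corner[OF xu]
  proof (intro conjI ballI impI)
    show "?F \<in> carrier CS"
      using conv_CS[OF kf T] .
    fix \<delta> assume \<delta>: "\<delta> \<in> arrows G" "gdom G \<delta> \<noteq> x \<or> gran G \<delta> \<noteq> x"
    \<comment> \<open>The right factor is supported at \<open>\<tau>\<close>, whose source is
      \<open>x\<close>, and the left factor at the inverse of \<open>\<kappa>\<close>, whose range
      is \<open>x\<close>. Each excludes one of the two cases, which is why both bracketings of the
      triple product are used.\<close>
    then consider "gdom G \<delta> \<noteq> x" | "gran G \<delta> \<noteq> x" by blast
    then show "?F \<delta> = ezero S (gran G \<delta>)"
    proof cases
      case 1
      show ?thesis
        by (rule conv_zero[OF kf T \<delta>(1)]) (use 1 \<tau> in \<open>auto simp: point_section_apply split: if_splits\<close>)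
    next
      case 2
      have "gdiv \<delta> \<rho> \<noteq> ginv G \<kappa>" if "\<rho> \<in> arrows G" "gdom G \<rho> = gdom G \<delta>" for \<rho>
        using 2 that \<delta> \<kappa> gran_gdiv[of \<delta> \<rho>] gran_ginv[of \<kappa>] by metis
      then show ?thesis
        unfolding F_eq using \<delta> by (intro conv_zero[OF k fT]) (auto simp: point_section_apply)
    qed
  qed
  have Fx: "?F x = act S (ginv G \<kappa>) (f \<gamma>)"
  proof -
    interpret R: ring "stalk S (gran G \<gamma>)" by (rule ring_stalk_gran[OF \<gamma>])
    interpret Rx: ring "stalk S x" by (rule ring_stalk[OF xu])
    have fv: "f \<gamma> \<in> carrier (stalk S (gran G \<gamma>))"
      using section_value[OF CS_AS[OF fC] \<gamma>] .
    have "(f \<otimes>\<^bsub>AS\<^esub> ?T) \<kappa> = emult S (f (gdiv \<kappa> \<tau>)) (act S (gdiv \<kappa> \<tau>) (?T \<tau>))"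
      by (rule conv_single[OF fC T \<kappa>(1) \<tau>(1)]) (use \<kappa> \<tau> in \<open>auto simp: point_section_apply\<close>)
    also have "\<dots> = f \<gamma>"
      using act_eone[OF \<gamma>] \<tau> R.r_one[OF fv]
      by (simp add: f\<kappa> point_section_apply)
    finally have 1: "(f \<otimes>\<^bsub>AS\<^esub> ?T) \<kappa> = f \<gamma>" .
    have xdiv: "gdiv x \<rho> = ginv G \<rho>" if "\<rho> \<in> arrows G" "gdom G \<rho> = x" for \<rho>
      using ran_mult_self[of "ginv G \<rho>"] that by (simp add: gdiv_def)
    have "?F x = emult S (?k (gdiv x \<kappa>)) (act S (gdiv x \<kappa>) ((f \<otimes>\<^bsub>AS\<^esub> ?T) \<kappa>))"
      unfolding F_eq
    proof (rule conv_single[OF k fT xx(1) \<kappa>(1)])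
      fix \<rho> assume \<rho>: "\<rho> \<in> arrows G" "gdom G \<rho> = gdom G x" "\<rho> \<noteq> \<kappa>"
      then have "ginv G \<rho> \<noteq> ginv G \<kappa>"
        using \<kappa>(1) by (metis inv_inv)
      then show "?k (gdiv x \<rho>) = ezero S (gran G x)"
        using \<rho> xx by (simp add: xdiv point_section_apply)
    qed (use \<kappa> xx in auto)
    also have "\<dots> = act S (ginv G \<kappa>) (f \<gamma>)"
      using \<kappa> fv act_closed[of "ginv G \<kappa>" "f \<gamma>"] Rx.l_one
      by (simp add: xdiv 1 point_section_apply)
    finally show ?thesis .
  qed
  let ?B = "isotropy_skew_ring G S x" and ?res = "\<lambda>u. restrict u (carrier (isotropy G x))"
  note iso = restrict_corner_iso[OF xu]
  have hom: "?res u \<in> carrier ?B" "?res (u \<otimes>\<^bsub>AS\<^esub> v) = ?res u \<otimes>\<^bsub>?B\<^esub> ?res v" "?res (u \<oplus>\<^bsub>AS\<^esub> v) = ?res u \<oplus>\<^bsub>?B\<^esub> ?res v"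
    if "u \<in> carrier (corner x)" "v \<in> carrier (corner x)" for u v
    using ring_iso_memE(1-3)[OF iso] that by simp_all
  interpret D: ring "corner x" by (rule ring_corner[OF xu])
  have "?res ?F \<in> jacobson_radical ?B"
  proof (rule B.left_quasi_regular_jacobson_radical)
    show "?res ?F \<in> carrier ?B"
      using hom(1)[OF F F] .
    fix b assume "b \<in> carrier ?B"
    then have "b \<in> ?res ` carrier (corner x)"
      using ring_iso_memE(5)[OF iso] by (simp add: bij_betw_def)
    then obtain b' where b': "b' \<in> carrier (corner x)" "b = ?res b'"
      by blast
    obtain a where a: "a \<in> carrier (corner x)" "a = b' \<otimes>\<^bsub>AS\<^esub> ?F \<oplus>\<^bsub>AS\<^esub> a \<otimes>\<^bsub>AS\<^esub> (b' \<otimes>\<^bsub>AS\<^esub> ?F)"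
      using corner_left_quasi_regular[OF xu f k \<tau>(1,2) b'(1) F] by blast
    have bF: "b' \<otimes>\<^bsub>AS\<^esub> ?F \<in> carrier (corner x)" "a \<otimes>\<^bsub>AS\<^esub> (b' \<otimes>\<^bsub>AS\<^esub> ?F) \<in> carrier (corner x)"
      using D.m_closed b'(1) a(1) F by auto
    have "?res a = ?res (b' \<otimes>\<^bsub>AS\<^esub> ?F \<oplus>\<^bsub>AS\<^esub> a \<otimes>\<^bsub>AS\<^esub> (b' \<otimes>\<^bsub>AS\<^esub> ?F))"
      using a(2) by (rule arg_cong)
    also have "\<dots> = b \<otimes>\<^bsub>?B\<^esub> ?res ?F \<oplus>\<^bsub>?B\<^esub> ?res a \<otimes>\<^bsub>?B\<^esub> (b \<otimes>\<^bsub>?B\<^esub> ?res ?F)"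
      unfolding hom(3)[OF bF] hom(2)[OF a(1) bF(1)] hom(2)[OF b'(1) F] b'(2) ..
    finally show "\<exists>a \<in> carrier ?B. a = b \<otimes>\<^bsub>?B\<^esub> ?res ?F \<oplus>\<^bsub>?B\<^esub> a \<otimes>\<^bsub>?B\<^esub> (b \<otimes>\<^bsub>?B\<^esub> ?res ?F)"
      using hom(1)[OF a(1) a(1)] by blast
  qed
  then have "?res ?F = \<zero>\<^bsub>?B\<^esub>"
    using sp by (simp add: semiprimitive_def)
  then have "?res ?F x = \<zero>\<^bsub>?B\<^esub> x"
    by (rule fun_cong)
  then have "?F x = ezero S x"
    using xx by (simp add: isotropy_skew_ring_def skew_group_ring_def carrier_isotropy)
  then show ?thesis
    using act_eq_ezero_iff[of "ginv G \<kappa>" "f \<gamma>"] \<kappa> section_value[OF CS_AS[OF fC] \<gamma>] by (simp add: Fx)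
qed

end

theorem theorem4p24:
  fixes G :: "'g groupoid" and S :: "('g, 'e) gsheaf_rings" and X :: "'g set"
  assumes "ample_groupoid G"
    and "gsheaf_of_rings G S"
    and "invariant_set G X"
    and "\<And>y. y \<in> units G \<Longrightarrow> orbit G y \<subseteq> X \<Longrightarrow>
           \<exists>x \<in> orbit G y. semiprimitive (isotropy_skew_ring G S x)"
    and "\<And>f. f \<in> carrier (gamma_c G S) \<Longrightarrow>
           (\<forall>\<gamma> \<in> restriction G X. f \<gamma> = ezero S (gran G \<gamma>)) \<Longrightarrow> f = \<zero>\<^bsub>gamma_c G S\<^esub>"
  shows "semiprimitive (gamma_c G S)"
proof -
  interpret ample_sheaf G S
    using assms(1,2) by (rule ample_sheaf.intro)
  have "f = \<zero>\<^bsub>gamma_c G S\<^esub>" if f: "f \<in> jacobson_radical (gamma_c G S)" for f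
  proof (rule assms(5))
    show "f \<in> carrier (gamma_c G S)"
      using f by (simp add: jacobson_radical_def)
    show "\<forall>\<gamma> \<in> restriction G X. f \<gamma> = ezero S (gran G \<gamma>)"
    proof
      fix \<gamma> assume "\<gamma> \<in> restriction G X"
      then have \<gamma>: "\<gamma> \<in> arrows G" "gdom G \<gamma> \<in> X"
        by (auto simp: restriction_def)
      \<comment> \<open>Invariance puts the whole orbit of the source of \<open>\<gamma>\<close>
        inside \<open>X\<close>, so the orbit contains a point with semiprimitive isotropy
        ring.\<close>
      have "gran G \<sigma> \<in> X" if "\<sigma> \<in> arrows G" "gdom G \<sigma> = gdom G \<gamma>" for \<sigma>
        using that assms(3) \<gamma>(2) unfolding invariant_set_def by metis
      then have "orbit G (gdom G \<gamma>) \<subseteq> X"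
        by (auto simp: orbit_def)
      then obtain x where "x \<in> orbit G (gdom G \<gamma>)" "semiprimitive (isotropy_skew_ring G S x)"
        using assms(4)[of "gdom G \<gamma>"] \<gamma>(1) by auto
      then show "f \<gamma> = ezero S (gran G \<gamma>)"
        by (rule jacobson_radical_vanishes[OF f \<gamma>(1)])
    qed
  qed
  \<comment> \<open>Semiprimitivity is an equality of sets, so zero must also be placed in the
    radical.\<close>
  moreover have "\<zero>\<^bsub>gamma_c G S\<^esub> = \<zero>\<^bsub>AS\<^esub>"
    by (simp add: gamma_c_def)
  then have "\<zero>\<^bsub>gamma_c G S\<^esub> \<in> jacobson_radical (gamma_c G S)"
    using gamma_c_zero by (intro zero_in_jacobson_radical) (simp only:)
  ultimately show ?thesis
    unfolding semiprimitive_def by blast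
qed

end
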